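(* Let $H$ be a Hilbert space, let $\mathcal{A}\subset L(H)$ be a commutative $C^*$-algebra containing the identity $1$ of $L(H)$, and let $U\in L(H)$ be such that $\delta(a)=UaU^*$ is an endomorphism of $\mathcal{A}$. Moreover, let $U^*U\in\mathcal{A}$. Let $\alpha:\Delta\to M(\mathcal{A})$ be the partial mapping associated with $\delta$, and put $$\widehat{M}_N=\{\widetilde{x}=(x_0,x_1,\dots,x_N,0,0,\dots):\ x_N\in\Delta_N,\ x_N\notin\Delta_{-1},\ \alpha(x_n)=x_{n-1}\ (1\le n\le N)\},\qquad N=0,1,2,\dots,$$ $$M_\infty=\{\widetilde{x}=(x_0,x_1,\dots):\ x_n\in\Delta_n\cap\Delta_{-\infty}\ (n\ge 0),\ \alpha(x_n)=x_{n-1}\ (n\ge 1)\}.$$ Equip the disjoint union $\bigcup_{N=0}^\infty\widehat{M}_N\cup M_\infty$ with the topology in which a fundamental system of neighborhoods of a point $\widetilde{x}\in\widehat{M}_N$ is given by the sets $$O(a_1,\dots,a_k,\varepsilon)=\{\widetilde{y}\in\widehat{M}_N:\ |a_i(x_N)-a_i(y_N)|<\varepsilon,\ i=1,\dots,k\},$$ and a fundamental system of neighborhoods of a point $\widetilde{x}\in M_\infty$ is given by the sets $$O(a_1,\dots,a_k,n,\varepsilon)=\Big\{\widetilde{y}\in\bigcup_{N=n}^\infty\widehat{M}_N\cup M_\infty:\ |a_i(x_n)-a_i(y_n)|<\varepsilon,\ i=1,\dots,k\Big\},$$ where $\varepsilon>0$, $a_i\in\mathcal{A}$ and $k,n\in\mathbb{N}\cup\{0\}$.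 Then the mapping $\widetilde{x}\mapsto(\xi^0_{\widetilde{x}},\xi^1_{\widetilde{x}},\dots)$ is a homeomorphism $$M(\overline{E_*(\mathcal{A})})\cong\bigcup_{N=0}^\infty\widehat{M}_N\cup M_\infty$$ onto this countable union of disjoint sets, in which each $\widehat{M}_N$ is closed and open and $M_\infty$ is closed (some of these sets may be empty).
   Context: $L(H)$ is the algebra of bounded operators on $H$. Endomorphisms are $*$-homomorphisms into the same algebra, not necessarily unital. (Since $\delta$ is an endomorphism of $\mathcal{A}\ni 1$, $U$ is a partial isometry; and since $\mathcal{A}$ is commutative, $U^*U\in\mathcal{A}$ implies that $U^*U$ lies in the commutant $\mathcal{A}'$.) For a unital commutative $C^*$-algebra $\mathcal{B}$, $M(\mathcal{B})$ is its maximal ideal space, i.e. the space of nonzero multiplicative linear functionals with the weak-$*$ topology. $\mathcal{B}$ is identified with $C(M(\mathcal{B}))$ by the Gelfand transform, so $a(x)=x(a)$ for $a\in\mathcal{B}$, $x\in M(\mathcal{B})$. The partial mapping: $\Delta=\{\tau\in M(\mathcal{A}):\tau(UU^* )=1\}$ is closed and open, and $\alpha:\Delta\to M(\mathcal{A})$, $\alpha(\tau)=\tau\circ\delta$, is continuous; equivalently, for $f\in C(M(\mathcal{A}))$, $(\delta f)(x)=f(\alpha(x))$ if $x\in\Delta$ and $(\delta f)(x)=0$ if $x\notin\Delta$. For $n\ge 0$, $\Delta_n=\alpha^{-n}(M(\mathcal{A}))$ is the set on which $\alpha^n$ is defined (so $\Delta_0=M(\mathcal{A})$, $\Delta_1=\Delta$),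 and for $n\ge 1$, $\Delta_{-n}=\alpha^n(\Delta_n)$ is the image of $\alpha^n$; in particular $\Delta_{-1}=\alpha(\Delta)$. Finally $\Delta_{-\infty}=\bigcap_{n\ge 1}\Delta_{-n}$. The coefficient algebra: $\delta_*(x)=U^*xU$ for $x\in L(H)$, $\delta_*^0(x)=x$, and $\overline{E_*(\mathcal{A})}$ is the $C^*$-algebra generated by $\bigcup_{n=0}^\infty\delta_*^n(\mathcal{A})$. It is known that under the present hypotheses $\overline{E_*(\mathcal{A})}$ is commutative and that both $\delta$ and $\delta_*$ restrict to endomorphisms of it. For $\widetilde{x}\in M(\overline{E_*(\mathcal{A})})$ and $n\ge 0$, the functional $\xi^n_{\widetilde{x}}:\mathcal{A}\to\mathbb{C}$ is $\xi^n_{\widetilde{x}}(a)=\widetilde{x}(\delta_*^n(a))=\widetilde{x}(U^{*n}aU^n)$. It is multiplicative and linear, so it is either an element $x_n\in M(\mathcal{A})$ or the zero functional (written $0$). *)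

theory Defs
  imports "HOL-Analysis.Analysis"
begin

section \<open>Complex Hilbert spaces\<close>

text \<open>The inner product is linear in its first argument. The real vector space structure and the
  norm inherited from \<^class>\<open>real_normed_vector\<close> are tied to the complex ones by
  \<open>scaleR_scaleC\<close> and \<open>norm_eq_sqrt_cinner\<close>.\<close>

class complex_inner = real_normed_vector +
  fixes scaleC :: "complex \<Rightarrow> 'a \<Rightarrow> 'a" (infixr "*\<^sub>C" 75)
    and cinner :: "'a \<Rightarrow> 'a \<Rightarrow> complex"
  assumes scaleC_add_right: "c *\<^sub>C (x + y) = c *\<^sub>C x + c *\<^sub>C y"
    and scaleC_add_left: "(c + d) *\<^sub>C x = c *\<^sub>C x + d *\<^sub>C x"
    and scaleC_scaleC: "c *\<^sub>C (d *\<^sub>C x) = (c * d) *\<^sub>C x"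
    and scaleC_one: "1 *\<^sub>C x = x"
    and scaleR_scaleC: "r *\<^sub>R x = complex_of_real r *\<^sub>C x"
    and cinner_commute: "cinner x y = cnj (cinner y x)"
    and cinner_add_left: "cinner (x + y) z = cinner x z + cinner y z"
    and cinner_scaleC_left: "cinner (c *\<^sub>C x) y = c * cinner x y"
    and norm_eq_sqrt_cinner: "norm x = sqrt (cmod (cinner x x))"
    and cinner_ge_zero: "0 \<le> Re (cinner x x)"

class chilbert_space = complex_inner + complete_space

lemma norm_scaleC: "norm (c *\<^sub>C x) = cmod c * norm (x :: 'a :: complex_inner)"
proof -
  have "cinner (c *\<^sub>C x) (c *\<^sub>C x) = c * (cnj c * cinner x x)"
    by (metis cinner_commute cinner_scaleC_left complex_cnj_mult)
  then show ?thesis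
    by (simp add: norm_eq_sqrt_cinner norm_mult real_sqrt_mult flip: mult.assoc)
qed

lemma bounded_linear_scaleC: "bounded_linear ((*\<^sub>C) c :: 'a :: complex_inner \<Rightarrow> 'a)"
  by (rule bounded_linear_intro[of _ "cmod c"])
     (simp_all add: scaleC_add_right scaleR_scaleC scaleC_scaleC norm_scaleC mult.commute)


section \<open>Bounded operators\<close>

text \<open>\<^typ>\<open>'h \<Rightarrow>\<^sub>L 'h\<close> consists of the bounded \<^emph>\<open>real\<close>-linear maps, with the operator norm;
  \<open>L(H)\<close> is the set of complex-linear ones among them.\<close>

definition bounded_ops :: "('h :: complex_inner \<Rightarrow>\<^sub>L 'h) set" where
  "bounded_ops = {T. \<forall>c x. blinfun_apply T (c *\<^sub>C x) = c *\<^sub>C blinfun_apply T x}"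

definition cscale :: "complex \<Rightarrow> ('h :: complex_inner \<Rightarrow>\<^sub>L 'h) \<Rightarrow> ('h \<Rightarrow>\<^sub>L 'h)" where
  "cscale c T = Blinfun (\<lambda>x. c *\<^sub>C blinfun_apply T x)"

lemma cscale_apply [simp]: "blinfun_apply (cscale c T) x = c *\<^sub>C blinfun_apply T x"
  unfolding cscale_def
  by (subst bounded_linear_Blinfun_apply)
     (auto intro: bounded_linear_compose[OF bounded_linear_scaleC] blinfun.bounded_linear_right)

text \<open>By the Riesz representation theorem the adjoint exists for every operator in
  \<^term>\<open>bounded_ops\<close> on a Hilbert space; its uniqueness is \<open>adj_eqI\<close>.\<close>

definition adj :: "('h :: chilbert_space \<Rightarrow>\<^sub>L 'h) \<Rightarrow> ('h \<Rightarrow>\<^sub>L 'h)" where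
  "adj T = (THE S. \<forall>x y. cinner (blinfun_apply T x) y = cinner x (blinfun_apply S y))"

lemma adj_eqI:
  assumes "\<And>x y. cinner (blinfun_apply T x) y = cinner x (blinfun_apply S y)"
  shows "adj T = S"
  unfolding adj_def
proof (rule the_equality)
  show "\<forall>x y. cinner (blinfun_apply T x) y = cinner x (blinfun_apply S y)"
    using assms by blast
next
  fix R assume R: "\<forall>x y. cinner (blinfun_apply T x) y = cinner x (blinfun_apply R y)"
  show "R = S"
  proof (rule blinfun_eqI)
    fix y
    let ?d = "blinfun_apply R y - blinfun_apply S y"
    have *: "cinner (blinfun_apply R y) z = cinner (blinfun_apply S y) z" for z
      using R assms by (metis cinner_commute)
    have "cinner ?d z + cinner (blinfun_apply S y) z = cinner (blinfun_apply R y) z" for z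
      by (simp flip: cinner_add_left)
    with * have "cinner ?d ?d = 0"
      by (metis add_cancel_left_left)
    then have "norm ?d = 0"
      by (simp add: norm_eq_sqrt_cinner)
    then show "blinfun_apply R y = blinfun_apply S y"
      by simp
  qed
qed

definition cstar_algebra :: "('h :: chilbert_space \<Rightarrow>\<^sub>L 'h) set \<Rightarrow> bool" where
  "cstar_algebra A \<longleftrightarrow>
     A \<subseteq> bounded_ops \<and> 0 \<in> A \<and>
     (\<forall>a\<in>A. \<forall>b\<in>A. a + b \<in> A) \<and>
     (\<forall>c. \<forall>a\<in>A. cscale c a \<in> A) \<and>
     (\<forall>a\<in>A. \<forall>b\<in>A. a o\<^sub>L b \<in> A) \<and>
     (\<forall>a\<in>A. adj a \<in> A) \<and>
     closed A"

definition comm_cstar_algebra :: "('h :: chilbert_space \<Rightarrow>\<^sub>L 'h) set \<Rightarrow> bool" where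
  "comm_cstar_algebra A \<longleftrightarrow> cstar_algebra A \<and> (\<forall>a\<in>A. \<forall>b\<in>A. a o\<^sub>L b = b o\<^sub>L a)"

definition star_endomorphism ::
    "('h :: chilbert_space \<Rightarrow>\<^sub>L 'h) set \<Rightarrow> (('h \<Rightarrow>\<^sub>L 'h) \<Rightarrow> ('h \<Rightarrow>\<^sub>L 'h)) \<Rightarrow> bool" where
  "star_endomorphism A \<phi> \<longleftrightarrow>
     \<phi> ` A \<subseteq> A \<and>
     (\<forall>a\<in>A. \<forall>b\<in>A. \<phi> (a + b) = \<phi> a + \<phi> b) \<and>
     (\<forall>c. \<forall>a\<in>A. \<phi> (cscale c a) = cscale c (\<phi> a)) \<and>
     (\<forall>a\<in>A. \<forall>b\<in>A. \<phi> (a o\<^sub>L b) = \<phi> a o\<^sub>L \<phi> b) \<and>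
     (\<forall>a\<in>A. \<phi> (adj a) = adj (\<phi> a))"

definition delta :: "('h :: chilbert_space \<Rightarrow>\<^sub>L 'h) \<Rightarrow> ('h \<Rightarrow>\<^sub>L 'h) \<Rightarrow> ('h \<Rightarrow>\<^sub>L 'h)" where
  "delta U a = U o\<^sub>L a o\<^sub>L adj U"

definition delta_star :: "('h :: chilbert_space \<Rightarrow>\<^sub>L 'h) \<Rightarrow> ('h \<Rightarrow>\<^sub>L 'h) \<Rightarrow> ('h \<Rightarrow>\<^sub>L 'h)" where
  "delta_star U a = adj U o\<^sub>L a o\<^sub>L U"

definition coeff_algebra :: "('h :: chilbert_space \<Rightarrow>\<^sub>L 'h) set \<Rightarrow> ('h \<Rightarrow>\<^sub>L 'h) \<Rightarrow> ('h \<Rightarrow>\<^sub>L 'h) set" where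
  "coeff_algebra A U = cstar_algebra hull (\<Union>n. (delta_star U ^^ n) ` A)"


section \<open>Maximal ideal spaces\<close>

text \<open>A functional on \<open>B\<close> is a function that is \<^const>\<open>undefined\<close> outside \<open>B\<close>, so that the
  weak-* topology is a subspace topology of the product topology.\<close>

type_synonym 'h functional = "('h \<Rightarrow>\<^sub>L 'h) \<Rightarrow> complex"

definition max_ideal_space :: "('h :: chilbert_space \<Rightarrow>\<^sub>L 'h) set \<Rightarrow> 'h functional set" where
  "max_ideal_space B =
     {\<tau> \<in> extensional B.
        (\<forall>a\<in>B. \<forall>b\<in>B. \<tau> (a + b) = \<tau> a + \<tau> b) \<and>
        (\<forall>c. \<forall>a\<in>B. \<tau> (cscale c a) = c * \<tau> a) \<and>
        (\<forall>a\<in>B. \<forall>b\<in>B. \<tau> (a o\<^sub>L b) = \<tau> a * \<tau> b) \<and>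
        (\<exists>a\<in>B. \<tau> a \<noteq> 0)}"

definition max_ideal_topology :: "('h :: chilbert_space \<Rightarrow>\<^sub>L 'h) set \<Rightarrow> 'h functional topology" where
  "max_ideal_topology B = subtopology (product_topology (\<lambda>_. euclidean) B) (max_ideal_space B)"

definition zero_functional :: "('h :: chilbert_space \<Rightarrow>\<^sub>L 'h) set \<Rightarrow> 'h functional" where
  "zero_functional B = (\<lambda>a\<in>B. 0)"


section \<open>The partial mapping\<close>

text \<open>The partial mapping \<open>\<alpha>\<close> is \<open>alpha A U\<close> restricted to \<open>Delta A U\<close>; outside of
  \<open>Delta A U\<close> the values of \<open>alpha\<close> are irrelevant.\<close>

definition Delta :: "('h :: chilbert_space \<Rightarrow>\<^sub>L 'h) set \<Rightarrow> ('h \<Rightarrow>\<^sub>L 'h) \<Rightarrow> 'h functional set" where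
  "Delta A U = {\<tau> \<in> max_ideal_space A. \<tau> (U o\<^sub>L adj U) = 1}"

definition alpha ::
    "('h :: chilbert_space \<Rightarrow>\<^sub>L 'h) set \<Rightarrow> ('h \<Rightarrow>\<^sub>L 'h) \<Rightarrow> 'h functional \<Rightarrow> 'h functional" where
  "alpha A U \<tau> = (\<lambda>a\<in>A. \<tau> (delta U a))"

text \<open>\<open>Delta_dom A U n\<close> is \<open>\<Delta>\<^sub>n\<close>, the domain of \<open>\<alpha>\<^sup>n\<close>; \<open>Delta_im A U n\<close> is
  \<open>\<Delta>\<^sub>-\<^sub>n\<close>, its image.\<close>

primrec Delta_dom ::
    "('h :: chilbert_space \<Rightarrow>\<^sub>L 'h) set \<Rightarrow> ('h \<Rightarrow>\<^sub>L 'h) \<Rightarrow> nat \<Rightarrow> 'h functional set" where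
  "Delta_dom A U 0 = max_ideal_space A"
| "Delta_dom A U (Suc n) = {\<tau> \<in> Delta A U. alpha A U \<tau> \<in> Delta_dom A U n}"

definition Delta_im ::
    "('h :: chilbert_space \<Rightarrow>\<^sub>L 'h) set \<Rightarrow> ('h \<Rightarrow>\<^sub>L 'h) \<Rightarrow> nat \<Rightarrow> 'h functional set" where
  "Delta_im A U n = (alpha A U ^^ n) ` Delta_dom A U n"

definition Delta_im_inf ::
    "('h :: chilbert_space \<Rightarrow>\<^sub>L 'h) set \<Rightarrow> ('h \<Rightarrow>\<^sub>L 'h) \<Rightarrow> 'h functional set" where
  "Delta_im_inf A U = (\<Inter>n\<in>{1..}. Delta_im A U n)"


section \<open>The space of sequences\<close>

definition M_hat ::
    "('h :: chilbert_space \<Rightarrow>\<^sub>L 'h) set \<Rightarrow> ('h \<Rightarrow>\<^sub>L 'h) \<Rightarrow> nat \<Rightarrow> (nat \<Rightarrow> 'h functional) set" where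
  "M_hat A U N =
     {x. x N \<in> Delta_dom A U N \<and> x N \<notin> Delta_im A U 1 \<and>
         (\<forall>n\<in>{1..N}. x n \<in> Delta A U \<and> alpha A U (x n) = x (n - 1)) \<and>
         (\<forall>n>N. x n = zero_functional A)}"

definition M_inf ::
    "('h :: chilbert_space \<Rightarrow>\<^sub>L 'h) set \<Rightarrow> ('h \<Rightarrow>\<^sub>L 'h) \<Rightarrow> (nat \<Rightarrow> 'h functional) set" where
  "M_inf A U =
     {x. (\<forall>n. x n \<in> Delta_dom A U n \<inter> Delta_im_inf A U) \<and>
         (\<forall>n\<ge>1. x n \<in> Delta A U \<and> alpha A U (x n) = x (n - 1))}"

definition M_union ::
    "('h :: chilbert_space \<Rightarrow>\<^sub>L 'h) set \<Rightarrow> ('h \<Rightarrow>\<^sub>L 'h) \<Rightarrow> (nat \<Rightarrow> 'h functional) set" where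
  "M_union A U = (\<Union>N. M_hat A U N) \<union> M_inf A U"

text \<open>The finite set \<open>F\<close> plays the role of \<open>a\<^sub>1, \<dots>, a\<^sub>k\<close>.\<close>

definition nbhd_hat ::
    "('h :: chilbert_space \<Rightarrow>\<^sub>L 'h) set \<Rightarrow> ('h \<Rightarrow>\<^sub>L 'h) \<Rightarrow> nat \<Rightarrow> (nat \<Rightarrow> 'h functional) \<Rightarrow>
     ('h \<Rightarrow>\<^sub>L 'h) set \<Rightarrow> real \<Rightarrow> (nat \<Rightarrow> 'h functional) set" where
  "nbhd_hat A U N x F \<epsilon> = {y \<in> M_hat A U N. \<forall>a\<in>F. cmod (x N a - y N a) < \<epsilon>}"

definition nbhd_inf ::
    "('h :: chilbert_space \<Rightarrow>\<^sub>L 'h) set \<Rightarrow> ('h \<Rightarrow>\<^sub>L 'h) \<Rightarrow> (nat \<Rightarrow> 'h functional) \<Rightarrow>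
     ('h \<Rightarrow>\<^sub>L 'h) set \<Rightarrow> nat \<Rightarrow> real \<Rightarrow> (nat \<Rightarrow> 'h functional) set" where
  "nbhd_inf A U x F n \<epsilon> =
     {y \<in> (\<Union>N\<in>{n..}. M_hat A U N) \<union> M_inf A U. \<forall>a\<in>F. cmod (x n a - y n a) < \<epsilon>}"

definition basic_nbhds ::
    "('h :: chilbert_space \<Rightarrow>\<^sub>L 'h) set \<Rightarrow> ('h \<Rightarrow>\<^sub>L 'h) \<Rightarrow> (nat \<Rightarrow> 'h functional) \<Rightarrow>
     (nat \<Rightarrow> 'h functional) set set" where
  "basic_nbhds A U x =
     {nbhd_hat A U N x F \<epsilon> | N F \<epsilon>. x \<in> M_hat A U N \<and> finite F \<and> F \<subseteq> A \<and> 0 < \<epsilon>} \<union>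
     {nbhd_inf A U x F n \<epsilon> | F n \<epsilon>. x \<in> M_inf A U \<and> finite F \<and> F \<subseteq> A \<and> 0 < \<epsilon>}"

text \<open>That this is a topology with underlying set \<^const>\<open>M_union\<close> in which \<^const>\<open>basic_nbhds\<close>
  form fundamental systems of neighborhoods is shown below
  (\<open>openin_M_topology\<close>, \<open>topspace_M_topology\<close>, \<open>M_topology_nbhds\<close>).\<close>

definition M_topology ::
    "('h :: chilbert_space \<Rightarrow>\<^sub>L 'h) set \<Rightarrow> ('h \<Rightarrow>\<^sub>L 'h) \<Rightarrow> (nat \<Rightarrow> 'h functional) topology" where
  "M_topology A U =
     topology (\<lambda>W. W \<subseteq> M_union A U \<and> (\<forall>x\<in>W. \<exists>B\<in>basic_nbhds A U x. B \<subseteq> W))"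

definition xi ::
    "('h :: chilbert_space \<Rightarrow>\<^sub>L 'h) set \<Rightarrow> ('h \<Rightarrow>\<^sub>L 'h) \<Rightarrow> nat \<Rightarrow> 'h functional \<Rightarrow> 'h functional" where
  "xi A U n x = (\<lambda>a\<in>A. x ((delta_star U ^^ n) a))"


section \<open>The neighborhood systems define a topology\<close>

lemma max_ideal_space_nonzero:
  "\<tau> \<in> max_ideal_space A \<Longrightarrow> \<tau> \<noteq> zero_functional A"
  by (auto simp: max_ideal_space_def zero_functional_def)

lemma Delta_dom_subset: "Delta_dom A U n \<subseteq> max_ideal_space A"
  by (cases n) (auto simp: Delta_def)

lemma M_hat_nonzero:
  assumes "x \<in> M_hat A U N" "n \<le> N"
  shows "x n \<noteq> zero_functional A"
proof (cases "n = N")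
  case True
  then show ?thesis
    using assms Delta_dom_subset[of A U N] max_ideal_space_nonzero by (auto simp: M_hat_def)
next
  case False
  show ?thesis
  proof (cases "n = 0")
    case False
    then have "x n \<in> Delta A U"
      using assms by (auto simp: M_hat_def)
    then show ?thesis
      using max_ideal_space_nonzero by (auto simp: Delta_def)
  next
    case n0: True
    have "x N \<in> Delta_dom A U N" "\<And>k. k \<in> {1..N} \<Longrightarrow> alpha A U (x k) = x (k - 1)"
      using assms by (auto simp: M_hat_def)
    then have "x (N - k) \<in> Delta_dom A U (N - k)" if "k \<le> N" for k
      using that
    proof (induction k)
      case (Suc k)
      then have "N - k = Suc (N - Suc k)" by simp
      with Suc show ?case by (force simp: Suc_diff_le)
    qed simp
    from this[of N] show ?thesis
      using n0 max_ideal_space_nonzero by simp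
  qed
qed

lemma M_hat_unique:
  assumes "x \<in> M_hat A U N" "x \<in> M_hat A U N'"
  shows "N = N'"
proof -
  have "\<not> k < l" if "x \<in> M_hat A U k" "x \<in> M_hat A U l" for k l
    using that M_hat_nonzero[of x A U l l] by (auto simp: M_hat_def)
  with assms show ?thesis
    by (meson linorder_neqE_nat)
qed

lemma M_hat_M_inf:
  assumes "x \<in> M_hat A U N"
  shows "x \<notin> M_inf A U"
proof
  assume "x \<in> M_inf A U"
  then have "x (Suc N) \<in> max_ideal_space A"
    using Delta_dom_subset by (fastforce simp: M_inf_def)
  moreover have "x (Suc N) = zero_functional A"
    using assms by (simp add: M_hat_def)
  ultimately show False
    using max_ideal_space_nonzero by blast
qed

lemma M_shift:
  assumes "delta U ` A \<subseteq> A" "x \<in> (\<Union>N\<in>{m..}. M_hat A U N) \<union> M_inf A U" "n \<le> m" "a \<in> A"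
  shows "x n a = x m ((delta U ^^ (m - n)) a)"
proof -
  have x: "alpha A U (x k) = x (k - 1)" if "1 \<le> k" "k \<le> m" for k
    using assms(2) that by (auto simp: M_hat_def M_inf_def)
  have "\<forall>a\<in>A. x (m - k) a = x m ((delta U ^^ k) a)" if "k \<le> m" for k
    using that
  proof (induction k)
    case (Suc k)
    have "x (m - Suc k) a = x (m - k) (delta U a)" if "a \<in> A" for a
      using x[of "m - k", symmetric] Suc.prems that by (simp add: alpha_def)
    then show ?case
      using Suc assms(1) by (auto simp: funpow_swap1)
  qed simp
  from this[of "m - n"] show ?thesis
    using assms(3,4) by simp
qed

lemma basic_nbhds_cases:
  assumes "B \<in> basic_nbhds A U x"
  obtains
    (hat) N F \<epsilon> where "x \<in> M_hat A U N" "B = nbhd_hat A U N x F \<epsilon>" "finite F" "F \<subseteq> A" "0 < \<epsilon>"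
  | (inf) F n \<epsilon> where "x \<in> M_inf A U" "B = nbhd_inf A U x F n \<epsilon>" "finite F" "F \<subseteq> A" "0 < \<epsilon>"
  using assms unfolding basic_nbhds_def by auto

lemma basic_nbhds_hat:
  "x \<in> M_hat A U N \<Longrightarrow> finite F \<Longrightarrow> F \<subseteq> A \<Longrightarrow> 0 < \<epsilon> \<Longrightarrow> nbhd_hat A U N x F \<epsilon> \<in> basic_nbhds A U x"
  unfolding basic_nbhds_def by auto

lemma basic_nbhds_inf:
  "x \<in> M_inf A U \<Longrightarrow> finite F \<Longrightarrow> F \<subseteq> A \<Longrightarrow> 0 < \<epsilon> \<Longrightarrow> nbhd_inf A U x F n \<epsilon> \<in> basic_nbhds A U x"
  unfolding basic_nbhds_def by auto

lemma basic_nbhds_subset: "B \<in> basic_nbhds A U x \<Longrightarrow> B \<subseteq> M_union A U"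
  by (erule basic_nbhds_cases) (auto simp: nbhd_hat_def nbhd_inf_def M_union_def)

lemma basic_nbhds_self: "B \<in> basic_nbhds A U x \<Longrightarrow> x \<in> B"
  by (erule basic_nbhds_cases) (auto simp: nbhd_hat_def nbhd_inf_def)

lemma basic_nbhds_ne: "x \<in> M_union A U \<Longrightarrow> basic_nbhds A U x \<noteq> {}"
  using basic_nbhds_hat[of x A U _ "{}" 1] basic_nbhds_inf[of x A U "{}" 1]
  by (fastforce simp: M_union_def)

lemma shift_set_subset: "delta U ` A \<subseteq> A \<Longrightarrow> F \<subseteq> A \<Longrightarrow> (delta U ^^ k) ` F \<subseteq> A"
  by (induction k) auto

lemma nbhd_inf_shift:
  assumes "delta U ` A \<subseteq> A" "x \<in> M_inf A U" "F \<subseteq> A" "n \<le> m"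
  shows "nbhd_inf A U x ((delta U ^^ (m - n)) ` F) m \<epsilon> \<subseteq> nbhd_inf A U x F n \<epsilon>"
proof
  fix y assume y: "y \<in> nbhd_inf A U x ((delta U ^^ (m - n)) ` F) m \<epsilon>"
  then have ym: "y \<in> (\<Union>N\<in>{m..}. M_hat A U N) \<union> M_inf A U"
    by (auto simp: nbhd_inf_def)
  have "cmod (x n a - y n a) < \<epsilon>" if "a \<in> F" for a
    using M_shift[OF assms(1) ym assms(4), of a] M_shift[OF assms(1) _ assms(4), of x a]
      y that assms(2,3) by (auto simp: nbhd_inf_def)
  then show "y \<in> nbhd_inf A U x F n \<epsilon>"
    using ym assms(4) by (fastforce simp: nbhd_inf_def)
qed

lemma basic_nbhds_Int:
  assumes "delta U ` A \<subseteq> A" "B \<in> basic_nbhds A U x" "C \<in> basic_nbhds A U x"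
  shows "\<exists>D\<in>basic_nbhds A U x. D \<subseteq> B \<inter> C"
  using assms(2)
proof (cases rule: basic_nbhds_cases)
  case B: (hat N F \<epsilon>)
  from assms(3) show ?thesis
  proof (cases rule: basic_nbhds_cases)
    case C: (hat N' G \<eta>)
    have "N' = N"
      using B C M_hat_unique by blast
    with B C have "nbhd_hat A U N x (F \<union> G) (min \<epsilon> \<eta>) \<subseteq> B \<inter> C"
      by (auto simp: nbhd_hat_def)
    moreover have "nbhd_hat A U N x (F \<union> G) (min \<epsilon> \<eta>) \<in> basic_nbhds A U x"
      using B C by (intro basic_nbhds_hat) auto
    ultimately show ?thesis by blast
  next
    case C: (inf G m \<eta>)
    show ?thesis
      using M_hat_M_inf[OF B(1)] C(1) by (rule notE)
  qed
next
  case B: (inf F n \<epsilon>)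
  from assms(3) show ?thesis
  proof (cases rule: basic_nbhds_cases)
    case C: (inf G m \<eta>)
    obtain k where k: "n \<le> k" "m \<le> k"
      using that[of "max n m"] by simp
    let ?F = "(delta U ^^ (k - n)) ` F" and ?G = "(delta U ^^ (k - m)) ` G"
    have "nbhd_inf A U x (?F \<union> ?G) k (min \<epsilon> \<eta>) \<subseteq> nbhd_inf A U x ?F k \<epsilon> \<inter> nbhd_inf A U x ?G k \<eta>"
      by (auto simp: nbhd_inf_def)
    also have "\<dots> \<subseteq> B \<inter> C"
      using nbhd_inf_shift[OF assms(1) B(1,4) k(1)] nbhd_inf_shift[OF assms(1) C(1,4) k(2)]
      unfolding B(2) C(2) by (rule Int_mono)
    finally have "nbhd_inf A U x (?F \<union> ?G) k (min \<epsilon> \<eta>) \<subseteq> B \<inter> C" .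
    moreover have "nbhd_inf A U x (?F \<union> ?G) k (min \<epsilon> \<eta>) \<in> basic_nbhds A U x"
      using B(1,3,5) C(3,5) shift_set_subset[OF assms(1) B(4)] shift_set_subset[OF assms(1) C(4)]
      by (intro basic_nbhds_inf) simp_all
    ultimately show ?thesis by blast
  next
    case C: (hat N G \<eta>)
    show ?thesis
      using M_hat_M_inf[OF C(1)] B(1) by (rule notE)
  qed
qed

lemma finite_slack:
  assumes "finite F" "\<forall>a\<in>F. f a < (\<epsilon> :: real)"
  shows "\<exists>\<eta>>0. \<forall>a\<in>F. f a + \<eta> \<le> \<epsilon>"
  using assms
proof (induction F)
  case empty
  show ?case by (rule exI[of _ 1]) simp
next
  case (insert a F)
  then obtain \<eta> where "\<eta> > 0" "\<forall>a\<in>F. f a + \<eta> \<le> \<epsilon>" by auto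
  with insert.prems show ?case
    by (intro exI[of _ "min \<eta> (\<epsilon> - f a)"]) force
qed

lemma basic_nbhds_open:
  assumes "delta U ` A \<subseteq> A" "B \<in> basic_nbhds A U x" "y \<in> B"
  shows "\<exists>C\<in>basic_nbhds A U y. C \<subseteq> B"
  using assms(2)
proof (cases rule: basic_nbhds_cases)
  case B: (hat N F \<epsilon>)
  with assms(3) have y: "y \<in> M_hat A U N" "\<forall>a\<in>F. cmod (x N a - y N a) < \<epsilon>"
    by (auto simp: nbhd_hat_def)
  obtain \<eta> where \<eta>: "\<eta> > 0" "\<forall>a\<in>F. cmod (x N a - y N a) + \<eta> \<le> \<epsilon>"
    using finite_slack[OF B(3) y(2)] by auto
  have "cmod (x N a - z N a) < \<epsilon>" if "cmod (y N a - z N a) < \<eta>" "a \<in> F" for a z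
    using norm_triangle_ineq[of "x N a - y N a" "y N a - z N a"] \<eta>(2) that by fastforce
  then have "nbhd_hat A U N y F \<eta> \<subseteq> B"
    by (auto simp: B nbhd_hat_def)
  with basic_nbhds_hat[OF y(1) B(3,4) \<eta>(1)] show ?thesis by blast
next
  case B: (inf F n \<epsilon>)
  with assms(3) have y: "y \<in> (\<Union>N\<in>{n..}. M_hat A U N) \<union> M_inf A U"
      "\<forall>a\<in>F. cmod (x n a - y n a) < \<epsilon>"
    by (auto simp: nbhd_inf_def)
  obtain \<eta> where \<eta>: "\<eta> > 0" "\<forall>a\<in>F. cmod (x n a - y n a) + \<eta> \<le> \<epsilon>"
    using finite_slack[OF B(3) y(2)] by auto
  have *: "cmod (x n a - z n a) < \<epsilon>" if "cmod (y n a - z n a) < \<eta>" "a \<in> F" for a z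
    using norm_triangle_ineq[of "x n a - y n a" "y n a - z n a"] \<eta>(2) that by fastforce
  from y(1) consider "y \<in> M_inf A U" | N where "N \<ge> n" "y \<in> M_hat A U N"
    by auto
  then show ?thesis
  proof cases
    case 1
    have "nbhd_inf A U y F n \<eta> \<subseteq> B"
      using * by (auto simp: B nbhd_inf_def)
    with basic_nbhds_inf[OF 1 B(3,4) \<eta>(1)] show ?thesis by blast
  next
    case 2
    let ?G = "(delta U ^^ (N - n)) ` F"
    have "z \<in> B" if z: "z \<in> nbhd_hat A U N y ?G \<eta>" for z
    proof -
      have zN: "z \<in> M_hat A U N"
        using z by (simp add: nbhd_hat_def)
      have "cmod (y n a - z n a) < \<eta>" if "a \<in> F" for a
        using M_shift[OF assms(1) _ 2(1), of y a] M_shift[OF assms(1) _ 2(1), of z a]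
          z zN 2 that B(4) by (fastforce simp: nbhd_hat_def)
      with * zN 2(1) show ?thesis
        by (auto simp: B nbhd_inf_def)
    qed
    moreover have "nbhd_hat A U N y ?G \<eta> \<in> basic_nbhds A U y"
      using 2 B shift_set_subset[OF assms(1) B(4)] \<eta>(1) by (intro basic_nbhds_hat) auto
    ultimately show ?thesis by blast
  qed
qed

lemma openin_M_topology:
  assumes "delta U ` A \<subseteq> A"
  shows "openin (M_topology A U) W \<longleftrightarrow>
           W \<subseteq> M_union A U \<and> (\<forall>x\<in>W. \<exists>B\<in>basic_nbhds A U x. B \<subseteq> W)"
proof -
  let ?P = "\<lambda>W. W \<subseteq> M_union A U \<and> (\<forall>x\<in>W. \<exists>B\<in>basic_nbhds A U x. B \<subseteq> W)"
  have "istopology ?P"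
    unfolding istopology_def
  proof (intro conjI allI impI)
    fix S T assume S: "?P S" and T: "?P T"
    then show "S \<inter> T \<subseteq> M_union A U" by blast
    show "\<forall>x\<in>S \<inter> T. \<exists>B\<in>basic_nbhds A U x. B \<subseteq> S \<inter> T"
    proof
      fix x assume "x \<in> S \<inter> T"
      with S T obtain B C where BC: "B \<in> basic_nbhds A U x" "B \<subseteq> S" "C \<in> basic_nbhds A U x" "C \<subseteq> T"
        by blast
      with basic_nbhds_Int[OF assms BC(1,3)] show "\<exists>B\<in>basic_nbhds A U x. B \<subseteq> S \<inter> T"
        by blast
    qed
  next
    fix K assume K: "\<forall>W\<in>K. ?P W"
    then show "\<Union>K \<subseteq> M_union A U" by blast
    show "\<forall>x\<in>\<Union>K. \<exists>B\<in>basic_nbhds A U x. B \<subseteq> \<Union>K"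
      using K by (meson Union_iff Union_upper order_trans)
  qed
  then show ?thesis
    by (simp add: M_topology_def)
qed

lemma topspace_M_topology:
  assumes "delta U ` A \<subseteq> A"
  shows "topspace (M_topology A U) = M_union A U"
proof
  show "topspace (M_topology A U) \<subseteq> M_union A U"
    using openin_M_topology[OF assms, of "topspace (M_topology A U)"] by simp
  have "openin (M_topology A U) (M_union A U)"
    unfolding openin_M_topology[OF assms]
  proof (intro conjI ballI subset_refl)
    fix x assume "x \<in> M_union A U"
    then obtain B where B: "B \<in> basic_nbhds A U x"
      using basic_nbhds_ne[of x A U] by auto
    then show "\<exists>B\<in>basic_nbhds A U x. B \<subseteq> M_union A U"
      using basic_nbhds_subset[OF B] by (rule bexI[rotated])
  qed
  then show "M_union A U \<subseteq> topspace (M_topology A U)"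
    by (rule openin_subset)
qed

lemma M_topology_nbhds:
  assumes "delta U ` A \<subseteq> A" "x \<in> M_union A U"
  shows "(\<exists>W. openin (M_topology A U) W \<and> x \<in> W \<and> W \<subseteq> V) \<longleftrightarrow> (\<exists>B\<in>basic_nbhds A U x. B \<subseteq> V)"
proof
  assume "\<exists>W. openin (M_topology A U) W \<and> x \<in> W \<and> W \<subseteq> V"
  then show "\<exists>B\<in>basic_nbhds A U x. B \<subseteq> V"
    using openin_M_topology[OF assms(1)] by (meson order_trans)
next
  assume "\<exists>B\<in>basic_nbhds A U x. B \<subseteq> V"
  then obtain B where B: "B \<in> basic_nbhds A U x" "B \<subseteq> V" by blast
  have "openin (M_topology A U) B"
    using openin_M_topology[OF assms(1)] basic_nbhds_subset[OF B(1)] basic_nbhds_open[OF assms(1) B(1)]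
    by blast
  with basic_nbhds_self[OF B(1)] B(2) show "\<exists>W. openin (M_topology A U) W \<and> x \<in> W \<and> W \<subseteq> V"
    by blast
qed

end

theory Submission
  imports Defs
begin

text \<open>
  Write \<open>\<delta> a = U a U\<^sup>*\<close> and \<open>\<delta>\<^sub>* a = U\<^sup>* a U\<close>, and let \<open>B\<close> be the \<open>C\<^sup>*\<close>-algebra generated by all \<open>\<delta>\<^sub>*\<^sup>n a\<close>
  with \<open>a \<in> A\<close>.

  Since \<open>U U\<^sup>* = \<delta> 1\<close> is a projection, \<open>U\<close> is a partial isometry, and since \<open>U\<^sup>* U\<close> commutes with \<open>A\<close>, it
  intertwines: \<open>U a = \<delta> a U\<close> (\<open>U_intertwines\<close>). Consequently the generators commute, \<open>B\<close> is commutative and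
  invariant under \<open>\<delta>\<close>, and each \<open>\<delta>\<^sub>*\<^sup>n\<close> is multiplicative on \<open>A\<close>. A character \<open>x\<close> of \<open>B\<close> is therefore
  described by its coordinates \<open>x \<circ> \<delta>\<^sub>*\<^sup>n\<close>, each of which is a character of \<open>A\<close> or zero according to the value, 1
  or 0, of \<open>x\<close> on the projection \<open>U\<^sup>*\<^sup>n U\<^sup>n\<close>. These projections decrease, so either the coordinates
  vanish from some index \<open>N + 1\<close> on or none of them vanishes; this is the distinction between \<open>M_hat\<close> and
  \<open>M_inf\<close>. Consecutive coordinates are linked by \<open>\<alpha>\<close> because \<open>\<delta>\<^sub>* (\<delta> a) = U\<^sup>* U a U\<^sup>* U\<close>.

  The map is injective since a character is determined by its values on generators. For
  surjectivity (\<open>M_hat_lift\<close>, \<open>M_inf_lift\<close>) the coordinate \<open>x\<^sub>n\<close> is extended to a character \<open>y\<close> of \<open>B\<close>; then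
  \<open>y \<circ> \<delta>\<^sup>n\<close> is a character with the coordinates \<open>x\<^sub>0, \<dots>, x\<^sub>n\<close>. On \<open>M_hat\<close> the choice \<open>n = N\<close> also produces the
  right zeros, because \<open>\<alpha>(\<Delta>)\<close> is the set where \<open>U\<^sup>* U\<close> has value 1; on \<open>M_inf\<close> the characters so obtained
  converge pointwise as \<open>n\<close> grows.

  The analytic core is that characters extend from \<open>A\<close> to \<open>B\<close> (\<open>character_extension\<close>). It is obtained from real
  algebra: a proper archimedean quadratic module in a commutative real algebra has a real point
  (\<open>archimedean_module_point\<close>), which is applied to the self-adjoint elements of \<open>B\<close> that are bounded below by
  \<open>-h\<close> for a suitable \<open>h \<in> A\<close> in the kernel of the given character.

  Both directions of the homeomorphism are then read off from coordinates. Basic neighborhoods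
  are described by finitely many values of a character. Conversely, evaluation at \<open>b\<close> is continuous on the space
  of sequences for \<open>b\<close> a generator, and the set of all such \<open>b\<close> is a \<open>C\<^sup>*\<close>-algebra, hence contains \<open>B\<close>.
\<close>

section \<open>Inner products and the Riesz representation theorem\<close>

instance chilbert_space \<subseteq> banach ..

lemma cinner_add_right: "cinner x (y + z) = cinner x y + cinner x z"
  by (metis cinner_add_left cinner_commute complex_cnj_add)

lemma cinner_scaleC_right: "cinner x (c *\<^sub>C y) = cnj c * cinner x y"
  by (metis cinner_commute cinner_scaleC_left complex_cnj_mult)

lemma cinner_scaleR_left: "cinner (r *\<^sub>R x) y = r *\<^sub>R cinner x y"
  by (simp add: scaleR_scaleC cinner_scaleC_left scaleR_conv_of_real)

lemma cinner_scaleR_right: "cinner x (r *\<^sub>R y) = r *\<^sub>R cinner x y"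
  by (simp add: scaleR_scaleC cinner_scaleC_right scaleR_conv_of_real)

lemma cinner_zero_left [simp]: "cinner 0 x = 0"
  using cinner_add_left[of 0 0 x] by simp

lemma cinner_zero_right [simp]: "cinner x 0 = 0"
  using cinner_add_right[of x 0 0] by simp

lemma cinner_minus_left: "cinner (- x) y = - cinner x y"
  using cinner_add_left[of x "- x" y] by (simp add: eq_neg_iff_add_eq_0 add.commute)

lemma cinner_minus_right: "cinner x (- y) = - cinner x y"
  using cinner_add_right[of x y "- y"] by (simp add: eq_neg_iff_add_eq_0 add.commute)

lemma cinner_diff_left: "cinner (x - y) z = cinner x z - cinner y z"
  using cinner_add_left[of x "- y" z] by (simp add: cinner_minus_left)

lemma cinner_diff_right: "cinner x (y - z) = cinner x y - cinner x z"
  using cinner_add_right[of x y "- z"] by (simp add: cinner_minus_right)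

lemma cinner_self: "cinner x x = complex_of_real ((norm x)\<^sup>2)"
proof -
  have "Im (cinner x x) = 0"
    using cinner_commute[of x x] by (simp add: complex_eq_iff)
  moreover have "(norm x)\<^sup>2 = cmod (cinner x x)"
    by (simp add: norm_eq_sqrt_cinner)
  ultimately show ?thesis
    using cinner_ge_zero[of x] by (simp add: complex_eq_iff cmod_def)
qed

text \<open>The polarisation identity. With the triangle inequality, which the norm of the class
  satisfies by assumption, it yields the Cauchy--Schwarz inequality.\<close>

lemma norm_add_sq: "(norm (x + y))\<^sup>2 = (norm x)\<^sup>2 + (norm y)\<^sup>2 + 2 * Re (cinner x y)"
  for x y :: "'h :: complex_inner"
proof -
  have "Re (cinner (x + y) (x + y)) = (norm x)\<^sup>2 + (norm y)\<^sup>2 + 2 * Re (cinner x y)"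
    using arg_cong[OF cinner_commute[of x y], of Re]
    unfolding cinner_add_left cinner_add_right by (simp add: cinner_self)
  then show ?thesis by (simp add: cinner_self)
qed

lemma Re_cinner_le: "Re (cinner x y) \<le> norm x * norm y"
proof -
  have "(norm (x + y))\<^sup>2 \<le> (norm x + norm y)\<^sup>2"
    by (simp add: norm_triangle_ineq power_mono)
  then show ?thesis
    by (simp add: norm_add_sq power2_sum)
qed

text \<open>Rotating \<open>x\<close> by the phase of the inner product makes the inner product real.\<close>

lemma cmod_cinner_le: "cmod (cinner x y) \<le> norm x * norm y"
proof (cases "cinner x y = 0")
  case False
  define c where "c = cnj (cinner x y) / cmod (cinner x y)"
  have c: "cmod c = 1"
    using False by (simp add: c_def norm_divide)
  have "cinner (c *\<^sub>C x) y = cmod (cinner x y)"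
    using False complex_norm_square[of "cinner x y"]
    by (simp add: c_def cinner_scaleC_left field_simps power2_eq_square)
  then have "cmod (cinner x y) \<le> norm (c *\<^sub>C x) * norm y"
    using Re_cinner_le[of "c *\<^sub>C x" y] by simp
  then show ?thesis by (simp add: norm_scaleC c)
qed simp

lemma cinner_eqI:
  assumes "\<And>z. cinner z x = cinner z y"
  shows "x = y"
proof -
  have "cinner (x - y) (x - y) = 0"
    using assms[of "x - y"] by (simp add: cinner_diff_right)
  then show ?thesis by (simp add: cinner_self)
qed

text \<open>The representing vector minimises \<open>J x = \<parallel>x\<parallel>\<^sup>2 - 2 Re (f x)\<close>. By the parallelogram law a
  minimising sequence is Cauchy, and at the limit the first variation of \<open>J\<close> vanishes in every
  direction, so that the real parts of both functionals agree. The imaginary parts agree because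
  both functionals are complex linear.\<close>

theorem riesz_representation:
  fixes f :: "'h :: chilbert_space \<Rightarrow> complex"
  assumes "bounded_linear f" and f_scaleC: "\<And>c x. f (c *\<^sub>C x) = c * f x"
  shows "\<exists>w. \<forall>x. f x = cinner x w"
proof -
  interpret f: bounded_linear f by fact
  define J where "J x = (norm x)\<^sup>2 - 2 * Re (f x)" for x
  obtain K where K: "\<And>x. cmod (f x) \<le> norm x * K"
    using f.pos_bounded by blast
  have J_ge: "J x \<ge> - K\<^sup>2" for x
  proof -
    have "Re (f x) \<le> norm x * K"
      using K[of x] complex_Re_le_cmod order_trans by blast
    moreover have "(norm x - K)\<^sup>2 \<ge> 0" by simp
    ultimately show ?thesis
      unfolding J_def power2_diff by linarith
  qed
  define m where "m = Inf (range J)"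
  have bdd: "bdd_below (range J)"
    using J_ge by (intro bdd_belowI[of _ "- K\<^sup>2"]) auto
  have m_le: "m \<le> J x" for x
    unfolding m_def using bdd by (intro cInf_lower) auto
  have "\<exists>x. J x < m + inverse (Suc n)" for n
    using cInf_lessD[of "range J" "m + inverse (Suc n)"] by (auto simp: m_def)
  then obtain X where X: "\<And>n. J (X n) < m + inverse (real (Suc n))"
    by metis
  \<comment> \<open>The parallelogram law, with the midpoint compared to the infimum.\<close>
  have dist_le: "(norm (x - y))\<^sup>2 \<le> 2 * (J x + J y) - 4 * m" for x y
  proof -
    have "(norm (x - y))\<^sup>2 = 2 * (norm x)\<^sup>2 + 2 * (norm y)\<^sup>2 - (norm (x + y))\<^sup>2"
      using norm_add_sq[of x y] norm_add_sq[of x "- y"] by (simp add: cinner_minus_right)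
    moreover have "4 * J ((1/2) *\<^sub>R (x + y)) = (norm (x + y))\<^sup>2 - 4 * Re (f x) - 4 * Re (f y)"
      unfolding J_def f.scaleR norm_scaleR by (simp add: f.add power_divide field_simps)
    ultimately show ?thesis
      using m_le[of "(1/2) *\<^sub>R (x + y)"] by (simp add: J_def)
  qed
  have "Cauchy X"
  proof (rule metric_CauchyI)
    fix e :: real assume "e > 0"
    then obtain M where M: "inverse (real (Suc M)) < e\<^sup>2 / 4"
      using reals_Archimedean[of "e\<^sup>2 / 4"] by auto
    have Jlt: "J (X n) < m + e\<^sup>2 / 4" if "n \<ge> M" for n
    proof -
      have "inverse (real (Suc n)) \<le> inverse (real (Suc M))"
        using that by (intro le_imp_inverse_le) auto
      with M X[of n] show ?thesis by linarith
    qed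
    have near: "(norm (X k - X l))\<^sup>2 < e\<^sup>2" if "k \<ge> M" "l \<ge> M" for k l
      using dist_le[of "X k" "X l"] Jlt[OF that(1)] Jlt[OF that(2)] by (simp add: field_simps)
    show "\<exists>M. \<forall>k\<ge>M. \<forall>l\<ge>M. dist (X k) (X l) < e"
      using \<open>e > 0\<close> near by (auto simp: dist_norm intro!: exI[of _ M] power2_less_imp_less[of _ e])
  qed
  then obtain w where w: "X \<longlonglongrightarrow> w"
    using Cauchy_convergent convergent_def by blast
  have "(\<lambda>n. J (X n)) \<longlonglongrightarrow> J w"
    unfolding J_def by (intro tendsto_intros w f.tendsto)
  moreover have "(\<lambda>n. m + inverse (real (Suc n))) \<longlonglongrightarrow> m + 0"
    by (intro tendsto_add tendsto_const LIMSEQ_inverse_real_of_nat)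
  ultimately have Jw: "J w \<le> m"
    using X by (intro LIMSEQ_le[of "\<lambda>n. J (X n)" "J w" "\<lambda>n. m + inverse (real (Suc n))"])
      (auto intro!: exI[of _ 0] less_imp_le)
  have Re_eq: "Re (f x) = Re (cinner x w)" for x
  proof -
    define d where "d = Re (cinner x w) - Re (f x)"
    define N where "N = (norm x)\<^sup>2"
    have "t\<^sup>2 * N + 2 * t * d \<ge> 0" for t :: real
    proof -
      have "J (w + t *\<^sub>R x) = J w + t\<^sup>2 * N + 2 * t * d"
        using cinner_commute[of w x]
        by (simp add: J_def norm_add_sq f.add f.scaleR cinner_scaleR_right power_mult_distrib
            N_def d_def algebra_simps)
      with m_le[of "w + t *\<^sub>R x"] Jw show ?thesis by linarith
    qed
    \<comment> \<open>The optimal \<open>t\<close> is \<open>-d / N\<close>; using \<open>N + 1\<close> avoids the case \<open>x = 0\<close>.\<close>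
    from this[of "- d / (N + 1)"] have "d\<^sup>2 * N / (N + 1)\<^sup>2 \<ge> 2 * d\<^sup>2 / (N + 1)"
      by (simp add: power_divide power2_eq_square)
    moreover have N: "N \<ge> 0" by (simp add: N_def)
    ultimately have "2 * d\<^sup>2 * (N + 1) \<le> d\<^sup>2 * N"
      by (simp add: divide_simps power2_eq_square split: if_splits)
    then have "d\<^sup>2 * (N + 2) \<le> 0" by (simp add: algebra_simps)
    with N have "d\<^sup>2 \<le> 0"
      by (simp add: mult_le_0_iff)
    then show ?thesis by (simp add: d_def)
  qed
  have "f x = cinner x w" for x
    using Re_eq[of x] Re_eq[of "\<i> *\<^sub>C x"]
    by (simp add: complex_eq_iff f_scaleC cinner_scaleC_left)
  then show ?thesis by blast
qed

section \<open>Bounded operators and their adjoints\<close>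

lemma bounded_opsD: "T \<in> bounded_ops \<Longrightarrow> T (c *\<^sub>C x) = c *\<^sub>C T x"
  by (simp add: bounded_ops_def)

lemma scaleR_eq_cscale: "r *\<^sub>R T = cscale (complex_of_real r) T"
  by (rule blinfun_eqI) (simp add: blinfun.scaleR_left scaleR_scaleC)

lemma cscale_add_left: "cscale (c + d) T = cscale c T + cscale d T"
  by (rule blinfun_eqI) (simp add: blinfun.add_left scaleC_add_left)

lemma cscale_add_right: "cscale c (S + T) = cscale c S + cscale c T"
  by (rule blinfun_eqI) (simp add: blinfun.add_left scaleC_add_right)

lemma cscale_cscale: "cscale c (cscale d T) = cscale (c * d) T"
  by (rule blinfun_eqI) (simp add: scaleC_scaleC)

lemma cscale_one [simp]: "cscale 1 T = T"
  by (rule blinfun_eqI) (simp add: scaleC_one)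

lemma uminus_eq_cscale: "- T = cscale (- 1) T"
  using scaleR_eq_cscale[of "-1" T] by simp

lemma cscale_minus_left: "cscale (- c) T = - cscale c T"
  using cscale_cscale[of "-1" c T] by (simp flip: uminus_eq_cscale)

lemma cscale_zero [simp]: "cscale 0 T = 0"
  using scaleR_eq_cscale[of 0 T] by simp

lemma norm_cscale: "norm (cscale c T) \<le> cmod c * norm T"
  by (rule norm_blinfun_bound)
     (auto simp: norm_scaleC mult.assoc intro!: mult_left_mono norm_blinfun)

lemma compose_cscale_left: "cscale c S o\<^sub>L T = cscale c (S o\<^sub>L T)"
  by (rule blinfun_eqI) simp

lemma compose_cscale_right: "S \<in> bounded_ops \<Longrightarrow> S o\<^sub>L cscale c T = cscale c (S o\<^sub>L T)"
  by (rule blinfun_eqI) (simp add: bounded_opsD)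

lemma compose_id [simp]: "T o\<^sub>L id_blinfun = T" "id_blinfun o\<^sub>L T = T"
  by (rule blinfun_eqI; simp)+

lemma compose_assoc: "(a o\<^sub>L b) o\<^sub>L c = a o\<^sub>L (b o\<^sub>L c)"
  by (rule blinfun_eqI) simp

lemmas compose_add_left = bounded_bilinear.add_left[OF bounded_bilinear_blinfun_compose]
  and compose_add_right = bounded_bilinear.add_right[OF bounded_bilinear_blinfun_compose]
  and compose_diff_left = bounded_bilinear.diff_left[OF bounded_bilinear_blinfun_compose]
  and compose_diff_right = bounded_bilinear.diff_right[OF bounded_bilinear_blinfun_compose]
  and compose_scaleR_left = bounded_bilinear.scaleR_left[OF bounded_bilinear_blinfun_compose]
  and compose_scaleR_right = bounded_bilinear.scaleR_right[OF bounded_bilinear_blinfun_compose]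

lemma bounded_ops_id [simp]: "id_blinfun \<in> bounded_ops"
  by (simp add: bounded_ops_def)

lemma bounded_ops_compose: "S \<in> bounded_ops \<Longrightarrow> T \<in> bounded_ops \<Longrightarrow> S o\<^sub>L T \<in> bounded_ops"
  by (simp add: bounded_ops_def)

lemma bounded_ops_add: "S \<in> bounded_ops \<Longrightarrow> T \<in> bounded_ops \<Longrightarrow> S + T \<in> bounded_ops"
  by (simp add: bounded_ops_def blinfun.add_left scaleC_add_right)

lemma bounded_ops_cscale: "T \<in> bounded_ops \<Longrightarrow> cscale c T \<in> bounded_ops"
  by (simp add: bounded_ops_def scaleC_scaleC mult.commute)

lemma closed_bounded_ops: "closed (bounded_ops :: ('h :: complex_inner \<Rightarrow>\<^sub>L 'h) set)"
proof -
  have "closed {T :: 'h \<Rightarrow>\<^sub>L 'h. T (c *\<^sub>C x) = c *\<^sub>C T x}" for c x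
    by (intro closed_Collect_eq continuous_intros
        bounded_linear.continuous_on[OF bounded_linear_scaleC])
  then have "closed (\<Inter>c x. {T :: 'h \<Rightarrow>\<^sub>L 'h. T (c *\<^sub>C x) = c *\<^sub>C T x})"
    by blast
  moreover have "bounded_ops = (\<Inter>c x. {T :: 'h \<Rightarrow>\<^sub>L 'h. T (c *\<^sub>C x) = c *\<^sub>C T x})"
    by (auto simp: bounded_ops_def)
  ultimately show ?thesis by simp
qed

text \<open>The vector that represents \<open>x \<mapsto> \<langle>T x, y\<rangle>\<close> is the value of the adjoint at \<open>y\<close>.\<close>

lemma adjoint_exists:
  fixes T :: "'h :: chilbert_space \<Rightarrow>\<^sub>L 'h"
  assumes "T \<in> bounded_ops"
  shows "\<exists>S. \<forall>x y. cinner (T x) y = cinner x (blinfun_apply S y)"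
proof -
  have "\<exists>w. \<forall>x. cinner (T x) y = cinner x w" for y
  proof (rule riesz_representation)
    show "bounded_linear (\<lambda>x. cinner (T x) y)"
    proof (rule bounded_linear_intro[of _ "norm T * norm y"])
      show "cmod (cinner (T x) y) \<le> norm x * (norm T * norm y)" for x
        using cmod_cinner_le[of "T x" y] mult_right_mono[OF norm_blinfun[of T x], of "norm y"]
        by (simp add: mult_ac)
    qed (simp_all add: blinfun.add_right blinfun.scaleR_right cinner_add_left cinner_scaleR_left)
  qed (simp add: bounded_opsD[OF assms] cinner_scaleC_left)
  then obtain S where S: "\<And>x y. cinner (T x) y = cinner x (S y)"
    by metis
  have "bounded_linear S"
  proof (rule bounded_linear_intro[of _ "norm T"])
    show "S (x + y) = S x + S y" for x y
      by (rule cinner_eqI) (simp add: cinner_add_right flip: S)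
    show "S (r *\<^sub>R x) = r *\<^sub>R S x" for r x
      by (rule cinner_eqI) (simp add: cinner_scaleR_right flip: S)
    show "norm (S y) \<le> norm y * norm T" for y
    proof -
      have "(norm (S y))\<^sup>2 = cmod (cinner (T (S y)) y)"
        unfolding S by (simp add: cinner_self norm_power)
      also have "\<dots> \<le> norm T * norm (S y) * norm y"
        using cmod_cinner_le[of "T (S y)" y] mult_right_mono[OF norm_blinfun[of T "S y"], of "norm y"]
        by simp
      finally have "norm (S y) * norm (S y) \<le> (norm y * norm T) * norm (S y)"
        by (simp add: power2_eq_square mult_ac)
      then show ?thesis
        by (cases "S y = 0") (simp_all add: mult_le_cancel_right)
    qed
  qed
  then have "blinfun_apply (Blinfun S) = S"
    by (rule bounded_linear_Blinfun_apply)
  with S show ?thesis by metis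
qed

lemma cinner_adj: "T \<in> bounded_ops \<Longrightarrow> cinner (T x) y = cinner x (adj T y)"
  using adjoint_exists[of T] adj_eqI by metis

lemma cinner_adj': "T \<in> bounded_ops \<Longrightarrow> cinner (adj T x) y = cinner x (T y)"
  by (metis cinner_adj cinner_commute)

lemma adj_bounded_ops: "T \<in> bounded_ops \<Longrightarrow> adj T \<in> bounded_ops"
  unfolding bounded_ops_def mem_Collect_eq
  by (intro allI cinner_eqI)
     (simp add: bounded_ops_def cinner_scaleC_right flip: cinner_adj)

lemma adj_adj: "T \<in> bounded_ops \<Longrightarrow> adj (adj T) = T"
  by (rule adj_eqI) (simp add: cinner_adj')

lemma adj_add: "S \<in> bounded_ops \<Longrightarrow> T \<in> bounded_ops \<Longrightarrow> adj (S + T) = adj S + adj T"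
  by (rule adj_eqI) (simp add: blinfun.add_left cinner_add_left cinner_add_right cinner_adj)

lemma adj_cscale: "T \<in> bounded_ops \<Longrightarrow> adj (cscale c T) = cscale (cnj c) (adj T)"
  by (rule adj_eqI) (simp add: cinner_scaleC_left cinner_scaleC_right cinner_adj)

lemma adj_scaleR: "T \<in> bounded_ops \<Longrightarrow> adj (r *\<^sub>R T) = r *\<^sub>R adj T"
  by (simp add: scaleR_eq_cscale adj_cscale)

lemma adj_compose: "S \<in> bounded_ops \<Longrightarrow> T \<in> bounded_ops \<Longrightarrow> adj (S o\<^sub>L T) = adj T o\<^sub>L adj S"
  by (rule adj_eqI) (simp add: cinner_adj)

lemma adj_id [simp]: "adj id_blinfun = id_blinfun"
  by (rule adj_eqI) simp

lemma adj_zero [simp]: "adj 0 = 0"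
  by (rule adj_eqI) simp

lemma adj_diff: "S \<in> bounded_ops \<Longrightarrow> T \<in> bounded_ops \<Longrightarrow> adj (S - T) = adj S - adj T"
  by (rule adj_eqI) (simp add: blinfun.diff_left cinner_diff_left cinner_diff_right cinner_adj)

lemma bounded_ops_diff: "S \<in> bounded_ops \<Longrightarrow> T \<in> bounded_ops \<Longrightarrow> S - T \<in> bounded_ops"
  using bounded_ops_add[OF _ bounded_ops_cscale, of S T "-1"] by (simp flip: uminus_eq_cscale)

lemma bounded_ops_zero [simp]: "0 \<in> bounded_ops"
  using bounded_ops_diff[OF bounded_ops_id bounded_ops_id] by simp

lemma cstar_algebra_bounded_ops: "cstar_algebra (bounded_ops :: ('h :: chilbert_space \<Rightarrow>\<^sub>L 'h) set)"
  unfolding cstar_algebra_def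
  by (auto intro: bounded_ops_add bounded_ops_cscale bounded_ops_compose adj_bounded_ops
      closed_bounded_ops)

section \<open>Real points of archimedean quadratic modules\<close>

text \<open>The algebra is given by a carrier set and an explicit product, because it will be the set of
  self-adjoint elements of a commutative \<open>C\<^sup>*\<close>-algebra of operators, which is not a type.\<close>

locale comm_real_algebra =
  fixes R :: "'a :: real_vector set" and m :: "'a \<Rightarrow> 'a \<Rightarrow> 'a" (infixl "\<odot>" 70) and e :: 'a
  assumes subspace: "subspace R"
    and one_closed: "e \<in> R"
    and mult_closed: "a \<in> R \<Longrightarrow> b \<in> R \<Longrightarrow> a \<odot> b \<in> R"
    and mult_commute: "a \<in> R \<Longrightarrow> b \<in> R \<Longrightarrow> a \<odot> b = b \<odot> a"
    and mult_assoc: "a \<odot> b \<odot> c = a \<odot> (b \<odot> c)"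
    and mult_one: "a \<odot> e = a"
    and bilinear: "bilinear (\<odot>)"
begin

lemma add_closed: "a \<in> R \<Longrightarrow> b \<in> R \<Longrightarrow> a + b \<in> R"
  and diff_closed: "a \<in> R \<Longrightarrow> b \<in> R \<Longrightarrow> a - b \<in> R"
  and minus_closed: "a \<in> R \<Longrightarrow> - a \<in> R"
  and scale_closed: "a \<in> R \<Longrightarrow> r *\<^sub>R a \<in> R"
  and zero_closed: "0 \<in> R"
  using subspace by (auto simp: subspace_add subspace_diff subspace_neg subspace_scale subspace_0)

lemmas closed = add_closed diff_closed minus_closed scale_closed zero_closed one_closed mult_closed

lemmas distribs = bilinear_ladd[OF bilinear] bilinear_radd[OF bilinear] bilinear_lsub[OF bilinear]
  bilinear_rsub[OF bilinear] bilinear_lmul[OF bilinear] bilinear_rmul[OF bilinear]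
  bilinear_lneg[OF bilinear] bilinear_rneg[OF bilinear]

lemma one_mult: "a \<in> R \<Longrightarrow> e \<odot> a = a"
  using mult_commute mult_one one_closed by metis

definition quadratic_module :: "'a set \<Rightarrow> bool" where
  "quadratic_module M \<longleftrightarrow> M \<subseteq> R \<and> e \<in> M \<and> (\<forall>a\<in>M. \<forall>b\<in>M. a + b \<in> M) \<and>
     (\<forall>a\<in>M. \<forall>c\<in>R. c \<odot> c \<odot> a \<in> M)"

definition real_point :: "('a \<Rightarrow> real) \<Rightarrow> 'a set \<Rightarrow> bool" where
  "real_point \<phi> M \<longleftrightarrow>
     (\<forall>f\<in>R. \<forall>g\<in>R. \<phi> (f + g) = \<phi> f + \<phi> g) \<and> (\<forall>f\<in>R. \<forall>g\<in>R. \<phi> (f \<odot> g) = \<phi> f * \<phi> g) \<and>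
     (\<forall>f\<in>R. \<forall>r. \<phi> (r *\<^sub>R f) = r * \<phi> f) \<and> \<phi> e = 1 \<and> (\<forall>f\<in>M. \<phi> f \<ge> 0)"

text \<open>A quadratic module need not be closed under products of its elements, but it is a module over
  the semiring of sums of squares. This is what allows one element to be adjoined to it.\<close>

inductive_set sos :: "'a set" where
  square: "c \<in> R \<Longrightarrow> c \<odot> c \<in> sos"
| add: "s \<in> sos \<Longrightarrow> t \<in> sos \<Longrightarrow> s + t \<in> sos"

lemma sos_closed: "s \<in> sos \<Longrightarrow> s \<in> R"
  by (induction rule: sos.induct) (auto intro: closed)

lemma square_sos: "s \<in> sos \<Longrightarrow> c \<in> R \<Longrightarrow> c \<odot> c \<odot> s \<in> sos"
proof (induction rule: sos.induct)
  case (square d)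
  have "c \<odot> c \<odot> (d \<odot> d) = (c \<odot> d) \<odot> (c \<odot> d)"
    using square by (metis mult_assoc mult_commute)
  then show ?case
    using sos.square[of "c \<odot> d"] square by (auto intro: closed)
qed (auto simp: distribs intro: sos.add)

context
  fixes M assumes M: "quadratic_module M"
begin

lemma module_subset: "a \<in> M \<Longrightarrow> a \<in> R"
  and module_one: "e \<in> M"
  and module_add: "a \<in> M \<Longrightarrow> b \<in> M \<Longrightarrow> a + b \<in> M"
  and module_square: "a \<in> M \<Longrightarrow> c \<in> R \<Longrightarrow> c \<odot> c \<odot> a \<in> M"
  using M unfolding quadratic_module_def by auto

lemma module_scale: "a \<in> M \<Longrightarrow> r \<ge> 0 \<Longrightarrow> r *\<^sub>R a \<in> M"
  using module_square[of a "sqrt r *\<^sub>R e"] module_subset[of a]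
  by (simp add: distribs mult_one one_mult one_closed scale_closed)

lemma module_zero: "0 \<in> M"
  using module_scale[OF module_one, of 0] by simp

lemma module_sos: "s \<in> sos \<Longrightarrow> a \<in> M \<Longrightarrow> s \<odot> a \<in> M"
  by (induction rule: sos.induct) (auto simp: distribs intro: module_square module_add)

lemma sos_module: "s \<in> sos \<Longrightarrow> s \<in> M"
  using module_sos[OF _ module_one] by (simp add: mult_one)

lemma quadratic_module_adjoin:
  assumes "f \<in> R"
  shows "quadratic_module {a + s \<odot> f | a s. a \<in> M \<and> s \<in> sos}" (is "quadratic_module ?N")
    and "M \<subseteq> {a + s \<odot> f | a s. a \<in> M \<and> s \<in> sos}"
    and "f \<in> {a + s \<odot> f | a s. a \<in> M \<and> s \<in> sos}"
proof -
  have zero: "0 \<in> sos"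
    using sos.square[OF zero_closed] distribs(5)[of 0 0 0] by simp
  have one: "e \<in> sos"
    using sos.square[OF one_closed] by (simp add: mult_one)
  show "M \<subseteq> ?N"
    using zero bilinear_lzero[OF bilinear, of f] by force
  show "f \<in> ?N"
    using one module_zero one_mult[OF assms] by force
  show "quadratic_module ?N"
    unfolding quadratic_module_def
  proof (intro conjI ballI)
    show "?N \<subseteq> R"
      using assms by (blast intro: add_closed mult_closed module_subset sos_closed)
    show "e \<in> ?N"
      using \<open>M \<subseteq> ?N\<close> module_one by blast
    fix a assume "a \<in> ?N"
    then obtain u s where a: "a = u + s \<odot> f" "u \<in> M" "s \<in> sos" by blast
    show "a + b \<in> ?N" if "b \<in> ?N" for b
    proof -
      from that obtain v t where b: "b = v + t \<odot> f" "v \<in> M" "t \<in> sos" by blast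
      have "a + b = (u + v) + (s + t) \<odot> f"
        by (simp add: a b distribs)
      then show ?thesis using a b module_add sos.add by blast
    qed
    show "c \<odot> c \<odot> a \<in> ?N" if "c \<in> R" for c
    proof -
      have "c \<odot> c \<odot> a = c \<odot> c \<odot> u + (c \<odot> c \<odot> s) \<odot> f"
        by (simp add: a distribs mult_assoc)
      then show ?thesis using a that module_square square_sos by blast
    qed
  qed
qed

text \<open>Since every element is a difference of squares, whatever is stable under multiplication by
  squares and under subtraction is stable under multiplication by the whole algebra.\<close>

lemma difference_of_squares:
  "f \<in> R \<Longrightarrow> f = ((1/2) *\<^sub>R (f + e)) \<odot> ((1/2) *\<^sub>R (f + e)) - ((1/2) *\<^sub>R (f - e)) \<odot> ((1/2) *\<^sub>R (f - e))"
  by (simp add: distribs mult_one one_mult one_closed algebra_simps flip: scaleR_add_left)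

lemma support_ideal:
  assumes "a \<in> M" "- a \<in> M" "f \<in> R"
  shows "f \<odot> a \<in> M"
proof -
  let ?u = "(1/2) *\<^sub>R (f + e)" and ?v = "(1/2) *\<^sub>R (f - e)"
  have "f \<odot> a = ?u \<odot> ?u \<odot> a + ?v \<odot> ?v \<odot> (- a)"
    by (subst (1) difference_of_squares[OF assms(3)]) (simp add: distribs)
  also have "\<dots> \<in> M"
    using assms by (intro module_add module_square) (auto intro: closed)
  finally show ?thesis .
qed

text \<open>If neither \<open>f\<close> nor \<open>-f\<close> belonged to \<open>M\<close>, adjoining either of them would produce \<open>-1\<close>, that is
  \<open>-1 = a + s f = b - t f\<close> with \<open>a, b \<in> M\<close> and sums of squares \<open>s, t\<close>. Eliminating \<open>f\<close> gives
  \<open>-s = t + t a + s b \<in> M\<close>, hence \<open>s\<close> lies in the support ideal, and then so does \<open>s f\<close>; but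
  \<open>-1 = a + s f\<close> would be an element of \<open>M\<close>.\<close>

lemma maximal_module_total:
  assumes proper: "- e \<notin> M"
    and maximal: "\<And>N. quadratic_module N \<Longrightarrow> M \<subseteq> N \<Longrightarrow> - e \<notin> N \<Longrightarrow> N = M"
    and f: "f \<in> R"
  shows "f \<in> M \<or> - f \<in> M"
proof (rule ccontr)
  assume *: "\<not> (f \<in> M \<or> - f \<in> M)"
  have ex: "\<exists>a s. - e = a + s \<odot> g \<and> a \<in> M \<and> s \<in> sos" if "g \<in> R" "g \<notin> M" for g
    using maximal[OF quadratic_module_adjoin(1)[OF that(1)] quadratic_module_adjoin(2)[OF that(1)]]
      quadratic_module_adjoin(3)[OF that(1)] that(2) by auto
  obtain a s where a: "- e = a + s \<odot> f" "a \<in> M" "s \<in> sos"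
    using ex[OF f] * by auto
  obtain b t where b: "- e = b + t \<odot> (- f)" "b \<in> M" "t \<in> sos"
    using ex[OF minus_closed[OF f]] * by auto
  note sR = sos_closed[OF a(3)] and tR = sos_closed[OF b(3)]
  have "t \<odot> (s \<odot> f) = s \<odot> (t \<odot> f)"
    using sR tR by (metis mult_assoc mult_commute)
  moreover have "s \<odot> f = - e - a" "t \<odot> (- f) = - e - b"
    using a(1) b(1) by (metis add_diff_cancel_left')+
  moreover from this(2) have "- (t \<odot> f) = - (e + b)"
    by (simp add: distribs)
  ultimately have "t \<odot> (- e - a) = s \<odot> (e + b)"
    by (simp only: neg_equal_iff_equal)
  then have "- t - t \<odot> a = s + s \<odot> b"
    by (simp add: distribs mult_one)
  then have "s \<odot> b = - t - t \<odot> a - s"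
    by (metis add_diff_cancel_left')
  then have "- s = t + t \<odot> a + s \<odot> b"
    by simp
  also have "\<dots> \<in> M"
    by (intro module_add) (use a b in \<open>auto intro: module_sos sos_module\<close>)
  finally have "f \<odot> s \<in> M"
    using support_ideal[OF sos_module[OF a(3)] _ f] by blast
  then have "- e \<in> M"
    using a(1,2) module_add mult_commute[OF f sR] by metis
  with proper show False by simp
qed

text \<open>A total archimedean module is a Dedekind cut for every \<open>f\<close>: the value at \<open>f\<close> is the supremum of
  the reals \<open>r\<close> with \<open>f - r \<in> M\<close>. It is linear because \<open>M\<close> is a cone. It is
  multiplicative because \<open>f\<^sup>2\<close> is infinitesimal whenever \<open>f\<close> is, by the identity
  \<open>2 d (d\<^sup>2 - f\<^sup>2) = (d + f)\<^sup>2 (d - f) + (d - f)\<^sup>2 (d + f)\<close>.\<close>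

lemma total_module_point:
  assumes proper: "- e \<notin> M"
    and total: "\<And>f. f \<in> R \<Longrightarrow> f \<in> M \<or> - f \<in> M"
    and arch: "\<And>f. f \<in> R \<Longrightarrow> \<exists>r. r *\<^sub>R e - f \<in> M"
  shows "\<exists>\<phi>. real_point \<phi> M"
proof -
  define \<phi> where "\<phi> f = Sup {r. f - r *\<^sub>R e \<in> M}" for f
  have neg_e: "r \<ge> 0" if "r *\<^sub>R e \<in> M" for r
  proof (rule ccontr)
    assume "\<not> r \<ge> 0"
    then show False
      using module_scale[OF that, of "- 1 / r"] proper by (simp add: field_simps)
  qed
  have order: "r \<le> s" if "f - r *\<^sub>R e \<in> M" "s *\<^sub>R e - f \<in> M" for f r s
    using neg_e[of "s - r"] module_add[OF that] by (simp add: algebra_simps)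
  have ne: "\<exists>r. f - r *\<^sub>R e \<in> M" if "f \<in> R" for f
  proof -
    obtain r where "r *\<^sub>R e - (- f) \<in> M" using arch[OF minus_closed] \<open>f \<in> R\<close> by blast
    then show ?thesis by (intro exI[of _ "- r"]) (simp add: algebra_simps)
  qed
  have bdd: "bdd_above {r. f - r *\<^sub>R e \<in> M}" if "f \<in> R" for f
  proof -
    obtain s where "s *\<^sub>R e - f \<in> M" using arch \<open>f \<in> R\<close> by blast
    then show ?thesis using order by (intro bdd_aboveI[of _ s]) auto
  qed
  have below: "r \<le> \<phi> f" if "f \<in> R" "f - r *\<^sub>R e \<in> M" for f r
    unfolding \<phi>_def using that bdd by (intro cSup_upper) auto
  have above: "\<phi> f \<le> s" if "f \<in> R" "s *\<^sub>R e - f \<in> M" for f s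
    unfolding \<phi>_def using that ne order by (intro cSup_least) auto
  have in_M: "f - r *\<^sub>R e \<in> M" if "f \<in> R" "r < \<phi> f" for f r
    using total[of "f - r *\<^sub>R e"] above[of f r] that by (auto simp: closed)
  have in_M': "s *\<^sub>R e - f \<in> M" if "f \<in> R" "\<phi> f < s" for f s
    using total[of "s *\<^sub>R e - f"] below[of f s] that by (auto simp: closed)
  have \<phi>_unique: "\<phi> f = c" if "f \<in> R" "\<And>\<epsilon>. \<epsilon> > 0 \<Longrightarrow> f - (c - \<epsilon>) *\<^sub>R e \<in> M"
      "\<And>\<epsilon>. \<epsilon> > 0 \<Longrightarrow> (c + \<epsilon>) *\<^sub>R e - f \<in> M" for f c
  proof (rule antisym)
    show "\<phi> f \<le> c"
      by (rule field_le_epsilon) (rule above[OF that(1) that(3)])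
    show "c \<le> \<phi> f"
      by (rule field_le_epsilon) (use below[OF that(1) that(2)] in \<open>simp add: algebra_simps\<close>)
  qed
  have add: "\<phi> (f + g) = \<phi> f + \<phi> g" if "f \<in> R" "g \<in> R" for f g
  proof (rule \<phi>_unique)
    fix \<epsilon> :: real assume "\<epsilon> > 0"
    then have "f - (\<phi> f - \<epsilon>/2) *\<^sub>R e \<in> M" "g - (\<phi> g - \<epsilon>/2) *\<^sub>R e \<in> M"
        "(\<phi> f + \<epsilon>/2) *\<^sub>R e - f \<in> M" "(\<phi> g + \<epsilon>/2) *\<^sub>R e - g \<in> M"
      using that by (auto intro!: in_M in_M')
    from module_add[OF this(1,2)] module_add[OF this(3,4)]
    show "f + g - (\<phi> f + \<phi> g - \<epsilon>) *\<^sub>R e \<in> M" "(\<phi> f + \<phi> g + \<epsilon>) *\<^sub>R e - (f + g) \<in> M"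
      by (simp_all add: algebra_simps flip: scaleR_add_left)
  qed (use that in \<open>auto intro: closed\<close>)
  have one: "\<phi> e = 1"
  proof (rule \<phi>_unique)
    fix \<epsilon> :: real assume "\<epsilon> > 0"
    then show "e - (1 - \<epsilon>) *\<^sub>R e \<in> M" "(1 + \<epsilon>) *\<^sub>R e - e \<in> M"
      using module_scale[OF module_one, of \<epsilon>] by (simp_all add: algebra_simps)
  qed (rule one_closed)
  have zero: "\<phi> 0 = 0"
    using add[OF zero_closed zero_closed] by simp
  have minus: "\<phi> (- f) = - \<phi> f" if "f \<in> R" for f
    using add[OF that minus_closed[OF that]] zero by simp
  have diff: "\<phi> (f - g) = \<phi> f - \<phi> g" if "f \<in> R" "g \<in> R" for f g
    using add[OF that(1) minus_closed[OF that(2)]] minus[OF that(2)] by simp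
  have pos: "\<phi> f \<ge> 0" if "f \<in> M" for f
    using below[of f 0] that module_subset by simp
  have scale_pos: "\<phi> (r *\<^sub>R f) = r * \<phi> f" if "f \<in> R" "r > 0" for f r
  proof (rule \<phi>_unique)
    fix \<epsilon> :: real assume "\<epsilon> > 0"
    then have "f - (\<phi> f - \<epsilon>/r) *\<^sub>R e \<in> M" "(\<phi> f + \<epsilon>/r) *\<^sub>R e - f \<in> M"
      using that by (auto intro!: in_M in_M')
    from this[THEN module_scale, of r]
    show "r *\<^sub>R f - (r * \<phi> f - \<epsilon>) *\<^sub>R e \<in> M" "(r * \<phi> f + \<epsilon>) *\<^sub>R e - r *\<^sub>R f \<in> M"
      using that by (simp_all add: algebra_simps)
  qed (use that in \<open>auto intro: closed\<close>)
  have scale: "\<phi> (r *\<^sub>R f) = r * \<phi> f" if "f \<in> R" for f r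
    using scale_pos[OF that, of r] scale_pos[OF minus_closed[OF that], of "- r"] minus[OF that] zero
    by (cases r "0::real" rule: linorder_cases) auto
  have sq_null: "\<phi> (f \<odot> f) = 0" if f: "f \<in> R" "\<phi> f = 0" for f
  proof (rule \<phi>_unique)
    fix \<epsilon> :: real assume \<epsilon>: "\<epsilon> > 0"
    have "f \<odot> f \<in> M"
      using module_square[OF module_one f(1)] by (simp add: mult_one)
    then show "f \<odot> f - (0 - \<epsilon>) *\<^sub>R e \<in> M"
      using module_add[OF _ module_scale[OF module_one, of \<epsilon>]] \<epsilon> by simp
    \<comment> \<open>It remains to bound \<open>f\<^sup>2\<close> by \<open>\<epsilon> = d\<^sup>2\<close>, knowing \<open>-d < f < d\<close>.\<close>
    define d where "d = sqrt \<epsilon>"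
    have d: "d > 0" "d * d = \<epsilon>" using \<epsilon> by (auto simp: d_def)
    have 1: "d *\<^sub>R e - f \<in> M" "f - (- d) *\<^sub>R e \<in> M"
      using in_M'[OF f(1), of d] in_M[OF f(1), of "- d"] d f by simp_all
    have "(d *\<^sub>R e + f) \<odot> (d *\<^sub>R e + f) \<odot> (d *\<^sub>R e - f) +
        (d *\<^sub>R e - f) \<odot> (d *\<^sub>R e - f) \<odot> (f - (- d) *\<^sub>R e) \<in> M" (is "?x \<in> M")
      using 1 f by (intro module_add module_square) (auto intro: closed)
    moreover have "?x = (2 * d) *\<^sub>R (\<epsilon> *\<^sub>R e - f \<odot> f)"
      unfolding d(2)[symmetric] using f
      by (simp add: distribs mult_assoc mult_one one_mult closed algebra_simps flip: scaleR_add_left)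
    ultimately show "(0 + \<epsilon>) *\<^sub>R e - f \<odot> f \<in> M"
      using module_scale[of ?x "1 / (2 * d)"] d by simp
  qed (use f in \<open>auto intro: closed\<close>)
  have sq: "\<phi> (f \<odot> f) = \<phi> f * \<phi> f" if f: "f \<in> R" for f
  proof -
    define g where "g = f - \<phi> f *\<^sub>R e"
    have g: "g \<in> R" using f by (auto simp: g_def intro!: closed)
    have "\<phi> g = 0"
      using f by (simp add: g_def diff scale one closed)
    then have "\<phi> (g \<odot> g) = 0" by (rule sq_null[OF g])
    moreover have "g \<odot> g = f \<odot> f - (2 * \<phi> f) *\<^sub>R f + (\<phi> f * \<phi> f) *\<^sub>R e"
      using f by (simp add: g_def distribs mult_one one_mult closed algebra_simps flip: scaleR_add_left)
    ultimately show ?thesis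
      using f by (simp add: add diff scale one closed)
  qed
  have mult: "\<phi> (f \<odot> g) = \<phi> f * \<phi> g" if f: "f \<in> R" "g \<in> R" for f g
  proof -
    have "(f + g) \<odot> (f + g) = f \<odot> f + 2 *\<^sub>R (f \<odot> g) + g \<odot> g"
      using f by (simp add: distribs mult_commute[of g f] scaleR_2 algebra_simps)
    then have "\<phi> ((f + g) \<odot> (f + g)) = \<phi> (f \<odot> f) + 2 * \<phi> (f \<odot> g) + \<phi> (g \<odot> g)"
      using f by (simp add: add scale closed)
    then show ?thesis
      using f by (simp add: sq add closed algebra_simps)
  qed
  show ?thesis
    using add mult scale one pos unfolding real_point_def by blast
qed

end

text \<open>Every proper archimedean quadratic module has a real point: a maximal proper
  quadratic module above it, obtained from Zorn's lemma, is total.\<close>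

theorem archimedean_module_point:
  assumes Q: "quadratic_module Q" and proper: "- e \<notin> Q"
    and arch: "\<And>f. f \<in> R \<Longrightarrow> \<exists>r. r *\<^sub>R e - f \<in> Q"
  shows "\<exists>\<phi>. real_point \<phi> Q"
proof -
  let ?\<F> = "{N. quadratic_module N \<and> Q \<subseteq> N \<and> - e \<notin> N}"
  have "\<exists>M\<in>?\<F>. \<forall>N\<in>?\<F>. M \<subseteq> N \<longrightarrow> N = M"
  proof (rule subset_Zorn_nonempty)
    show "?\<F> \<noteq> {}" using Q proper by blast
    fix \<C> assume \<C>: "\<C> \<noteq> {}" "subset.chain ?\<F> \<C>"
    then have mem: "quadratic_module N" "Q \<subseteq> N" "- e \<notin> N" if "N \<in> \<C>" for N
      using that unfolding subset_chain_def by auto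
    have "quadratic_module (\<Union>\<C>)"
      unfolding quadratic_module_def
    proof (intro conjI ballI)
      show "\<Union>\<C> \<subseteq> R" "e \<in> \<Union>\<C>"
        using mem(1) \<C>(1) module_subset module_one by blast+
      fix a assume "a \<in> \<Union>\<C>"
      then obtain N where N: "N \<in> \<C>" "a \<in> N" by blast
      show "c \<odot> c \<odot> a \<in> \<Union>\<C>" if "c \<in> R" for c
        using N that mem(1) module_square by blast
      fix b assume "b \<in> \<Union>\<C>"
      then obtain N' where N': "N' \<in> \<C>" "b \<in> N'" by blast
      have "N \<subseteq> N' \<or> N' \<subseteq> N"
        using \<C>(2) N N' unfolding subset_chain_def by blast
      then show "a + b \<in> \<Union>\<C>"
        using N N' mem(1) module_add by blast
    qed
    moreover have "Q \<subseteq> \<Union>\<C>" using mem(2) \<C>(1) by blast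
    moreover have "- e \<notin> \<Union>\<C>" using mem(3) by blast
    ultimately show "\<Union>\<C> \<in> ?\<F>" by simp
  qed
  then obtain M where M: "quadratic_module M" "Q \<subseteq> M" "- e \<notin> M"
    and "\<forall>N\<in>?\<F>. M \<subseteq> N \<longrightarrow> N = M"
    by blast
  then have max: "N = M" if "quadratic_module N" "M \<subseteq> N" "- e \<notin> N" for N
    using that by blast
  have total: "f \<in> M \<or> - f \<in> M" if "f \<in> R" for f
    using M(3) max that by (rule maximal_module_total[OF M(1)])
  have arch': "\<exists>r. r *\<^sub>R e - f \<in> M" if "f \<in> R" for f
    using arch[OF that] M(2) by blast
  obtain \<phi> where "real_point \<phi> M"
    using total_module_point[OF M(1,3)] total arch' by blast
  then show ?thesis
    using M(2) unfolding real_point_def by blast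
qed

end

section \<open>Characters\<close>

lemma cstar_algebraD:
  assumes "cstar_algebra A"
  shows "a \<in> A \<Longrightarrow> a \<in> bounded_ops" "0 \<in> A" "a \<in> A \<Longrightarrow> b \<in> A \<Longrightarrow> a + b \<in> A"
    "a \<in> A \<Longrightarrow> cscale c a \<in> A" "a \<in> A \<Longrightarrow> b \<in> A \<Longrightarrow> a o\<^sub>L b \<in> A" "a \<in> A \<Longrightarrow> adj a \<in> A" "closed A"
    "a \<in> A \<Longrightarrow> r *\<^sub>R a \<in> A" "a \<in> A \<Longrightarrow> - a \<in> A" "a \<in> A \<Longrightarrow> b \<in> A \<Longrightarrow> a - b \<in> A"
proof -
  show 1: "a \<in> A \<Longrightarrow> a \<in> bounded_ops" "0 \<in> A" "a \<in> A \<Longrightarrow> b \<in> A \<Longrightarrow> a + b \<in> A"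
    "a \<in> A \<Longrightarrow> cscale c a \<in> A" "a \<in> A \<Longrightarrow> b \<in> A \<Longrightarrow> a o\<^sub>L b \<in> A" "a \<in> A \<Longrightarrow> adj a \<in> A" "closed A"
    for a b c
    using assms unfolding cstar_algebra_def by blast+
  show "a \<in> A \<Longrightarrow> r *\<^sub>R a \<in> A" and 2: "a \<in> A \<Longrightarrow> - a \<in> A" for a
    by (simp_all add: scaleR_eq_cscale uminus_eq_cscale 1)
  show "a \<in> A \<Longrightarrow> b \<in> A \<Longrightarrow> a - b \<in> A"
    using 1(3)[of a "- b"] 2 by simp
qed

lemma comm_cstar_algebraD:
  assumes "comm_cstar_algebra A"
  shows "cstar_algebra A" "a \<in> A \<Longrightarrow> b \<in> A \<Longrightarrow> a o\<^sub>L b = b o\<^sub>L a"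
  using assms unfolding comm_cstar_algebra_def by auto

lemma characterD:
  assumes "x \<in> max_ideal_space B"
  shows "a \<in> B \<Longrightarrow> b \<in> B \<Longrightarrow> x (a + b) = x a + x b"
    "a \<in> B \<Longrightarrow> x (cscale c a) = c * x a"
    "a \<in> B \<Longrightarrow> b \<in> B \<Longrightarrow> x (a o\<^sub>L b) = x a * x b"
    "x \<in> extensional B"
  using assms unfolding max_ideal_space_def by auto

lemma character_scaleR: "x \<in> max_ideal_space B \<Longrightarrow> a \<in> B \<Longrightarrow> x (r *\<^sub>R a) = of_real r * x a"
  by (simp add: scaleR_eq_cscale characterD(2))

lemma character_minus: "x \<in> max_ideal_space B \<Longrightarrow> a \<in> B \<Longrightarrow> x (- a) = - x a"
  by (simp add: uminus_eq_cscale characterD(2))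

lemma character_diff:
  "cstar_algebra B \<Longrightarrow> x \<in> max_ideal_space B \<Longrightarrow> a \<in> B \<Longrightarrow> b \<in> B \<Longrightarrow> x (a - b) = x a - x b"
  using characterD(1)[of x B a "- b"] character_minus[of x B b] by (simp add: cstar_algebraD(9))

lemma character_id:
  assumes "x \<in> max_ideal_space B" "id_blinfun \<in> B"
  shows "x id_blinfun = 1"
proof -
  obtain a where a: "a \<in> B" "x a \<noteq> 0"
    using assms(1) unfolding max_ideal_space_def by blast
  then show ?thesis
    using characterD(3)[OF assms(1) a(1) assms(2)] by simp
qed

text \<open>In a unital algebra a multiplicative functional is nonzero if and only if it is unital.\<close>

lemma max_ideal_space_iff:
  assumes "id_blinfun \<in> B"
  shows "x \<in> max_ideal_space B \<longleftrightarrow> x \<in> extensional B \<and>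
    (\<forall>a\<in>B. \<forall>b\<in>B. x (a + b) = x a + x b) \<and> (\<forall>c. \<forall>a\<in>B. x (cscale c a) = c * x a) \<and>
    (\<forall>a\<in>B. \<forall>b\<in>B. x (a o\<^sub>L b) = x a * x b) \<and> x id_blinfun = 1"
  using character_id[OF _ assms, of x] assms unfolding max_ideal_space_def
  by (smt (verit) mem_Collect_eq zero_neq_one)

text \<open>If \<open>x b\<close> exceeded the norm of \<open>b\<close>, then \<open>c = b / x b\<close> would satisfy \<open>\<parallel>c\<parallel> < 1\<close> and \<open>x c = 1\<close>.
  Banach's fixed point theorem solves \<open>s = c + c s\<close> in the algebra, and applying \<open>x\<close>
  yields \<open>x s = 1 + x s\<close>.\<close>

lemma character_contractive:
  assumes B: "cstar_algebra B" and x: "x \<in> max_ideal_space B" and b: "b \<in> B"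
  shows "cmod (x b) \<le> norm b"
proof (rule ccontr)
  assume "\<not> ?thesis"
  then have less: "norm b < cmod (x b)" by simp
  then have ne: "x b \<noteq> 0" by auto
  define c where "c = cscale (1 / x b) b"
  have c: "c \<in> B" "x c = 1"
    using b ne by (auto simp: c_def cstar_algebraD(4)[OF B] characterD(2)[OF x])
  have "norm c \<le> norm b / cmod (x b)"
    using norm_cscale[of "1 / x b" b] by (simp add: c_def norm_divide)
  also have "\<dots> < 1" using less ne by simp
  finally have "norm c < 1" .
  have "\<exists>!s\<in>B. c + (c o\<^sub>L s) = s"
  proof (rule Banach_fix[where c = "norm c"])
    show "complete B"
      using cstar_algebraD(7)[OF B] by (simp add: complete_eq_closed)
    show "(\<lambda>s. c + (c o\<^sub>L s)) ` B \<subseteq> B"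
      using c(1) by (auto intro!: cstar_algebraD(3,5)[OF B])
    show "dist (c + (c o\<^sub>L s)) (c + (c o\<^sub>L t)) \<le> norm c * dist s t" for s t
      using norm_blinfun_compose[of c "s - t"] by (simp add: dist_norm compose_diff_right)
  qed (use \<open>norm c < 1\<close> c in auto)
  then obtain s where s: "s \<in> B" "c + (c o\<^sub>L s) = s" by blast
  have "x s = x c + x c * x s"
    using characterD(1,3)[OF x] s c(1) cstar_algebraD(5)[OF B] by metis
  then show False by (simp add: c(2))
qed

text \<open>For \<open>0 \<le> T \<le> c\<close> the operator \<open>c (c T - T\<^sup>2) = T (c - T) T + (c - T) T (c - T)\<close> is positive,
  so that \<open>\<parallel>T v\<parallel>\<^sup>2 \<le> c \<langle>T v, v\<rangle>\<close>.\<close>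

lemma norm_le_of_form_bounds:
  fixes T :: "'h :: chilbert_space \<Rightarrow>\<^sub>L 'h"
  assumes T: "T \<in> bounded_ops" "adj T = T"
    and lower: "\<And>v. 0 \<le> Re (cinner (T v) v)" and upper: "\<And>v. Re (cinner (T v) v) \<le> c * (norm v)\<^sup>2"
    and c: "0 < c"
  shows "norm T \<le> c"
proof (rule norm_blinfun_bound)
  fix v
  define w where "w = T v"
  have wv: "Re (cinner (T w) v) = (norm w)\<^sup>2"
    using cinner_adj[OF T(1), of w v] by (simp add: T(2) cinner_self w_def)
  have vw: "Re (cinner w w) = (norm w)\<^sup>2" by (simp add: cinner_self)
  have "0 \<le> Re (cinner (T (c *\<^sub>R v - w)) (c *\<^sub>R v - w))"
    by (rule lower)
  also have "\<dots> = c * (c * Re (cinner w v)) - 2 * c * (norm w)\<^sup>2 + Re (cinner (T w) w)"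
    unfolding blinfun.diff_right blinfun.scaleR_right cinner_diff_left cinner_diff_right
      cinner_scaleR_left cinner_scaleR_right w_def[symmetric]
    by (simp add: wv vw algebra_simps)
  finally have "c * (norm w)\<^sup>2 \<le> c * (c * Re (cinner w v))"
    using upper[of w] by linarith
  then have "(norm w)\<^sup>2 \<le> c * Re (cinner w v)"
    using c by simp
  also have "\<dots> \<le> c * (norm w * norm v)"
    using c Re_cinner_le by (intro mult_left_mono) auto
  finally have "norm w * norm w \<le> (c * norm v) * norm w"
    by (simp add: power2_eq_square mult_ac)
  then have "norm w \<le> c * norm v"
    using c by (cases "w = 0") (simp_all add: mult_le_cancel_right)
  then show "norm (T v) \<le> c * norm v" by (simp add: w_def)
qed (use c in simp)

lemma Re_cinner_le_norm: "Re (cinner (T v) v) \<le> norm T * (norm v)\<^sup>2"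
  for T :: "'h :: chilbert_space \<Rightarrow>\<^sub>L 'h"
proof -
  have "Re (cinner (T v) v) \<le> norm (T v) * norm v" by (rule Re_cinner_le)
  also have "\<dots> \<le> norm T * norm v * norm v"
    by (intro mult_right_mono norm_blinfun) simp
  finally show ?thesis by (simp add: power2_eq_square mult.assoc)
qed

text \<open>An operator that is bounded below by a positive scalar is invertible, so no character can
  vanish on it. Quantitatively, \<open>T = \<parallel>h\<parallel> + r - h\<close> has norm at most \<open>\<parallel>h\<parallel>\<close>, while
  \<open>\<tau> h = 0\<close> would force \<open>\<tau> T = \<parallel>h\<parallel> + r\<close>.\<close>

lemma character_nonzero_of_lower_bound:
  assumes A: "cstar_algebra A" and id: "id_blinfun \<in> A" and \<tau>: "\<tau> \<in> max_ideal_space A"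
    and h: "h \<in> A" "adj h = h" and r: "0 < r" and lower: "\<And>v. r * (norm v)\<^sup>2 \<le> Re (cinner (h v) v)"
  shows "\<tau> h \<noteq> 0"
proof
  assume 0: "\<tau> h = 0"
  define c where "c = norm h + r"
  define T where "T = c *\<^sub>R id_blinfun - h"
  note D = cstar_algebraD[OF A]
  have TA: "T \<in> A" unfolding T_def by (intro D id h)
  have form: "Re (cinner (T v) v) = c * (norm v)\<^sup>2 - Re (cinner (h v) v)" for v
    by (simp add: T_def blinfun.diff_left blinfun.scaleR_left cinner_diff_left cinner_scaleR_left
        cinner_self)
  have "norm T \<le> norm h"
  proof (cases "h = 0")
    case True
    have "v = 0" for v :: 'a
      using lower[of v] r by (simp add: True mult_le_0_iff)
    then have "T v = 0" for v by metis
    then show ?thesis by (simp add: blinfun_eqI True)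
  next
    case False
    show ?thesis
    proof (rule norm_le_of_form_bounds)
      show "T \<in> bounded_ops" by (rule D(1)[OF TA])
      show "adj T = T"
        by (simp add: T_def adj_diff adj_scaleR D(1) h id D(8))
      show "0 \<le> Re (cinner (T v) v)" for v
      proof -
        have "r * (norm v)\<^sup>2 \<ge> 0" using r by simp
        then show ?thesis
          using Re_cinner_le_norm[of h v] unfolding form c_def by (simp add: algebra_simps)
      qed
      show "Re (cinner (T v) v) \<le> norm h * (norm v)\<^sup>2" for v
        using lower[of v] unfolding form c_def by (simp add: algebra_simps)
    qed (use False in simp)
  qed
  moreover have "\<tau> T = c"
    using id h by (simp add: T_def character_diff[OF A \<tau>] character_scaleR[OF \<tau>] D(8) 0
        character_id[OF \<tau> id])
  ultimately have "\<bar>c\<bar> \<le> norm h"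
    using character_contractive[OF A \<tau> TA] by simp
  then show False using r by (simp add: c_def)
qed

lemma selfadjoint_square_form:
  assumes "g \<in> bounded_ops" "adj g = g"
  shows "cinner ((g o\<^sub>L g) v) v = (norm (g v))\<^sup>2"
  using cinner_adj[OF assms(1), of "g v" v] by (simp add: assms(2) cinner_self)

text \<open>If \<open>\<tau> a = p + i q\<close>, then \<open>\<tau>\<close> vanishes on \<open>(a - p)\<^sup>2 + q\<^sup>2\<close>, which is bounded below by \<open>q\<^sup>2\<close>.\<close>

lemma character_real:
  assumes A: "cstar_algebra A" and id: "id_blinfun \<in> A" and \<tau>: "\<tau> \<in> max_ideal_space A"
    and a: "a \<in> A" "adj a = a"
  shows "\<tau> a = of_real (Re (\<tau> a))"
proof -
  note D = cstar_algebraD[OF A]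
  define p q where "p = Re (\<tau> a)" and "q = Im (\<tau> a)"
  define g where "g = a - p *\<^sub>R id_blinfun"
  define h where "h = (g o\<^sub>L g) + (q * q) *\<^sub>R id_blinfun"
  have g: "g \<in> A" "adj g = g"
    using a id by (auto simp: g_def adj_diff adj_scaleR D)
  have h: "h \<in> A" "adj h = h"
    using g id by (auto simp: h_def adj_add adj_scaleR adj_compose D)
  have "\<tau> g = \<i> * q"
    using a id by (simp add: g_def character_diff[OF A \<tau>] character_scaleR[OF \<tau>] D
        character_id[OF \<tau> id] p_def q_def complex_eq_iff)
  then have "\<tau> h = 0"
    using g id by (simp add: h_def characterD[OF \<tau>] character_scaleR[OF \<tau>] D
        character_id[OF \<tau> id] complex_eq_iff)
  moreover have "(q * q) * (norm v)\<^sup>2 \<le> Re (cinner (h v) v)" for v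
    using selfadjoint_square_form[OF D(1)[OF g(1)] g(2), of v]
    by (simp add: h_def blinfun.add_left blinfun.scaleR_left cinner_add_left cinner_scaleR_left
        cinner_self)
  ultimately have "\<not> 0 < q * q"
    using character_nonzero_of_lower_bound[OF A id \<tau> h, of "q * q"] by blast
  then have "q = 0"
    using not_real_square_gt_zero by auto
  then show ?thesis by (simp add: p_def q_def complex_eq_iff)
qed

lemma cartesian_decomposition:
  assumes A: "cstar_algebra A" and a: "a \<in> A"
  obtains r s where "r \<in> A" "adj r = r" "s \<in> A" "adj s = s" "a = r + cscale \<i> s"
proof
  note D = cstar_algebraD[OF A]
  let ?r = "cscale (1/2) (a + adj a)" and ?s = "cscale (\<i>/2) (adj a - a)"
  show "?r \<in> A" "?s \<in> A"
    using a by (auto intro!: D)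
  show "adj ?r = ?r"
    using a by (simp add: adj_cscale adj_add adj_adj D bounded_ops_add add.commute)
  have "adj ?s = cscale (- \<i> / 2) (a - adj a)"
    using a by (simp add: adj_cscale adj_diff adj_adj D bounded_ops_diff)
  also have "\<dots> = ?s"
    using cscale_cscale[of "- \<i> / 2" "-1" "adj a - a"] by (simp flip: uminus_eq_cscale)
  finally show "adj ?s = ?s" .
  have "cscale \<i> ?s = cscale (1/2) (- adj a + a)"
    using cscale_cscale[of "1/2" "-1" "adj a - a"] by (simp add: cscale_cscale flip: uminus_eq_cscale)
  then have "?r + cscale \<i> ?s = cscale (1/2) (a + a)"
    by (simp flip: cscale_add_right)
  also have "a + a = cscale 2 a"
    using cscale_add_left[of 1 1 a] by simp
  finally show "a = ?r + cscale \<i> ?s"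
    by (simp add: cscale_cscale)
qed

lemma cartesian_decomposition_unique:
  assumes "r \<in> bounded_ops" "adj r = r" "s \<in> bounded_ops" "adj s = s"
    and "r' \<in> bounded_ops" "adj r' = r'" "s' \<in> bounded_ops" "adj s' = s'"
    and eq: "r + cscale \<i> s = r' + cscale \<i> s'"
  shows "r = r'" "s = s'"
proof -
  have "adj (r + cscale \<i> s) = r - cscale \<i> s" "adj (r' + cscale \<i> s') = r' - cscale \<i> s'"
    using assms(1-8)
    by (simp_all add: adj_add adj_cscale bounded_ops_cscale cscale_minus_left)
  with eq have "r - cscale \<i> s = r' - cscale \<i> s'" by simp
  then have "(r + cscale \<i> s) + (r - cscale \<i> s) = (r' + cscale \<i> s') + (r' - cscale \<i> s')"
    by (simp only: eq)
  then have "r + r = r' + r'" by simp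
  then have "2 *\<^sub>R r = 2 *\<^sub>R r'" by (simp only: scaleR_2)
  then show "r = r'" by simp
  with eq have "cscale (- \<i>) (cscale \<i> s) = cscale (- \<i>) (cscale \<i> s')" by simp
  then show "s = s'" by (simp add: cscale_cscale)
qed

lemma character_adj:
  assumes A: "cstar_algebra A" and id: "id_blinfun \<in> A" and \<tau>: "\<tau> \<in> max_ideal_space A"
    and a: "a \<in> A"
  shows "\<tau> (adj a) = cnj (\<tau> a)"
proof -
  note D = cstar_algebraD[OF A]
  obtain r s where rs: "r \<in> A" "adj r = r" "s \<in> A" "adj s = s" "a = r + cscale \<i> s"
    using cartesian_decomposition[OF A a] by blast
  have "adj a = r + cscale (- \<i>) s"
    using rs by (simp add: adj_add adj_cscale D)
  then have "\<tau> (adj a) = \<tau> r - \<i> * \<tau> s" "\<tau> a = \<tau> r + \<i> * \<tau> s"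
    using rs by (simp_all add: characterD[OF \<tau>] D)
  with character_real[OF A id \<tau> rs(1,2)] character_real[OF A id \<tau> rs(3,4)]
  show ?thesis by (simp add: complex_eq_iff)
qed

text \<open>A character of the real algebra of self-adjoint elements extends complex linearly, through the
  decomposition into real and imaginary parts.\<close>

lemma complexify_character:
  fixes \<phi> :: "('h :: chilbert_space \<Rightarrow>\<^sub>L 'h) \<Rightarrow> real"
  assumes B: "cstar_algebra B" and id: "id_blinfun \<in> B"
  defines "R \<equiv> {b \<in> B. adj b = b}"
  assumes comm: "\<And>a b. a \<in> R \<Longrightarrow> b \<in> R \<Longrightarrow> a o\<^sub>L b = b o\<^sub>L a"
    and add: "\<And>a b. a \<in> R \<Longrightarrow> b \<in> R \<Longrightarrow> \<phi> (a + b) = \<phi> a + \<phi> b"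
    and mult: "\<And>a b. a \<in> R \<Longrightarrow> b \<in> R \<Longrightarrow> \<phi> (a o\<^sub>L b) = \<phi> a * \<phi> b"
    and scale: "\<And>a r. a \<in> R \<Longrightarrow> \<phi> (r *\<^sub>R a) = r * \<phi> a"
    and one: "\<phi> id_blinfun = 1"
  shows "\<exists>x\<in>max_ideal_space B. \<forall>b\<in>R. x b = of_real (\<phi> b)"
proof -
  note D = cstar_algebraD[OF B]
  have R: "a + b \<in> R" "a o\<^sub>L b \<in> R" "r *\<^sub>R a \<in> R" "0 \<in> R" "id_blinfun \<in> R" "a - b \<in> R"
    if "a \<in> R" "b \<in> R" for a b r
    using that comm[OF that] id by (auto simp: R_def D adj_add adj_compose adj_scaleR adj_diff)
  have decomp: "\<exists>r s. r \<in> R \<and> s \<in> R \<and> b = r + cscale \<i> s" if "b \<in> B" for b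
    using cartesian_decomposition[OF B that] unfolding R_def by blast
  define x where "x = (\<lambda>b\<in>B. THE z. \<exists>r\<in>R. \<exists>s\<in>R. b = r + cscale \<i> s \<and> z = Complex (\<phi> r) (\<phi> s))"
  have RB: "b \<in> B" "b \<in> bounded_ops" "adj b = b" if "b \<in> R" for b
    using that D(1) by (auto simp: R_def)
  have x: "x (r + cscale \<i> s) = Complex (\<phi> r) (\<phi> s)" if "r \<in> R" "s \<in> R" for r s
  proof -
    have "r + cscale \<i> s \<in> B" using that RB by (auto intro!: D)
    moreover have "(THE z. \<exists>r'\<in>R. \<exists>s'\<in>R. r + cscale \<i> s = r' + cscale \<i> s' \<and> z = Complex (\<phi> r') (\<phi> s'))
        = Complex (\<phi> r) (\<phi> s)"
    proof (rule the_equality)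
      fix z assume "\<exists>r'\<in>R. \<exists>s'\<in>R. r + cscale \<i> s = r' + cscale \<i> s' \<and> z = Complex (\<phi> r') (\<phi> s')"
      then obtain r' s' where z: "r' \<in> R" "s' \<in> R" "r + cscale \<i> s = r' + cscale \<i> s'"
          "z = Complex (\<phi> r') (\<phi> s')"
        by blast
      then have "r = r'" "s = s'"
        using cartesian_decomposition_unique[OF RB(2,3)[OF that(1)] RB(2,3)[OF that(2)]
            RB(2,3)[OF z(1)] RB(2,3)[OF z(2)] z(3)] by auto
      with z show "z = Complex (\<phi> r) (\<phi> s)" by simp
    qed (use that in blast)
    ultimately show ?thesis by (simp add: x_def)
  qed
  have x_R: "x r = of_real (\<phi> r)" if "r \<in> R" for r
  proof -
    have "\<phi> 0 = 0" using scale[OF that, of 0] scale[of 0 0] R(4)[OF that that] by simp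
    moreover have "cscale \<i> 0 = (0 :: 'h \<Rightarrow>\<^sub>L 'h)" using cscale_cscale[of \<i> 0 0] by simp
    ultimately show ?thesis
      using x[OF that R(4)[OF that that]] by (simp add: complex_eq_iff)
  qed
  have neg: "\<phi> (a - b) = \<phi> a - \<phi> b" if "a \<in> R" "b \<in> R" for a b
    using add[OF that(1) R(3)[OF that(2) that(2)], of "-1"] scale[OF that(2), of "-1"] by simp
  have "x \<in> max_ideal_space B"
    unfolding max_ideal_space_iff[OF id]
  proof (intro conjI ballI allI)
    show "x \<in> extensional B" by (simp add: x_def)
    show "x id_blinfun = 1"
      using x_R[of id_blinfun] id one by (simp add: R_def)
  next
    fix a b assume "a \<in> B" "b \<in> B"
    then obtain r s t u where d: "r \<in> R" "s \<in> R" "a = r + cscale \<i> s" "t \<in> R" "u \<in> R" "b = t + cscale \<i> u"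
      using decomp by metis
    have xa: "x a = Complex (\<phi> r) (\<phi> s)" and xb: "x b = Complex (\<phi> t) (\<phi> u)"
      using x d by simp_all
    have "a + b = (r + t) + cscale \<i> (s + u)"
      by (simp add: d cscale_add_right)
    then have "x (a + b) = Complex (\<phi> (r + t)) (\<phi> (s + u))"
      using x R(1) d(1,2,4,5) by metis
    then show "x (a + b) = x a + x b"
      using d(1,2,4,5) by (simp add: xa xb add complex_eq_iff)
    have "a o\<^sub>L b = ((r o\<^sub>L t) - (s o\<^sub>L u)) + cscale \<i> ((r o\<^sub>L u) + (s o\<^sub>L t))"
      using d RB by (simp add: compose_add_left compose_add_right compose_cscale_left
          compose_cscale_right cscale_add_right cscale_cscale cscale_minus_left)
    then have "x (a o\<^sub>L b) = Complex (\<phi> ((r o\<^sub>L t) - (s o\<^sub>L u))) (\<phi> ((r o\<^sub>L u) + (s o\<^sub>L t)))"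
      using x R(1,2,6) d(1,2,4,5) by metis
    then show "x (a o\<^sub>L b) = x a * x b"
      using d(1,2,4,5) R(2) by (simp add: xa xb add neg mult complex_eq_iff)
  next
    fix c a assume "a \<in> B"
    then obtain r s where d: "r \<in> R" "s \<in> R" "a = r + cscale \<i> s"
      using decomp by metis
    have c: "cscale c b = Re c *\<^sub>R b + cscale \<i> (Im c *\<^sub>R b)" for b :: "'h \<Rightarrow>\<^sub>L 'h"
      unfolding scaleR_eq_cscale cscale_cscale cscale_add_left[symmetric] by (simp flip: complex_eq)
    have "cscale c (cscale \<i> s) = cscale \<i> (Re c *\<^sub>R s) - Im c *\<^sub>R s"
      by (subst c) (simp add: scaleR_eq_cscale cscale_cscale mult.commute cscale_minus_left)
    then have "cscale c a = (Re c *\<^sub>R r - Im c *\<^sub>R s) + cscale \<i> (Re c *\<^sub>R s + Im c *\<^sub>R r)"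
      using c[of r] by (simp add: d cscale_add_right)
    then have "x (cscale c a) = Complex (\<phi> (Re c *\<^sub>R r - Im c *\<^sub>R s)) (\<phi> (Re c *\<^sub>R s + Im c *\<^sub>R r))"
      using x R(1,3,6) d(1,2) by metis
    moreover have "x a = Complex (\<phi> r) (\<phi> s)"
      using x d by simp
    ultimately show "x (cscale c a) = c * x a"
      using d(1,2) R(3) by (simp add: add neg scale complex_eq_iff)
  qed
  then show ?thesis using x_R by blast
qed

section \<open>Extension of characters\<close>

text \<open>The self-adjoint elements \<open>b\<close> of \<open>B\<close> with \<open>b \<ge> -h\<close> for some well-behaved \<open>h \<in> A\<close> with
  \<open>\<tau> h = 0\<close> form an archimedean quadratic module, and it is proper because \<open>h \<ge> 1\<close> is
  incompatible with \<open>\<tau> h = 0\<close>. It contains \<open>-g\<^sup>2\<close> for every self-adjoint \<open>g \<in> A\<close> in the kernel of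
  \<open>\<tau>\<close>, so that a real point of it has to vanish on \<open>g\<close>; its complexification therefore extends \<open>\<tau>\<close>.\<close>

theorem character_extension:
  fixes A B :: "('h :: chilbert_space \<Rightarrow>\<^sub>L 'h) set"
  assumes A: "cstar_algebra A" and B: "comm_cstar_algebra B" and AB: "A \<subseteq> B"
    and id: "id_blinfun \<in> A" and \<tau>: "\<tau> \<in> max_ideal_space A"
  shows "\<exists>x\<in>max_ideal_space B. \<forall>a\<in>A. x a = \<tau> a"
proof -
  note cB = comm_cstar_algebraD(1)[OF B] and comm = comm_cstar_algebraD(2)[OF B]
  note D = cstar_algebraD[OF A] and E = cstar_algebraD[OF cB]
  have idB: "id_blinfun \<in> B" using AB id by blast
  define R where "R = {b \<in> B. adj b = b}"
  interpret comm_real_algebra R "(o\<^sub>L)" id_blinfun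
  proof
    show "subspace R"
      by (rule subspaceI) (auto simp: R_def E adj_add adj_scaleR)
    show "bilinear (o\<^sub>L)"
      unfolding bilinear_def
      by (intro conjI allI linearI)
         (simp_all add: compose_add_left compose_add_right compose_scaleR_left compose_scaleR_right)
    show "a o\<^sub>L b o\<^sub>L c = a o\<^sub>L (b o\<^sub>L c)" for a b c :: "'h \<Rightarrow>\<^sub>L 'h"
      by (rule blinfun_eqI) simp
  qed (auto simp: R_def E comm adj_compose idB)
  have RB: "b \<in> B" "b \<in> bounded_ops" "adj b = b" if "b \<in> R" for b
    using that E(1) by (auto simp: R_def)
  \<comment> \<open>The condition on \<open>c\<close> says \<open>c\<^sup>2 h \<le> \<parallel>c\<parallel>\<^sup>2 h\<close>. It makes \<open>Q\<close> stable under multiplication by squares although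
    \<open>c\<^sup>2 h\<close> need not lie in \<open>A\<close>, and it is immediate for the squares \<open>h = g\<^sup>2\<close> used below.\<close>
  define dominates where
    "dominates h b \<longleftrightarrow> h \<in> A \<and> adj h = h \<and> \<tau> h = 0 \<and>
       (\<forall>c\<in>R. \<forall>v. Re (cinner (blinfun_apply h (blinfun_apply c v)) (blinfun_apply c v)) \<le> (norm c)\<^sup>2 * Re (cinner (blinfun_apply h v) v)) \<and>
       (\<forall>v. 0 \<le> Re (cinner (b v) v) + Re (cinner (h v) v))" for h b :: "'h \<Rightarrow>\<^sub>L 'h"
  define Q where "Q = {b \<in> R. \<exists>h. dominates h b}"
  have \<tau>0: "\<tau> 0 = 0"
    using characterD(2)[OF \<tau> D(2), of 0] by simp
  have pos_Q: "b \<in> Q" if "b \<in> R" "\<And>v. 0 \<le> Re (cinner (b v) v)" for b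
    using that D(2) \<tau>0 unfolding Q_def dominates_def by (auto intro!: exI[of _ 0])
  have Q: "quadratic_module Q"
    unfolding quadratic_module_def
  proof (intro conjI ballI)
    show "Q \<subseteq> R" by (auto simp: Q_def)
    show "id_blinfun \<in> Q"
      by (rule pos_Q[OF one_closed]) (simp add: cinner_ge_zero)
    fix a assume "a \<in> Q"
    then obtain h where a: "a \<in> R" and h: "dominates h a" unfolding Q_def by blast
    show "a + b \<in> Q" if "b \<in> Q" for b
    proof -
      from that obtain k where b: "b \<in> R" and k: "dominates k b" unfolding Q_def by blast
      have "dominates (h + k) (a + b)"
        using h k unfolding dominates_def
        by (auto simp: D adj_add characterD(1)[OF \<tau>] blinfun.add_left cinner_add_left
            distrib_left intro!: add_mono) (smt (verit))
      then show ?thesis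
        using add_closed[OF a b] unfolding Q_def by blast
    qed
    show "c o\<^sub>L c o\<^sub>L a \<in> Q" if c: "c \<in> R" for c
    proof -
      have conj: "cinner ((c o\<^sub>L c o\<^sub>L a) v) v = cinner (a (c v)) (c v)" for v
      proof -
        have "c o\<^sub>L c o\<^sub>L a = c o\<^sub>L a o\<^sub>L c"
          using a c by (metis mult_assoc mult_commute)
        then show ?thesis
          using cinner_adj[OF RB(2)[OF c], of "a (c v)" v] by (simp add: RB(3)[OF c])
      qed
      have "dominates ((norm c)\<^sup>2 *\<^sub>R h) (c o\<^sub>L c o\<^sub>L a)"
        unfolding dominates_def
      proof (intro conjI ballI allI)
        show "(norm c)\<^sup>2 *\<^sub>R h \<in> A" "adj ((norm c)\<^sup>2 *\<^sub>R h) = (norm c)\<^sup>2 *\<^sub>R h" "\<tau> ((norm c)\<^sup>2 *\<^sub>R h) = 0"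
          using h by (auto simp: dominates_def D adj_scaleR character_scaleR[OF \<tau>])
        fix v
        show "Re (cinner (((norm c)\<^sup>2 *\<^sub>R h) (d v)) (d v))
            \<le> (norm d)\<^sup>2 * Re (cinner (((norm c)\<^sup>2 *\<^sub>R h) v) v)" if "d \<in> R" for d
          using h that mult_left_mono[of "Re (cinner (h (d v)) (d v))" "(norm d)\<^sup>2 * Re (cinner (h v) v)" "(norm c)\<^sup>2"]
          by (simp add: dominates_def blinfun.scaleR_left cinner_scaleR_left mult_ac)
        have "0 \<le> Re (cinner (a (c v)) (c v)) + Re (cinner (h (c v)) (c v))"
          and "Re (cinner (h (c v)) (c v)) \<le> (norm c)\<^sup>2 * Re (cinner (h v) v)"
          using h c by (auto simp: dominates_def)
        then show "0 \<le> Re (cinner ((c o\<^sub>L c o\<^sub>L a) v) v) + Re (cinner (((norm c)\<^sup>2 *\<^sub>R h) v) v)"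
          unfolding conj by (simp add: blinfun.scaleR_left cinner_scaleR_left)
      qed
      moreover have "c o\<^sub>L c o\<^sub>L a \<in> R" using a c by (intro closed)
      ultimately show ?thesis unfolding Q_def by blast
    qed
  qed
  have proper: "- id_blinfun \<notin> Q"
  proof
    assume "- id_blinfun \<in> Q"
    then obtain h where h: "dominates h (- id_blinfun)" unfolding Q_def by blast
    then have "1 * (norm v)\<^sup>2 \<le> Re (cinner (h v) v)" for v
      by (simp add: dominates_def blinfun.minus_left cinner_minus_left cinner_self)
    then have "\<tau> h \<noteq> 0"
      using h by (intro character_nonzero_of_lower_bound[OF A id \<tau>, of h 1]) (auto simp: dominates_def)
    with h show False by (simp add: dominates_def)
  qed
  have arch: "\<exists>r. r *\<^sub>R id_blinfun - f \<in> Q" if f: "f \<in> R" for f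
  proof (intro exI pos_Q)
    show "norm f *\<^sub>R id_blinfun - f \<in> R" using f by (intro closed)
    show "0 \<le> Re (cinner ((norm f *\<^sub>R id_blinfun - f) v) v)" for v
      using Re_cinner_le_norm[of f v]
      by (simp add: blinfun.diff_left blinfun.scaleR_left cinner_diff_left cinner_scaleR_left cinner_self)
  qed
  obtain \<phi> where "real_point \<phi> Q"
    using archimedean_module_point[OF Q proper] arch by blast
  then have \<phi>: "\<And>f g. f \<in> R \<Longrightarrow> g \<in> R \<Longrightarrow> \<phi> (f + g) = \<phi> f + \<phi> g"
    "\<And>f g. f \<in> R \<Longrightarrow> g \<in> R \<Longrightarrow> \<phi> (f o\<^sub>L g) = \<phi> f * \<phi> g"
    "\<And>f r. f \<in> R \<Longrightarrow> \<phi> (r *\<^sub>R f) = r * \<phi> f"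
    "\<phi> id_blinfun = 1" "\<And>f. f \<in> Q \<Longrightarrow> \<phi> f \<ge> 0"
    unfolding real_point_def by blast+
  obtain x where x: "x \<in> max_ideal_space B" "\<And>b. b \<in> R \<Longrightarrow> x b = of_real (\<phi> b)"
    using complexify_character[OF cB idB, of \<phi>, folded R_def] mult_commute \<phi>(1-4) by blast
  have selfadjoint: "x a = \<tau> a" if a: "a \<in> A" "adj a = a" for a
  proof -
    define g where "g = a - Re (\<tau> a) *\<^sub>R id_blinfun"
    have g: "g \<in> A" "adj g = g"
      using a id by (auto simp: g_def adj_diff adj_scaleR D)
    have gR: "g \<in> R" and aR: "a \<in> R" using g a AB by (auto simp: R_def)
    have "\<tau> g = 0"
      using a id character_real[OF A id \<tau> a]
      by (simp add: g_def character_diff[OF A \<tau>] character_scaleR[OF \<tau>] D character_id[OF \<tau> id])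
    then have "dominates (g o\<^sub>L g) (- (g o\<^sub>L g))"
      unfolding dominates_def
    proof (intro conjI ballI allI)
      show "g o\<^sub>L g \<in> A" "adj (g o\<^sub>L g) = g o\<^sub>L g" using g by (auto simp: D adj_compose)
      show "\<tau> (g o\<^sub>L g) = 0" if "\<tau> g = 0" using g that by (simp add: characterD[OF \<tau>])
      fix v
      show "0 \<le> Re (cinner ((- (g o\<^sub>L g)) v) v) + Re (cinner ((g o\<^sub>L g) v) v)"
        by (simp add: blinfun.minus_left cinner_minus_left)
      fix c assume c: "c \<in> R"
      have "g (c v) = c (g v)"
        using mult_commute[OF gR c] by (metis blinfun_apply_blinfun_compose)
      then have "norm (g (c v)) \<le> norm c * norm (g v)"
        by (simp add: norm_blinfun)
      then have "(norm (g (c v)))\<^sup>2 \<le> (norm c)\<^sup>2 * (norm (g v))\<^sup>2"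
        using power_mono[of _ _ 2] by (fastforce simp flip: power_mult_distrib)
      then show "Re (cinner ((g o\<^sub>L g) (c v)) (c v)) \<le> (norm c)\<^sup>2 * Re (cinner ((g o\<^sub>L g) v) v)"
        using selfadjoint_square_form[OF D(1)[OF g(1)] g(2)] by simp
    qed
    then have "- (g o\<^sub>L g) \<in> Q"
      unfolding Q_def using gR by (auto intro: closed)
    then have "0 \<le> \<phi> (- (g o\<^sub>L g))" by (rule \<phi>(5))
    also have "\<dots> = - (\<phi> g * \<phi> g)"
      using \<phi>(3)[of "g o\<^sub>L g" "-1"] \<phi>(2)[OF gR gR] gR by (simp add: closed)
    finally have "\<phi> g = 0" by (auto simp: mult_le_0_iff)
    moreover have "g + Re (\<tau> a) *\<^sub>R id_blinfun = a" by (simp add: g_def)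
    ultimately have "\<phi> a = Re (\<tau> a)"
      using \<phi>(1)[OF gR scale_closed[OF one_closed], of "Re (\<tau> a)"] \<phi>(3)[OF one_closed] \<phi>(4) by simp
    then show ?thesis
      using x(2)[OF aR] character_real[OF A id \<tau> a] by simp
  qed
  have "x a = \<tau> a" if a: "a \<in> A" for a
  proof -
    obtain r s where rs: "r \<in> A" "adj r = r" "s \<in> A" "adj s = s" "a = r + cscale \<i> s"
      using cartesian_decomposition[OF A a] by blast
    moreover have "r \<in> B" "s \<in> B" using rs AB by auto
    ultimately show ?thesis
      by (simp add: characterD[OF x(1)] characterD[OF \<tau>] D E selfadjoint)
  qed
  with x(1) show ?thesis by blast
qed

section \<open>The coefficient algebra\<close>

lemma cstar_algebra_Inter:
  assumes "\<A> \<noteq> {}" "\<And>A. A \<in> \<A> \<Longrightarrow> cstar_algebra A"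
  shows "cstar_algebra (\<Inter>\<A>)"
  unfolding cstar_algebra_def
proof (intro conjI ballI allI)
  show "\<Inter>\<A> \<subseteq> bounded_ops" using assms cstar_algebraD(1) by blast
qed (use assms(2) in \<open>auto intro: cstar_algebraD closed_Inter\<close>)

lemma cstar_algebra_hull:
  assumes "S \<subseteq> bounded_ops"
  shows "cstar_algebra (cstar_algebra hull S)"
  unfolding hull_def
  by (rule cstar_algebra_Inter) (use assms cstar_algebra_bounded_ops in auto)

lemma cstar_algebra_commutant:
  assumes S: "S \<subseteq> bounded_ops" and adj: "\<And>s. s \<in> S \<Longrightarrow> adj s \<in> S"
  shows "cstar_algebra {T \<in> bounded_ops. \<forall>s\<in>S. T o\<^sub>L s = s o\<^sub>L T}"
  unfolding cstar_algebra_def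
proof (intro conjI ballI allI)
  note D = cstar_algebraD[OF cstar_algebra_bounded_ops]
  have "closed {T. T o\<^sub>L s = s o\<^sub>L T}" for s :: "'a \<Rightarrow>\<^sub>L 'a"
    by (intro closed_Collect_eq continuous_intros)
  then have "closed (bounded_ops \<inter> (\<Inter>s\<in>S. {T. T o\<^sub>L s = s o\<^sub>L T}))"
    by (intro closed_Int closed_INT closed_bounded_ops) auto
  then show "closed {T \<in> bounded_ops. \<forall>s\<in>S. T o\<^sub>L s = s o\<^sub>L T}"
    by (rule back_subst[of closed]) auto
  fix a assume a: "a \<in> {T \<in> bounded_ops. \<forall>s\<in>S. T o\<^sub>L s = s o\<^sub>L T}"
  show "adj a \<in> {T \<in> bounded_ops. \<forall>s\<in>S. T o\<^sub>L s = s o\<^sub>L T}"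
  proof (intro CollectI conjI ballI)
    fix s assume s: "s \<in> S"
    then have "adj (a o\<^sub>L adj s) = adj (adj s o\<^sub>L a)" using a adj by simp
    moreover have "s \<in> bounded_ops" "adj s \<in> bounded_ops" using s S adj by auto
    ultimately show "adj a o\<^sub>L s = s o\<^sub>L adj a"
      using a by (simp add: adj_compose adj_adj)
  qed (use a D in auto)
  show "cscale c a \<in> {T \<in> bounded_ops. \<forall>s\<in>S. T o\<^sub>L s = s o\<^sub>L T}" for c
    using a S by (auto simp: D compose_cscale_left compose_cscale_right)
  fix b assume b: "b \<in> {T \<in> bounded_ops. \<forall>s\<in>S. T o\<^sub>L s = s o\<^sub>L T}"
  show "a + b \<in> {T \<in> bounded_ops. \<forall>s\<in>S. T o\<^sub>L s = s o\<^sub>L T}"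
    using a b by (auto simp: D compose_add_left compose_add_right)
  have "a o\<^sub>L b o\<^sub>L s = s o\<^sub>L (a o\<^sub>L b)" if "s \<in> S" for s
  proof -
    have as: "a o\<^sub>L s = s o\<^sub>L a" and bs: "b o\<^sub>L s = s o\<^sub>L b" using a b that by auto
    have "a o\<^sub>L b o\<^sub>L s = (a o\<^sub>L s) o\<^sub>L b" by (simp add: compose_assoc bs)
    then show ?thesis by (simp add: as compose_assoc)
  qed
  then show "a o\<^sub>L b \<in> {T \<in> bounded_ops. \<forall>s\<in>S. T o\<^sub>L s = s o\<^sub>L T}"
    using a b by (auto simp: D)
qed auto

text \<open>A self-adjoint commuting set is contained in its commutant, which is a \<open>C\<^sup>*\<close>-algebra; so the
  generated algebra commutes with the generators. Repeating the argument with the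
  generated algebra in place of the generators shows that it is commutative.\<close>

lemma cstar_algebra_hull_commutative:
  assumes S: "S \<subseteq> bounded_ops" and adj: "\<And>s. s \<in> S \<Longrightarrow> adj s \<in> S"
    and comm: "\<And>s t. s \<in> S \<Longrightarrow> t \<in> S \<Longrightarrow> s o\<^sub>L t = t o\<^sub>L s"
  shows "comm_cstar_algebra (cstar_algebra hull S)"
proof -
  let ?B = "cstar_algebra hull S"
  let ?C = "\<lambda>S :: ('a \<Rightarrow>\<^sub>L 'a) set. {T \<in> bounded_ops. \<forall>s\<in>S. T o\<^sub>L s = s o\<^sub>L T}"
  have B: "cstar_algebra ?B" using S by (rule cstar_algebra_hull)
  have "?B \<subseteq> ?C S"
    using cstar_algebra_commutant[OF S adj] S comm by (intro hull_minimal) auto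
  then have "S \<subseteq> ?C ?B" using S by auto
  then have "?B \<subseteq> ?C ?B"
    using cstar_algebra_commutant[of ?B] cstar_algebraD(1,6)[OF B] by (intro hull_minimal) auto
  then show ?thesis using B unfolding comm_cstar_algebra_def by auto
qed

locale endomorphism_system =
  fixes A :: "('h :: chilbert_space \<Rightarrow>\<^sub>L 'h) set" and U :: "'h \<Rightarrow>\<^sub>L 'h"
  assumes A: "comm_cstar_algebra A"
    and id_A: "id_blinfun \<in> A"
    and U: "U \<in> bounded_ops"
    and endo: "star_endomorphism A (delta U)"
    and initial_A: "adj U o\<^sub>L U \<in> A"
begin

lemmas cA = comm_cstar_algebraD(1)[OF A] and comm_A = comm_cstar_algebraD(2)[OF A]
lemmas AD = cstar_algebraD[OF cA]

lemma adj_U: "adj U \<in> bounded_ops" "adj (adj U) = U"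
  using U by (simp_all add: adj_bounded_ops adj_adj)

lemma delta_A: "a \<in> A \<Longrightarrow> delta U a \<in> A"
  using endo by (auto simp: star_endomorphism_def)

lemma delta_funpow_A: "a \<in> A \<Longrightarrow> (delta U ^^ n) a \<in> A"
  by (induction n) (auto intro: delta_A)

lemma final_eq: "delta U id_blinfun = U o\<^sub>L adj U"
  and initial_eq: "delta_star U id_blinfun = adj U o\<^sub>L U"
  by (simp_all add: delta_def delta_star_def)

lemma final_A: "U o\<^sub>L adj U \<in> A"
  using delta_A[OF id_A] by (simp add: final_eq)

text \<open>Since \<open>U U\<^sup>* = \<delta> 1\<close> is idempotent, \<open>W = U - U U\<^sup>* U\<close> satisfies \<open>W W\<^sup>* = 0\<close>.\<close>

lemma partial_isometry: "U o\<^sub>L (adj U o\<^sub>L U) = U" "adj U o\<^sub>L (U o\<^sub>L adj U) = adj U"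
proof -
  have "delta U (id_blinfun o\<^sub>L id_blinfun) = delta U id_blinfun o\<^sub>L delta U id_blinfun"
    using endo id_A unfolding star_endomorphism_def by blast
  then have proj: "U o\<^sub>L (adj U o\<^sub>L (U o\<^sub>L adj U)) = U o\<^sub>L adj U"
    by (simp add: final_eq compose_assoc)
  have proj': "U o\<^sub>L (adj U o\<^sub>L (U o\<^sub>L (adj U o\<^sub>L X))) = U o\<^sub>L (adj U o\<^sub>L X)" for X
    using arg_cong[OF proj, of "\<lambda>T. T o\<^sub>L X"] by (simp add: compose_assoc)
  define W where "W = U - (U o\<^sub>L (adj U o\<^sub>L U))"
  have W: "W \<in> bounded_ops" "adj W = adj U - (adj U o\<^sub>L (U o\<^sub>L adj U))"
    using U adj_U by (auto simp: W_def bounded_ops_diff bounded_ops_compose adj_diff adj_compose compose_assoc)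
  have WW: "W o\<^sub>L adj W = 0"
    unfolding W(2) unfolding W_def by (simp add: compose_diff_left compose_diff_right compose_assoc proj proj')
  have "adj W = 0"
  proof (rule blinfun_eqI)
    fix y
    have "cinner (adj W y) (adj W y) = cinner ((W o\<^sub>L adj W) y) y"
      by (simp add: cinner_adj[OF W(1)])
    then show "adj W y = blinfun_apply 0 y" by (simp add: WW cinner_self)
  qed
  moreover from this have "W = 0" using adj_adj[OF W(1)] by simp
  ultimately have 0: "U - (U o\<^sub>L (adj U o\<^sub>L U)) = 0" "adj U - (adj U o\<^sub>L (U o\<^sub>L adj U)) = 0"
    unfolding W(2) by (simp_all only: W_def)
  show "U o\<^sub>L (adj U o\<^sub>L U) = U" "adj U o\<^sub>L (U o\<^sub>L adj U) = adj U"
    using 0[THEN eq_iff_diff_eq_0[THEN iffD2], THEN sym] by auto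
qed

lemma partial_isometry': "U o\<^sub>L (adj U o\<^sub>L (U o\<^sub>L X)) = U o\<^sub>L X"
    "adj U o\<^sub>L (U o\<^sub>L (adj U o\<^sub>L X)) = adj U o\<^sub>L X"
  using arg_cong[OF partial_isometry(1), of "\<lambda>T. T o\<^sub>L X"]
    arg_cong[OF partial_isometry(2), of "\<lambda>T. T o\<^sub>L X"] by (simp_all add: compose_assoc)

text \<open>Moving \<open>U\<^sup>* U\<close> past \<open>a\<close> gives \<open>\<delta> a U = U a U\<^sup>* U = U U\<^sup>* U a = U a\<close>. All commutation relations of the
  coefficient algebra follow from this relation and its adjoint.\<close>

lemma U_intertwines:
  assumes "a \<in> A"
  shows "U o\<^sub>L a = delta U a o\<^sub>L U" "a o\<^sub>L adj U = adj U o\<^sub>L delta U a"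
proof -
  have c: "a o\<^sub>L (adj U o\<^sub>L U) = adj U o\<^sub>L (U o\<^sub>L a)"
    using comm_A[OF assms initial_A] by (simp add: compose_assoc)
  show "U o\<^sub>L a = delta U a o\<^sub>L U"
    by (simp add: delta_def compose_assoc c partial_isometry')
  have "adj U o\<^sub>L (U o\<^sub>L (a o\<^sub>L adj U)) = a o\<^sub>L (adj U o\<^sub>L U) o\<^sub>L adj U"
    by (simp add: c compose_assoc)
  then show "a o\<^sub>L adj U = adj U o\<^sub>L delta U a"
    by (simp add: delta_def compose_assoc partial_isometry)
qed

text \<open>Elements of \<open>A\<close> pass through \<open>U\<^sup>n\<close> at the price of applying \<open>\<delta>\<^sup>n\<close>. As \<open>A\<close> is commutative, the two sides
  show that \<open>\<delta>\<^sub>*\<^sup>n a\<close> commutes with \<open>A\<close>.\<close>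

lemma delta_star_funpow_absorb:
  assumes "b \<in> A"
  shows "(delta_star U ^^ n) a o\<^sub>L b = (delta_star U ^^ n) (a o\<^sub>L (delta U ^^ n) b)"
    "b o\<^sub>L (delta_star U ^^ n) a = (delta_star U ^^ n) ((delta U ^^ n) b o\<^sub>L a)"
proof -
  have step: "delta_star U c o\<^sub>L b = delta_star U (c o\<^sub>L delta U b)"
    "b o\<^sub>L delta_star U c = delta_star U (delta U b o\<^sub>L c)" if "b \<in> A" for b c
    using U_intertwines[OF that] by (simp_all add: delta_star_def compose_assoc) (simp flip: compose_assoc)
  have "(delta_star U ^^ n) a o\<^sub>L b = (delta_star U ^^ n) (a o\<^sub>L (delta U ^^ n) b) \<and>
    b o\<^sub>L (delta_star U ^^ n) a = (delta_star U ^^ n) ((delta U ^^ n) b o\<^sub>L a)"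
    using assms
  proof (induction n arbitrary: b)
    case (Suc n)
    then show ?case
      using Suc.IH[OF delta_A[OF Suc.prems]] by (simp add: step funpow_swap1[of "delta U"])
  qed simp
  then show "(delta_star U ^^ n) a o\<^sub>L b = (delta_star U ^^ n) (a o\<^sub>L (delta U ^^ n) b)"
    "b o\<^sub>L (delta_star U ^^ n) a = (delta_star U ^^ n) ((delta U ^^ n) b o\<^sub>L a)"
    by auto
qed

lemma delta_star_funpow_commutes:
  "a \<in> A \<Longrightarrow> b \<in> A \<Longrightarrow> (delta_star U ^^ n) a o\<^sub>L b = b o\<^sub>L (delta_star U ^^ n) a"
  by (simp add: delta_star_funpow_absorb comm_A delta_funpow_A)

text \<open>In \<open>U\<^sup>* X U U\<^sup>* Y U\<close> the projection \<open>U U\<^sup>*\<close> can be moved to the left, where \<open>U\<^sup>*\<close> absorbs it.\<close>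

lemma delta_star_mult:
  assumes "X o\<^sub>L (U o\<^sub>L adj U) = (U o\<^sub>L adj U) o\<^sub>L X"
  shows "delta_star U X o\<^sub>L delta_star U Y = delta_star U (X o\<^sub>L Y)"
proof -
  have "delta_star U X o\<^sub>L delta_star U Y = adj U o\<^sub>L (X o\<^sub>L (U o\<^sub>L adj U)) o\<^sub>L (Y o\<^sub>L U)"
    by (simp add: delta_star_def compose_assoc)
  then show ?thesis
    unfolding assms by (simp add: delta_star_def compose_assoc partial_isometry')
qed

lemma delta_star_funpow_mult:
  assumes "a \<in> A" "b \<in> A"
  shows "(delta_star U ^^ n) a o\<^sub>L (delta_star U ^^ n) b = (delta_star U ^^ n) (a o\<^sub>L b)"
  by (induction n) (simp_all add: delta_star_mult delta_star_funpow_commutes assms final_A)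

text \<open>Stripping one \<open>\<delta>\<^sub>*\<close> from both factors reduces to the case where one of them is in \<open>A\<close>.\<close>

lemma generators_commute:
  "a \<in> A \<Longrightarrow> b \<in> A \<Longrightarrow>
    (delta_star U ^^ n) a o\<^sub>L (delta_star U ^^ m) b = (delta_star U ^^ m) b o\<^sub>L (delta_star U ^^ n) a"
proof (induction n arbitrary: m)
  case 0
  then show ?case by (simp add: delta_star_funpow_commutes)
next
  case (Suc n)
  show ?case
  proof (cases m)
    case 0
    then show ?thesis using delta_star_funpow_commutes[of a b "Suc n"] Suc.prems by simp
  next
    case (Suc k)
    then show ?thesis
      using Suc.IH[of k] Suc.prems
      by (simp add: delta_star_mult delta_star_funpow_commutes final_A)
  qed
qed

abbreviation B where "B \<equiv> coeff_algebra A U"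

lemma delta_star_funpow_bounded_ops: "a \<in> bounded_ops \<Longrightarrow> (delta_star U ^^ n) a \<in> bounded_ops"
  by (induction n) (simp_all add: delta_star_def bounded_ops_compose U adj_U)

lemma adj_delta_star_funpow: "a \<in> bounded_ops \<Longrightarrow> adj ((delta_star U ^^ n) a) = (delta_star U ^^ n) (adj a)"
proof (induction n)
  case (Suc n)
  then show ?case
    using delta_star_funpow_bounded_ops[of a n]
    by (simp add: delta_star_def[of U "(delta_star U ^^ n) _"] adj_compose bounded_ops_compose U adj_U
        compose_assoc)
qed simp

lemma comm_B: "comm_cstar_algebra B"
  unfolding coeff_algebra_def
proof (rule cstar_algebra_hull_commutative)
  show "(\<Union>n. (delta_star U ^^ n) ` A) \<subseteq> bounded_ops"
    using AD(1) delta_star_funpow_bounded_ops by auto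
  show "adj s \<in> (\<Union>n. (delta_star U ^^ n) ` A)" if "s \<in> (\<Union>n. (delta_star U ^^ n) ` A)" for s
    using that AD(1,6) adj_delta_star_funpow by fastforce
qed (use generators_commute in auto)

lemmas cB = comm_cstar_algebraD(1)[OF comm_B]
lemmas BD = cstar_algebraD[OF cB]

lemma generator_B: "a \<in> A \<Longrightarrow> (delta_star U ^^ n) a \<in> B"
  using hull_subset[of "\<Union>n. (delta_star U ^^ n) ` A" cstar_algebra] by (auto simp: coeff_algebra_def)

lemma A_B: "A \<subseteq> B"
  using generator_B[of _ 0] by auto

lemma id_B: "id_blinfun \<in> B"
  using A_B id_A by auto

text \<open>A property of elements of the coefficient algebra that is inherited by the \<open>C\<^sup>*\<close>-operations
  and by norm limits need only be checked on the generators \<open>\<delta>\<^sub>*\<^sup>n a\<close>. This takes the place of a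
  description of the dense subalgebra that they span.\<close>

lemma coeff_algebra_induct:
  assumes "cstar_algebra {b \<in> B. P b}" "\<And>n a. a \<in> A \<Longrightarrow> P ((delta_star U ^^ n) a)" "b \<in> B"
  shows "P b"
proof -
  have "B \<subseteq> {b \<in> B. P b}"
    unfolding coeff_algebra_def[of A U]
    by (rule hull_minimal) (use assms generator_B in \<open>auto simp: coeff_algebra_def\<close>)
  with assms(3) show ?thesis by auto
qed

text \<open>Here \<open>U\<^sup>* U\<close> commutes with \<open>b\<close> because the coefficient algebra is commutative and contains \<open>A\<close>.\<close>

lemma delta_B_mult:
  assumes "b \<in> B" "c \<in> B"
  shows "delta U (b o\<^sub>L c) = delta U b o\<^sub>L delta U c"
proof -
  have "b o\<^sub>L (adj U o\<^sub>L U) = (adj U o\<^sub>L U) o\<^sub>L b"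
    using comm_cstar_algebraD(2)[OF comm_B] assms(1) initial_A A_B by blast
  moreover have "delta U b o\<^sub>L delta U c = U o\<^sub>L (b o\<^sub>L (adj U o\<^sub>L U)) o\<^sub>L (c o\<^sub>L adj U)"
    by (simp add: delta_def compose_assoc)
  ultimately show ?thesis
    by (simp add: delta_def compose_assoc partial_isometry')
qed

lemma delta_add: "delta U (b + c) = delta U b + delta U c"
  by (simp add: delta_def compose_add_left compose_add_right)

lemma delta_cscale: "delta U (cscale r b) = cscale r (delta U b)"
  by (simp add: delta_def compose_cscale_left compose_cscale_right U)

lemma delta_delta_star: "delta U (delta_star U b) = (U o\<^sub>L adj U) o\<^sub>L b o\<^sub>L (U o\<^sub>L adj U)"
  by (simp add: delta_def delta_star_def compose_assoc)

lemma delta_B: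
  assumes "b \<in> B"
  shows "delta U b \<in> B"
proof (rule coeff_algebra_induct[of "\<lambda>b. delta U b \<in> B"])
  have "closed (B \<inter> delta U -` B)"
    unfolding delta_def by (intro closed_Int BD(7) closed_vimage continuous_intros)
  moreover have "B \<inter> delta U -` B = {b \<in> B. delta U b \<in> B}" by auto
  moreover have "delta U (adj b) \<in> B" if "b \<in> B" "delta U b \<in> B" for b
  proof -
    have "delta U (adj b) = adj (delta U b)"
      using that(1) BD(1) by (simp add: delta_def adj_compose bounded_ops_compose U adj_U compose_assoc)
    then show ?thesis using that BD(6) by simp
  qed
  moreover have "delta U 0 = 0" using delta_cscale[of 0 0] by simp
  ultimately show "cstar_algebra {b \<in> B. delta U b \<in> B}"
    using BD(1) unfolding cstar_algebra_def by (auto simp: BD delta_add delta_cscale delta_B_mult)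
next
  fix n a assume a: "a \<in> A"
  have f: "U o\<^sub>L adj U \<in> B" using final_A A_B by auto
  show "delta U ((delta_star U ^^ n) a) \<in> B"
  proof (cases n)
    case 0
    then show ?thesis using a delta_A A_B by auto
  next
    case (Suc k)
    then show ?thesis using generator_B[OF a, of k] f by (auto simp: delta_delta_star intro: BD(5))
  qed
qed (rule assms)

lemma delta_funpow_B: "b \<in> B \<Longrightarrow> (delta U ^^ n) b \<in> B"
  by (induction n) (auto intro: delta_B)

lemma delta_funpow_add: "(delta U ^^ n) (b + c) = (delta U ^^ n) b + (delta U ^^ n) c"
  by (induction n) (auto simp: delta_add)

lemma delta_funpow_cscale: "(delta U ^^ n) (cscale r b) = cscale r ((delta U ^^ n) b)"
  by (induction n) (auto simp: delta_cscale)

lemma delta_funpow_mult: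
  "b \<in> B \<Longrightarrow> c \<in> B \<Longrightarrow> (delta U ^^ n) (b o\<^sub>L c) = (delta U ^^ n) b o\<^sub>L (delta U ^^ n) c"
  by (induction n) (auto simp: delta_B_mult delta_funpow_B)

end

section \<open>From characters of the coefficient algebra to sequences\<close>

text \<open>Characters are contractive, hence continuous.\<close>

lemma character_tendsto:
  assumes B: "cstar_algebra B" and x: "x \<in> max_ideal_space B"
    and X: "X \<longlonglongrightarrow> b" "\<And>n. X n \<in> B" "b \<in> B"
  shows "(\<lambda>n. x (X n)) \<longlonglongrightarrow> x b"
proof -
  have "(\<lambda>n. norm (X n - b)) \<longlonglongrightarrow> 0"
    using X(1) by (simp add: LIM_zero tendsto_norm_zero)
  moreover have "cmod (x (X n) - x b) \<le> norm (X n - b)" for n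
    using character_contractive[OF B x cstar_algebraD(10)[OF B X(2,3)]] character_diff[OF B x X(2,3)]
    by simp
  ultimately have "(\<lambda>n. x (X n) - x b) \<longlonglongrightarrow> 0"
    using Lim_null_comparison[of "\<lambda>n. x (X n) - x b" "\<lambda>n. norm (X n - b)" sequentially] by simp
  then show ?thesis by (simp add: LIM_zero_iff)
qed

context endomorphism_system
begin

text \<open>The operator \<open>U\<^sup>*\<^sup>n U\<^sup>n\<close>. A character takes the value 0 or 1 on it, and this decides whether the
  \<open>n\<close>-th coordinate of the sequence attached to the character is zero or a character of \<open>A\<close>.\<close>

abbreviation initial_proj :: "nat \<Rightarrow> 'h \<Rightarrow>\<^sub>L 'h" where
  "initial_proj n \<equiv> (delta_star U ^^ n) id_blinfun"

lemma initial_proj_Suc: "initial_proj (Suc n) = (delta_star U ^^ n) (adj U o\<^sub>L U)"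
  by (simp add: funpow_Suc_right initial_eq del: funpow.simps)

lemma initial_proj_B: "initial_proj n \<in> B"
  by (rule generator_B[OF id_A])

lemma delta_star_funpow_add: "(delta_star U ^^ n) (a + b) = (delta_star U ^^ n) a + (delta_star U ^^ n) b"
  by (induction n) (auto simp: delta_star_def compose_add_left compose_add_right)

lemma delta_star_funpow_cscale: "(delta_star U ^^ n) (cscale c a) = cscale c ((delta_star U ^^ n) a)"
  by (induction n) (auto simp: delta_star_def compose_cscale_left compose_cscale_right adj_U)

lemma xi_apply: "a \<in> A \<Longrightarrow> xi A U n x a = x ((delta_star U ^^ n) a)"
  by (simp add: xi_def)

context
  fixes x assumes x: "x \<in> max_ideal_space B"
begin

lemmas xD = characterD[OF x]

lemma character_delta_star_mult: "a \<in> A \<Longrightarrow> b \<in> A \<Longrightarrow>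
    x ((delta_star U ^^ n) (a o\<^sub>L b)) = x ((delta_star U ^^ n) a) * x ((delta_star U ^^ n) b)"
  by (simp add: generator_B xD(3) flip: delta_star_funpow_mult)

lemma character_initial_proj: "x (initial_proj n) = 0 \<or> x (initial_proj n) = 1"
  using character_delta_star_mult[OF id_A id_A, of n] by simp

text \<open>The projections \<open>U\<^sup>*\<^sup>n U\<^sup>n\<close> decrease with \<open>n\<close>.\<close>

lemma character_initial_proj_antimono: "m \<le> n \<Longrightarrow> x (initial_proj n) = 1 \<Longrightarrow> x (initial_proj m) = 1"
proof (induction n rule: dec_induct)
  case (step n)
  have "x (initial_proj (Suc n)) = x (initial_proj (Suc n)) * x (initial_proj n)"
    using character_delta_star_mult[OF initial_A id_A, of n] by (simp add: initial_proj_Suc del: funpow.simps)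
  with step show ?case by (simp del: funpow.simps)
qed

lemma xi_zero: "x (initial_proj n) = 0 \<Longrightarrow> xi A U n x = zero_functional A"
  using character_delta_star_mult[OF _ id_A, of _ n] by (auto simp: xi_def zero_functional_def)

lemma xi_character: "x (initial_proj n) = 1 \<Longrightarrow> xi A U n x \<in> max_ideal_space A"
  unfolding max_ideal_space_iff[OF id_A]
  by (auto simp: xi_apply AD id_A delta_star_funpow_add delta_star_funpow_cscale xD(1,2) generator_B character_delta_star_mult)
     (simp add: xi_def)

text \<open>From \<open>\<delta>\<^sub>* (\<delta> a) = U\<^sup>* U a U\<^sup>* U\<close>. This is what links consecutive coordinates through \<open>\<alpha>\<close>.\<close>

lemma character_delta_star_delta:
  assumes "a \<in> A"
  shows "x ((delta_star U ^^ Suc n) (delta U a)) = x (initial_proj (Suc n)) * x ((delta_star U ^^ n) a) * x (initial_proj (Suc n))"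
proof -
  have "delta_star U (delta U a) = (adj U o\<^sub>L U) o\<^sub>L a o\<^sub>L (adj U o\<^sub>L U)"
    by (simp add: delta_def delta_star_def compose_assoc)
  then have "(delta_star U ^^ Suc n) (delta U a) = (delta_star U ^^ n) ((adj U o\<^sub>L U) o\<^sub>L a o\<^sub>L (adj U o\<^sub>L U))"
    by (simp add: funpow_Suc_right del: funpow.simps)
  then show ?thesis
    using assms by (simp only: character_delta_star_mult AD initial_A initial_proj_Suc)
qed

lemma xi_alpha:
  assumes "x (initial_proj (Suc n)) = 1"
  shows "xi A U (Suc n) x \<in> Delta A U" "alpha A U (xi A U (Suc n) x) = xi A U n x"
proof -
  have n: "x (initial_proj n) = 1"
    using character_initial_proj_antimono[of n "Suc n"] assms by simp
  have "xi A U (Suc n) x (U o\<^sub>L adj U) = 1"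
    using character_delta_star_delta[OF id_A, of n] assms n final_A by (simp add: xi_apply final_eq)
  then show "xi A U (Suc n) x \<in> Delta A U"
    using xi_character[OF assms] by (simp add: Delta_def)
  have "alpha A U (xi A U (Suc n) x) a = xi A U n x a" if "a \<in> A" for a
    using character_delta_star_delta[OF that, of n] assms delta_A[OF that] that by (simp add: alpha_def xi_apply)
  then show "alpha A U (xi A U (Suc n) x) = xi A U n x"
    by (intro extensionalityI[of _ A]) (auto simp: alpha_def xi_def)
qed

lemma xi_Delta_dom: "x (initial_proj n) = 1 \<Longrightarrow> k \<le> n \<Longrightarrow> xi A U n x \<in> Delta_dom A U k"
proof (induction k arbitrary: n)
  case 0
  then show ?case by (simp add: xi_character)
next
  case (Suc k)
  then obtain m where m: "n = Suc m" by (cases n) auto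
  with Suc.prems have "x (initial_proj m) = 1" "k \<le> m"
    using character_initial_proj_antimono[of m n] by auto
  then show ?case
    using Suc.IH[of m] xi_alpha[of m] Suc.prems m by simp
qed

lemma xi_alpha_funpow: "x (initial_proj (n + k)) = 1 \<Longrightarrow> (alpha A U ^^ k) (xi A U (n + k) x) = xi A U n x"
proof (induction k)
  case (Suc k)
  have "x (initial_proj (n + k)) = 1"
    using character_initial_proj_antimono[of "n + k" "n + Suc k"] Suc.prems by simp
  then show ?case
    using Suc.IH xi_alpha(2)[of "n + k"] Suc.prems by (simp add: funpow_Suc_right del: funpow.simps)
qed simp

end

lemma Delta_im_1D: "\<tau> \<in> Delta_im A U 1 \<Longrightarrow> \<tau> (adj U o\<^sub>L U) = 1"
proof -
  assume "\<tau> \<in> Delta_im A U 1"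
  then obtain \<sigma> where \<sigma>: "\<sigma> \<in> Delta A U" "\<tau> = alpha A U \<sigma>"
    by (auto simp: Delta_im_def)
  have "delta U (adj U o\<^sub>L U) = U o\<^sub>L adj U"
    by (simp add: delta_def compose_assoc partial_isometry')
  then show "\<tau> (adj U o\<^sub>L U) = 1"
    using \<sigma> initial_A by (simp add: alpha_def Delta_def)
qed

text \<open>Together with the previous lemma this identifies \<open>\<alpha>(\<Delta>)\<close> with the set where \<open>U\<^sup>* U\<close> takes the value 1.
  The preimage is found on the coefficient algebra, where \<open>\<delta>\<^sub>*\<close> inverts \<open>\<delta>\<close>: extend \<open>\<tau>\<close> to it,
  compose with \<open>\<delta>\<^sub>*\<close> and restrict to \<open>A\<close> again.\<close>

lemma Delta_im_1I:
  assumes \<tau>: "\<tau> \<in> max_ideal_space A" and "\<tau> (adj U o\<^sub>L U) = 1"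
  shows "\<tau> \<in> Delta_im A U 1"
proof -
  obtain y where y: "y \<in> max_ideal_space B" "\<forall>a\<in>A. y a = \<tau> a"
    using character_extension[OF cA comm_B A_B id_A \<tau>] by blast
  have 1: "y (initial_proj (Suc 0)) = 1"
    using assms(2) y(2) initial_A by (simp add: initial_eq)
  have "xi A U 0 y = \<tau>"
    using y(2) characterD(4)[OF \<tau>] by (intro extensionalityI[of _ A]) (auto simp: xi_def)
  then have "\<tau> = alpha A U (xi A U (Suc 0) y)"
    using xi_alpha(2)[OF y(1) 1] by simp
  then show ?thesis
    using xi_Delta_dom[OF y(1) 1, of 1] by (auto simp: Delta_im_def)
qed

text \<open>The sequence breaks off after the index \<open>N\<close> exactly because \<open>U\<^sup>* U\<close> vanishes at its \<open>N\<close>-th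
  coordinate, which keeps that coordinate out of \<open>\<alpha>(\<Delta>)\<close>.\<close>

lemma xi_M_hat:
  assumes x: "x \<in> max_ideal_space B"
    and N: "x (initial_proj N) = 1" "x (initial_proj (Suc N)) = 0"
  shows "(\<lambda>n. xi A U n x) \<in> M_hat A U N"
  unfolding M_hat_def
proof (intro CollectI conjI ballI allI impI)
  show "xi A U N x \<in> Delta_dom A U N"
    using xi_Delta_dom[OF x N(1)] by simp
  have "xi A U N x (adj U o\<^sub>L U) = 0"
    using N(2) initial_A by (simp add: xi_apply flip: initial_proj_Suc del: funpow.simps)
  then show "xi A U N x \<notin> Delta_im A U 1"
    using Delta_im_1D by force
next
  fix n assume "n \<in> {1..N}"
  then obtain m where m: "n = Suc m" "Suc m \<le> N" by (cases n) auto
  then have "x (initial_proj (Suc m)) = 1"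
    using character_initial_proj_antimono[OF x m(2) N(1)] by simp
  then show "xi A U n x \<in> Delta A U" "alpha A U (xi A U n x) = xi A U (n - 1) x"
    using xi_alpha[OF x, of m] m by auto
next
  fix n assume "n > N"
  then have "x (initial_proj n) \<noteq> 1"
    using character_initial_proj_antimono[OF x, of "Suc N" n] N(2) by (auto simp del: funpow.simps)
  then show "xi A U n x = zero_functional A"
    using xi_zero[OF x] character_initial_proj[OF x] by blast
qed

text \<open>Each coordinate is the image under \<open>\<alpha>\<^sup>k\<close> of the coordinate \<open>k\<close> places further on.\<close>

lemma xi_M_inf:
  assumes x: "x \<in> max_ideal_space B" and N: "\<And>n. x (initial_proj n) = 1"
  shows "(\<lambda>n. xi A U n x) \<in> M_inf A U"
  unfolding M_inf_def
proof (intro CollectI conjI ballI allI impI IntI)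
  fix n
  show "xi A U n x \<in> Delta_dom A U n"
    using xi_Delta_dom[OF x N] by simp
  have "xi A U n x \<in> Delta_im A U k" for k
    unfolding Delta_im_def
    using xi_alpha_funpow[OF x N[of "n + k"]] xi_Delta_dom[OF x N[of "n + k"], of k] by (metis image_eqI le_add2)
  then show "xi A U n x \<in> Delta_im_inf A U"
    by (auto simp: Delta_im_inf_def)
  assume "n \<ge> 1"
  then show "xi A U n x \<in> Delta A U" "alpha A U (xi A U n x) = xi A U (n - 1) x"
    using xi_alpha[OF x N, of "n - 1"] by auto
qed

text \<open>The projections decrease, so that the character is 1 on all of them or up to a last index.\<close>

lemma xi_M_tail:
  assumes x: "x \<in> max_ideal_space B" and n: "x (initial_proj n) = 1"
  shows "(\<lambda>n. xi A U n x) \<in> (\<Union>N\<in>{n..}. M_hat A U N) \<union> M_inf A U"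
proof (cases "\<forall>k. x (initial_proj k) = 1")
  case True
  then show ?thesis using xi_M_inf[OF x] by simp
next
  case False
  \<comment> \<open>The first index at which the value is 0 rather than 1.\<close>
  define K where "K = (LEAST k. x (initial_proj k) \<noteq> 1)"
  have K: "x (initial_proj K) \<noteq> 1" "\<And>k. k < K \<Longrightarrow> x (initial_proj k) = 1"
    using False LeastI_ex[of "\<lambda>k. x (initial_proj k) \<noteq> 1"] not_less_Least[of _ "\<lambda>k. x (initial_proj k) \<noteq> 1"]
    unfolding K_def by blast+
  have "n < K"
    using character_initial_proj_antimono[OF x _ n, of K] K(1) by force
  then obtain N where N: "K = Suc N" "n \<le> N" by (cases K) auto
  then have "(\<lambda>n. xi A U n x) \<in> M_hat A U N"
    using xi_M_hat[OF x K(2)] K(1) character_initial_proj[OF x, of K] by auto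
  with N(2) show ?thesis by auto
qed

lemma xi_M_union:
  assumes x: "x \<in> max_ideal_space B"
  shows "(\<lambda>n. xi A U n x) \<in> M_union A U"
  using xi_M_tail[OF x, of 0] character_id[OF x id_B] unfolding M_union_def by fastforce

lemma xi_nonzero: "x \<in> max_ideal_space B \<Longrightarrow> xi A U n x \<noteq> zero_functional A \<Longrightarrow> x (initial_proj n) = 1"
  using xi_zero character_initial_proj by blast

lemma xi_M_hat_iff:
  assumes x: "x \<in> max_ideal_space B"
  shows "(\<lambda>n. xi A U n x) \<in> M_hat A U N \<longleftrightarrow> x (initial_proj N) = 1 \<and> x (initial_proj (Suc N)) = 0"
proof
  assume "(\<lambda>n. xi A U n x) \<in> M_hat A U N" (is "?s \<in> _")
  then have "x (initial_proj N) = 1" "xi A U (Suc N) x = zero_functional A"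
    using xi_nonzero[OF x] M_hat_nonzero[of ?s A U N N] by (auto simp: M_hat_def)
  moreover from this(2) have "x (initial_proj (Suc N)) = 0"
    using id_A xi_apply[OF id_A, of "Suc N" x] by (simp add: zero_functional_def del: funpow.simps)
  ultimately show "x (initial_proj N) = 1 \<and> x (initial_proj (Suc N)) = 0" by simp
qed (use xi_M_hat[OF x] in blast)

text \<open>At the indices before \<open>N\<close> the coordinates are values of \<open>\<alpha>\<close>, and \<open>\<alpha>\<close> maps \<open>\<Delta>\<close> to unital functionals.\<close>

lemma M_tail_character:
  assumes "s \<in> (\<Union>N\<in>{n..}. M_hat A U N) \<union> M_inf A U"
  shows "s n \<in> max_ideal_space A"
proof -
  have alpha: "alpha A U \<tau> \<in> max_ideal_space A" if "\<tau> \<in> Delta A U" for \<tau>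
  proof -
    have \<tau>: "\<tau> \<in> max_ideal_space A" "\<tau> (delta U id_blinfun) = 1"
      using that by (auto simp: Delta_def final_eq)
    show ?thesis
      unfolding max_ideal_space_iff[OF id_A] using \<tau>(2) A_B
      by (auto simp: alpha_def AD id_A delta_add delta_cscale delta_B_mult subset_iff
          characterD[OF \<tau>(1)] delta_A)
  qed
  consider "s \<in> M_inf A U" | N where "n \<le> N" "s \<in> M_hat A U N"
    using assms by auto
  then show ?thesis
  proof cases
    case 1
    then show ?thesis using Delta_dom_subset by (fastforce simp: M_inf_def)
  next
    case 2
    show ?thesis
    proof (cases "n = N")
      case True
      then show ?thesis using 2 Delta_dom_subset by (fastforce simp: M_hat_def)
    next
      case False
      then have "Suc n \<in> {1..N}" using 2 by auto
      then have "s (Suc n) \<in> Delta A U" "alpha A U (s (Suc n)) = s n"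
        using 2(2) by (auto simp: M_hat_def)
      then show ?thesis using alpha by metis
    qed
  qed
qed

text \<open>The sets of sequences underlying the neighborhoods of points of \<open>M\<^sub>\<infinity>\<close> are thus described by
  the value on a single element of the coefficient algebra, which makes their preimages open.\<close>

lemma xi_M_tail_iff:
  assumes x: "x \<in> max_ideal_space B"
  shows "(\<lambda>n. xi A U n x) \<in> (\<Union>N\<in>{n..}. M_hat A U N) \<union> M_inf A U \<longleftrightarrow> x (initial_proj n) = 1"
  using xi_M_tail[OF x] M_tail_character[of "\<lambda>n. xi A U n x" n] max_ideal_space_nonzero xi_nonzero[OF x]
  by blast

text \<open>The coordinates are the values on the generators. Closure of the agreement set under adjoints
  uses that characters preserve the involution.\<close>

lemma xi_injective:
  assumes x: "x \<in> max_ideal_space B" and y: "y \<in> max_ideal_space B"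
    and eq: "\<And>n. xi A U n x = xi A U n y"
  shows "x = y"
proof (rule extensionalityI[of _ B])
  show "x \<in> extensional B" "y \<in> extensional B" using characterD(4) x y by auto
  fix b assume b: "b \<in> B"
  show "x b = y b"
  proof (rule coeff_algebra_induct[of "\<lambda>b. x b = y b"])
    have "closed {b \<in> B. x b = y b}"
      unfolding closed_sequential_limits
    proof (intro allI impI, elim conjE)
      fix X b assume X: "\<forall>n. X n \<in> {b \<in> B. x b = y b}" "X \<longlonglongrightarrow> b"
      then have b: "b \<in> B" using closed_sequentially[OF BD(7)] by blast
      have XB: "X n \<in> B" for n using X(1) by simp
      have "(\<lambda>n. x (X n)) \<longlonglongrightarrow> x b" "(\<lambda>n. y (X n)) \<longlonglongrightarrow> y b"
        by (rule character_tendsto[OF cB x X(2) XB b], rule character_tendsto[OF cB y X(2) XB b])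
      moreover have "(\<lambda>n. x (X n)) = (\<lambda>n. y (X n))" using X(1) by auto
      ultimately show "b \<in> {b \<in> B. x b = y b}" using b LIMSEQ_unique by auto
    qed
    moreover have "x 0 = y 0"
      using characterD(2)[OF x BD(2), of 0] characterD(2)[OF y BD(2), of 0] by simp
    ultimately show "cstar_algebra {b \<in> B. x b = y b}"
      using BD(1) unfolding cstar_algebra_def
      by (auto simp: BD characterD[OF x] characterD[OF y] character_adj[OF cB id_B x]
          character_adj[OF cB id_B y])
    show "x ((delta_star U ^^ n) a) = y ((delta_star U ^^ n) a)" if "a \<in> A" for n a
      using eq[of n] that by (metis xi_apply)
  qed (rule b)
qed

section \<open>From sequences to characters\<close>

text \<open>The projections \<open>U\<^sup>n U\<^sup>*\<^sup>n\<close> decrease with \<open>n\<close>.\<close>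

lemma delta_funpow_id_antimono:
  assumes y: "y \<in> max_ideal_space B" and "m \<le> n" "y ((delta U ^^ n) id_blinfun) = 1"
  shows "y ((delta U ^^ m) id_blinfun) = 1"
  using assms(2,3)
proof (induction n rule: dec_induct)
  case (step n)
  have "(delta U ^^ Suc n) id_blinfun = (delta U ^^ n) (delta U id_blinfun o\<^sub>L id_blinfun)"
    by (simp add: funpow_swap1)
  also have "\<dots> = (delta U ^^ Suc n) id_blinfun o\<^sub>L (delta U ^^ n) id_blinfun"
    by (subst delta_funpow_mult) (auto simp: delta_B id_B funpow_swap1)
  finally have "y ((delta U ^^ Suc n) id_blinfun) = y ((delta U ^^ Suc n) id_blinfun) * y ((delta U ^^ n) id_blinfun)"
    by (metis characterD(3)[OF y] delta_funpow_B id_B)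
  with step show ?case by simp
qed

lemma pullback_character:
  assumes y: "y \<in> max_ideal_space B" and "y ((delta U ^^ n) id_blinfun) = 1"
  shows "(\<lambda>b\<in>B. y ((delta U ^^ n) b)) \<in> max_ideal_space B"
  unfolding max_ideal_space_iff[OF id_B]
  using assms(2)
  by (auto simp: BD id_B delta_funpow_add delta_funpow_cscale delta_funpow_mult delta_funpow_B
      characterD[OF y])

text \<open>Each factor of \<open>\<delta>\<close> cancels one \<open>\<delta>\<^sub>*\<close> up to compression by \<open>U U\<^sup>*\<close>, and the projections that
  accumulate have value 1 under \<open>y\<close>.\<close>

lemma pullback_generator:
  assumes y: "y \<in> max_ideal_space B" and a: "a \<in> A"
  shows "y ((delta U ^^ (m + n)) id_blinfun) = 1 \<Longrightarrow>
    y ((delta U ^^ (m + n)) ((delta_star U ^^ (n + k)) a)) = y ((delta U ^^ m) ((delta_star U ^^ k) a))"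
proof (induction n)
  case (Suc n)
  let ?f = "delta U id_blinfun" and ?X = "(delta_star U ^^ (n + k)) a"
  have B: "?f \<in> B" "?X \<in> B" using id_B delta_B generator_B[OF a] by auto
  have f: "y ((delta U ^^ (m + n)) ?f) = 1"
    using Suc.prems by (simp add: funpow_swap1)
  have "(delta U ^^ (m + Suc n)) ((delta_star U ^^ (Suc n + k)) a)
      = (delta U ^^ (m + n)) (delta U (delta_star U ?X))"
    by (simp add: funpow_swap1[of "delta U"])
  also have "\<dots> = (delta U ^^ (m + n)) ?f o\<^sub>L (delta U ^^ (m + n)) ?X o\<^sub>L (delta U ^^ (m + n)) ?f"
    using B by (simp add: delta_delta_star delta_funpow_mult BD(5) flip: final_eq)
  finally have "y ((delta U ^^ (m + Suc n)) ((delta_star U ^^ (Suc n + k)) a)) = y ((delta U ^^ (m + n)) ?X)"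
    using B f by (simp add: characterD(3)[OF y] delta_funpow_B BD(5))
  moreover have "y ((delta U ^^ (m + n)) id_blinfun) = 1"
    using delta_funpow_id_antimono[OF y _ Suc.prems, of "m + n"] by simp
  ultimately show ?case using Suc.IH by simp
qed simp

text \<open>An extension \<open>y\<close> of the \<open>n\<close>-th coordinate encodes all earlier ones, since these are
  \<open>s\<^sub>k = s\<^sub>n \<circ> \<delta>\<^sup>n\<^sup>-\<^sup>k\<close>. Composing \<open>y\<close> with \<open>\<delta>\<^sup>n\<close> moves them to their places.\<close>

lemma lift_M_tail:
  assumes s: "s \<in> (\<Union>N\<in>{n..}. M_hat A U N) \<union> M_inf A U"
    and y: "y \<in> max_ideal_space B" "\<forall>a\<in>A. y a = s n a"
  defines "z \<equiv> (\<lambda>b\<in>B. y ((delta U ^^ n) b))"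
  shows "z \<in> max_ideal_space B" "\<And>k a. k \<le> n \<Longrightarrow> a \<in> A \<Longrightarrow> z ((delta_star U ^^ k) a) = s k a"
    "\<And>k a. a \<in> A \<Longrightarrow> z ((delta_star U ^^ (n + k)) a) = y ((delta_star U ^^ k) a)"
proof -
  have dA: "delta U ` A \<subseteq> A" using delta_A by auto
  have s0: "s 0 \<in> max_ideal_space A"
    using s by (intro M_tail_character) auto
  have 1: "y ((delta U ^^ n) id_blinfun) = 1"
    using M_shift[OF dA s _ id_A, of 0] character_id[OF s0 id_A] y(2) delta_funpow_A[OF id_A] by simp
  show "z \<in> max_ideal_space B"
    unfolding z_def using y(1) 1 by (rule pullback_character)
  show "z ((delta_star U ^^ (n + k)) a) = y ((delta_star U ^^ k) a)" if "a \<in> A" for k a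
    using pullback_generator[OF y(1) that, of 0 n k] 1 generator_B[OF that] by (simp add: z_def)
  show "z ((delta_star U ^^ k) a) = s k a" if "k \<le> n" "a \<in> A" for k a
    using pullback_generator[OF y(1) that(2), of "n - k" k 0] 1 that generator_B[OF that(2), of k]
      M_shift[OF dA s that] y(2) delta_funpow_A[OF that(2)] by (simp add: z_def)
qed

lemma M_union_extensional: "s \<in> M_union A U \<Longrightarrow> s n \<in> extensional A"
proof -
  assume "s \<in> M_union A U"
  then consider "s \<in> (\<Union>N\<in>{n..}. M_hat A U N) \<union> M_inf A U" | N where "N < n" "s \<in> M_hat A U N"
    unfolding M_union_def by (metis UN_iff Un_iff atLeast_iff not_less)
  then show ?thesis
  proof cases
    case 1
    then show ?thesis using M_tail_character characterD(4) by blast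
  next
    case 2
    then show ?thesis by (simp add: M_hat_def zero_functional_def)
  qed
qed

text \<open>Lifting the last nonzero coordinate \<open>s\<^sub>N\<close> yields the coordinates up to \<open>N\<close>. The later ones vanish because
  \<open>s\<^sub>N \<notin> \<alpha>(\<Delta>)\<close> forces the value 0 on \<open>U\<^sup>* U\<close>.\<close>

lemma M_hat_lift:
  assumes s: "s \<in> M_hat A U N"
  shows "\<exists>x\<in>max_ideal_space B. \<forall>n. \<forall>a\<in>A. x ((delta_star U ^^ n) a) = s n a"
proof -
  have tail: "s \<in> (\<Union>N'\<in>{N..}. M_hat A U N') \<union> M_inf A U" using s by auto
  have sN: "s N \<in> max_ideal_space A" by (rule M_tail_character[OF tail])
  obtain y where y: "y \<in> max_ideal_space B" "\<forall>a\<in>A. y a = s N a"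
    using character_extension[OF cA comm_B A_B id_A sN] by blast
  note z = lift_M_tail[OF tail y]
  \<comment> \<open>The value of \<open>s\<^sub>N\<close> on the projection \<open>U\<^sup>* U\<close> is 0 or 1, and 1 is excluded by \<open>s\<^sub>N \<notin> \<alpha>(\<Delta>)\<close>.\<close>
  have "y (initial_proj 1) \<noteq> 1"
    using s Delta_im_1I[OF sN] y(2) initial_A by (auto simp: M_hat_def initial_eq)
  then have 0: "y (adj U o\<^sub>L U) = 0"
    using character_initial_proj[OF y(1), of 1] by (simp add: initial_eq)
  have "y ((delta_star U ^^ Suc k) a) = 0" if a: "a \<in> A" for k a
  proof -
    have "(delta_star U ^^ Suc k) a = (adj U o\<^sub>L U) o\<^sub>L (delta_star U ^^ Suc k) a"
      by (simp add: delta_star_def[of U "(delta_star U ^^ k) a"] compose_assoc partial_isometry')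
    then show ?thesis
      using 0 characterD(3)[OF y(1)] initial_A A_B generator_B[OF a, of "Suc k"]
      by (metis mult_zero_left subsetD)
  qed
  then have "(\<lambda>b\<in>B. y ((delta U ^^ N) b)) ((delta_star U ^^ n) a) = s n a" if "a \<in> A" for n a
    using z(2)[of n a] z(3)[of a "n - N"] that s
    by (cases "n \<le> N") (auto simp: M_hat_def zero_functional_def Suc_diff_Suc[symmetric] not_le simp del: funpow.simps)
  then show ?thesis using z(1) by blast
qed

text \<open>Characters are uniformly equicontinuous, so convergence on the generators propagates to norm
  limits.\<close>

lemma convergent_characters:
  assumes z: "\<And>n. z n \<in> max_ideal_space B"
    and gen: "\<And>k a. a \<in> A \<Longrightarrow> convergent (\<lambda>n. z n ((delta_star U ^^ k) a))"
    and b: "b \<in> B"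
  shows "convergent (\<lambda>n. z n b)"
proof (rule coeff_algebra_induct[of "\<lambda>b. convergent (\<lambda>n. z n b)"])
  note zD = characterD[OF z]
  have "closed {b \<in> B. convergent (\<lambda>n. z n b)}"
    unfolding closed_sequential_limits
  proof (intro allI impI, elim conjE)
    fix X b assume X: "\<forall>j. X j \<in> {b \<in> B. convergent (\<lambda>n. z n b)}" "X \<longlonglongrightarrow> b"
    then have b: "b \<in> B" using closed_sequentially[OF BD(7)] by blast
    have "Cauchy (\<lambda>n. z n b)"
    proof (rule metric_CauchyI)
      fix e :: real assume "e > 0"
      then obtain j where j: "norm (X j - b) < e / 3"
        using X(2) unfolding lim_sequentially dist_norm by (metis zero_less_divide_iff zero_less_numeral order_refl)
      have near: "dist (z n (X j)) (z n b) < e / 3" for n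
        using character_contractive[OF cB z BD(10)[of "X j" b], of n] character_diff[OF cB z, of "X j" b n] X(1) b j
        by (simp add: dist_norm)
      have "Cauchy (\<lambda>n. z n (X j))"
        using X(1) convergent_Cauchy by blast
      then obtain M where M: "\<And>n m. n \<ge> M \<Longrightarrow> m \<ge> M \<Longrightarrow> dist (z n (X j)) (z m (X j)) < e / 3"
        using metric_CauchyD[of _ "e / 3"] \<open>e > 0\<close> by fastforce
      have "dist (z n b) (z m b) < e" if "n \<ge> M" "m \<ge> M" for n m
      proof -
        have "dist (z n b) (z m b) \<le> dist (z n (X j)) (z n b) + dist (z n (X j)) (z m (X j)) + dist (z m (X j)) (z m b)"
          by (smt (verit) dist_commute dist_triangle)
        with near[of n] near[of m] M[OF that] show ?thesis by linarith
      qed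
      then show "\<exists>M. \<forall>m\<ge>M. \<forall>n\<ge>M. dist (z m b) (z n b) < e" by blast
    qed
    then show "b \<in> {b \<in> B. convergent (\<lambda>n. z n b)}"
      using b Cauchy_convergent by blast
  qed
  moreover have "convergent (\<lambda>n. cnj (f n))" if "convergent f" for f :: "nat \<Rightarrow> complex"
    using that tendsto_cnj unfolding convergent_def by blast
  moreover have "z n 0 = 0" for n
    using zD(2)[OF BD(2), of n 0] by simp
  ultimately show "cstar_algebra {b \<in> B. convergent (\<lambda>n. z n b)}"
    using BD(1) unfolding cstar_algebra_def
    by (auto simp: BD zD character_adj[OF cB id_B z] convergent_const
        intro!: convergent_add convergent_mult)
qed (use gen b in auto)

lemma limit_character:
  assumes z: "\<And>n. z n \<in> max_ideal_space B" and conv: "\<And>b. b \<in> B \<Longrightarrow> convergent (\<lambda>n. z n b)"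
  shows "(\<lambda>b\<in>B. lim (\<lambda>n. z n b)) \<in> max_ideal_space B"
proof -
  note zD = characterD[OF z]
  define x where "x = (\<lambda>b\<in>B. lim (\<lambda>n. z n b))"
  have lim: "(\<lambda>n. z n b) \<longlonglongrightarrow> x b" if "b \<in> B" for b
    using conv[OF that] that by (simp add: x_def convergent_LIMSEQ_iff)
  have "x \<in> max_ideal_space B"
    unfolding max_ideal_space_iff[OF id_B]
  proof (intro conjI ballI allI)
    show "x \<in> extensional B" by (simp add: x_def)
    show "x id_blinfun = 1"
      using lim[OF id_B] by (simp add: character_id[OF z id_B] LIMSEQ_const_iff)
    fix a assume a: "a \<in> B"
    show "x (cscale c a) = c * x a" for c
    proof (rule LIMSEQ_unique)
      show "(\<lambda>n. z n (cscale c a)) \<longlonglongrightarrow> x (cscale c a)" using a by (intro lim BD)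
      show "(\<lambda>n. z n (cscale c a)) \<longlonglongrightarrow> c * x a"
        using tendsto_mult[OF tendsto_const[of c] lim[OF a]] by (simp add: zD a)
    qed
    fix b assume b: "b \<in> B"
    show "x (a + b) = x a + x b"
    proof (rule LIMSEQ_unique)
      show "(\<lambda>n. z n (a + b)) \<longlonglongrightarrow> x (a + b)" using a b by (intro lim BD)
      show "(\<lambda>n. z n (a + b)) \<longlonglongrightarrow> x a + x b"
        using tendsto_add[OF lim[OF a] lim[OF b]] by (simp add: zD a b)
    qed
    show "x (a o\<^sub>L b) = x a * x b"
    proof (rule LIMSEQ_unique)
      show "(\<lambda>n. z n (a o\<^sub>L b)) \<longlonglongrightarrow> x (a o\<^sub>L b)" using a b by (intro lim BD)
      show "(\<lambda>n. z n (a o\<^sub>L b)) \<longlonglongrightarrow> x a * x b"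
        using tendsto_mult[OF lim[OF a] lim[OF b]] by (simp add: zD a b)
    qed
  qed
  then show ?thesis by (simp add: x_def)
qed

text \<open>For every \<open>n\<close> there is a character with the right coordinates up to \<open>n\<close>. On each generator these
  characters are eventually constant, hence they converge pointwise on the coefficient
  algebra, and the limit has all the right coordinates.\<close>

lemma M_inf_lift:
  assumes s: "s \<in> M_inf A U"
  shows "\<exists>x\<in>max_ideal_space B. \<forall>n. \<forall>a\<in>A. x ((delta_star U ^^ n) a) = s n a"
proof -
  have "\<exists>z\<in>max_ideal_space B. \<forall>k\<le>n. \<forall>a\<in>A. z ((delta_star U ^^ k) a) = s k a" for n
  proof -
    have tail: "s \<in> (\<Union>N\<in>{n..}. M_hat A U N) \<union> M_inf A U" using s by auto
    obtain y where y: "y \<in> max_ideal_space B" "\<forall>a\<in>A. y a = s n a"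
      using character_extension[OF cA comm_B A_B id_A M_tail_character[OF tail]] by blast
    show ?thesis using lift_M_tail[OF tail y] by blast
  qed
  then obtain z where z: "\<And>n. z n \<in> max_ideal_space B"
      "\<And>n k a. k \<le> n \<Longrightarrow> a \<in> A \<Longrightarrow> z n ((delta_star U ^^ k) a) = s k a"
    by metis
  have lim: "(\<lambda>n. z n ((delta_star U ^^ k) a)) \<longlonglongrightarrow> s k a" if "a \<in> A" for k a
    using z(2)[OF _ that] by (intro tendsto_eventually eventually_sequentiallyI[of k])
  have gen: "convergent (\<lambda>n. z n ((delta_star U ^^ k) a))" if "a \<in> A" for k a
    using lim[OF that] by (rule convergentI)
  have "convergent (\<lambda>n. z n b)" if "b \<in> B" for b
    by (rule convergent_characters[OF z(1) gen that])
  from limit_character[OF z(1) this] have "(\<lambda>b\<in>B. lim (\<lambda>n. z n b)) \<in> max_ideal_space B" .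
  moreover have "(\<lambda>b\<in>B. lim (\<lambda>n. z n b)) ((delta_star U ^^ k) a) = s k a" if "a \<in> A" for k a
    using generator_B[OF that] limI[OF lim[OF that]] by simp
  ultimately show ?thesis by blast
qed

lemma xi_surjective:
  assumes s: "s \<in> M_union A U"
  shows "\<exists>x\<in>max_ideal_space B. (\<lambda>n. xi A U n x) = s"
proof -
  obtain x where x: "x \<in> max_ideal_space B" "\<forall>n. \<forall>a\<in>A. x ((delta_star U ^^ n) a) = s n a"
    using s M_hat_lift M_inf_lift unfolding M_union_def by blast
  have "xi A U n x = s n" for n
    using x(2) M_union_extensional[OF s] by (intro extensionalityI[of _ A]) (auto simp: xi_def)
  with x(1) show ?thesis by blast
qed

section \<open>The homeomorphism\<close>

lemma topspace_max_ideal_topology: "topspace (max_ideal_topology B) = max_ideal_space B"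
  unfolding max_ideal_topology_def by (auto simp: PiE_def characterD(4))

lemma continuous_map_evaluation: "b \<in> B \<Longrightarrow> continuous_map (max_ideal_topology B) euclidean (\<lambda>x. x b)"
  unfolding max_ideal_topology_def
  by (intro continuous_map_from_subtopology continuous_map_product_projection)

lemma openin_evaluation:
  "b \<in> B \<Longrightarrow> open S \<Longrightarrow> openin (max_ideal_topology B) {x \<in> max_ideal_space B. x b \<in> S}"
  using openin_continuous_map_preimage[OF continuous_map_evaluation, of b S]
  by (simp add: topspace_max_ideal_topology)

lemma delta_image: "delta U ` A \<subseteq> A"
  using delta_A by auto

lemma openin_near:
  assumes "finite F" "F \<subseteq> A"
  shows "openin (max_ideal_topology B)
    {x \<in> max_ideal_space B. \<forall>a\<in>F. cmod (c a - x ((delta_star U ^^ n) a)) < \<epsilon>}"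
  using assms
proof (induction F)
  case empty
  show ?case
    using openin_topspace[of "max_ideal_topology B"] by (simp add: topspace_max_ideal_topology)
next
  case (insert a F)
  have "openin (max_ideal_topology B)
      ({x \<in> max_ideal_space B. x ((delta_star U ^^ n) a) \<in> ball (c a) \<epsilon>} \<inter>
       {x \<in> max_ideal_space B. \<forall>a\<in>F. cmod (c a - x ((delta_star U ^^ n) a)) < \<epsilon>})"
    using insert by (intro openin_Int openin_evaluation generator_B) auto
  then show ?case
    by (rule back_subst[of "openin _"]) (auto simp: dist_norm)
qed

text \<open>The value on a projection is 0 or 1, so it is locally constant.\<close>

lemma openin_initial_proj:
  "openin (max_ideal_topology B) {x \<in> max_ideal_space B. x (initial_proj n) = 1}"
  "openin (max_ideal_topology B) {x \<in> max_ideal_space B. x (initial_proj n) = 0}"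
proof -
  have "openin (max_ideal_topology B) {x \<in> max_ideal_space B. x (initial_proj n) \<in> - {0}}"
    "openin (max_ideal_topology B) {x \<in> max_ideal_space B. x (initial_proj n) \<in> - {1}}"
    by (intro openin_evaluation initial_proj_B open_Compl closed_singleton)+
  moreover have "{x \<in> max_ideal_space B. x (initial_proj n) \<in> - {0}} = {x \<in> max_ideal_space B. x (initial_proj n) = 1}"
    "{x \<in> max_ideal_space B. x (initial_proj n) \<in> - {1}} = {x \<in> max_ideal_space B. x (initial_proj n) = 0}"
    using character_initial_proj by force+
  ultimately show "openin (max_ideal_topology B) {x \<in> max_ideal_space B. x (initial_proj n) = 1}"
    "openin (max_ideal_topology B) {x \<in> max_ideal_space B. x (initial_proj n) = 0}" by auto
qed

lemma xi_preimage_basic_nbhd: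
  assumes "C \<in> basic_nbhds A U s"
  shows "openin (max_ideal_topology B) {x \<in> max_ideal_space B. (\<lambda>n. xi A U n x) \<in> C}"
  using assms
proof (cases rule: basic_nbhds_cases)
  case (hat N F \<epsilon>)
  have "openin (max_ideal_topology B)
      ({x \<in> max_ideal_space B. x (initial_proj N) = 1} \<inter> {x \<in> max_ideal_space B. x (initial_proj (Suc N)) = 0} \<inter>
       {x \<in> max_ideal_space B. \<forall>a\<in>F. cmod (s N a - x ((delta_star U ^^ N) a)) < \<epsilon>})"
    using hat by (intro openin_Int openin_initial_proj openin_near)
  then show ?thesis
    by (rule back_subst[of "openin _"])
       (use hat in \<open>auto simp: nbhd_hat_def xi_M_hat_iff xi_apply subset_iff simp del: funpow.simps\<close>)
next
  case (inf F n \<epsilon>)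
  have mem: "(\<lambda>n. xi A U n x) \<in> C \<longleftrightarrow>
      x (initial_proj n) = 1 \<and> (\<forall>a\<in>F. cmod (s n a - x ((delta_star U ^^ n) a)) < \<epsilon>)"
    if "x \<in> max_ideal_space B" for x
    unfolding inf(2) nbhd_inf_def mem_Collect_eq xi_M_tail_iff[OF that]
    using inf(4) by (auto simp: xi_apply subset_iff)
  have "openin (max_ideal_topology B)
      ({x \<in> max_ideal_space B. x (initial_proj n) = 1} \<inter>
       {x \<in> max_ideal_space B. \<forall>a\<in>F. cmod (s n a - x ((delta_star U ^^ n) a)) < \<epsilon>})"
    using inf by (intro openin_Int openin_initial_proj openin_near)
  then show ?thesis
    by (rule back_subst[of "openin _"]) (auto simp: mem)
qed

lemma continuous_map_xi: "continuous_map (max_ideal_topology B) (M_topology A U) (\<lambda>x n. xi A U n x)"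
  unfolding continuous_map_def topspace_max_ideal_topology topspace_M_topology[OF delta_image]
proof (intro conjI allI impI)
  show "(\<lambda>x n. xi A U n x) \<in> max_ideal_space B \<rightarrow> M_union A U"
    using xi_M_union by auto
  fix W assume W: "openin (M_topology A U) W"
  show "openin (max_ideal_topology B) {x \<in> max_ideal_space B. (\<lambda>n. xi A U n x) \<in> W}"
  proof (subst openin_subopen, intro ballI)
    fix x assume x: "x \<in> {x \<in> max_ideal_space B. (\<lambda>n. xi A U n x) \<in> W}"
    then obtain C where C: "C \<in> basic_nbhds A U (\<lambda>n. xi A U n x)" "C \<subseteq> W"
      using W openin_M_topology[OF delta_image] by blast
    show "\<exists>T. openin (max_ideal_topology B) T \<and> x \<in> T \<and> T \<subseteq> {x \<in> max_ideal_space B. (\<lambda>n. xi A U n x) \<in> W}"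
      using xi_preimage_basic_nbhd[OF C(1)] basic_nbhds_self[OF C(1)] x C(2)
      by (intro exI[of _ "{x \<in> max_ideal_space B. (\<lambda>n. xi A U n x) \<in> C}"]) auto
  qed
qed

text \<open>Near a point of \<open>M\<^sub>\<infinity>\<close> the topology controls every coordinate. On the piece with last index \<open>N\<close> it controls
  the \<open>N\<close>-th coordinate, which determines those with \<open>n \<le> N\<close> through \<open>\<delta>\<^sup>N\<^sup>-\<^sup>n\<close>, and the
  later ones are zero.\<close>

lemma continuous_map_coordinate:
  assumes a: "a \<in> A"
  shows "continuous_map (M_topology A U) euclidean (\<lambda>s. s n a)"
  unfolding continuous_map_def topspace_M_topology[OF delta_image]
proof (intro conjI allI impI)
  fix V :: "complex set" assume "openin euclidean V"
  then have V: "open V" by simp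
  show "openin (M_topology A U) {s \<in> M_union A U. s n a \<in> V}"
    unfolding openin_M_topology[OF delta_image]
  proof (intro conjI ballI)
    fix s assume "s \<in> {s \<in> M_union A U. s n a \<in> V}"
    then have s: "s \<in> M_union A U" "s n a \<in> V" by auto
    then obtain e where e: "e > 0" "ball (s n a) e \<subseteq> V"
      using V open_contains_ball by blast
    from s(1) consider "s \<in> M_inf A U" | N where "s \<in> M_hat A U N" "n \<le> N" | N where "s \<in> M_hat A U N" "N < n"
      unfolding M_union_def by (metis UN_iff Un_iff atLeast_iff not_less)
    then obtain C where C: "C \<in> basic_nbhds A U s" "\<forall>t\<in>C. t n a \<in> ball (s n a) e"
    proof cases
      case 1
      show ?thesis
        using that[OF basic_nbhds_inf[OF 1, of "{a}" e n]] a e(1) by (auto simp: nbhd_inf_def dist_norm)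
    next
      case 2
      let ?F = "{(delta U ^^ (N - n)) a}"
      have shift: "t n a = t N ((delta U ^^ (N - n)) a)" if "t \<in> M_hat A U N" for t
        using M_shift[OF delta_image _ 2(2) a, of t] that by auto
      have "t n a \<in> ball (s n a) e" if "t \<in> nbhd_hat A U N s ?F e" for t
        using that shift[of t] shift[OF 2(1)] by (simp add: nbhd_hat_def dist_norm)
      then show ?thesis
        using that[OF basic_nbhds_hat[OF 2(1), of ?F e]] delta_funpow_A[OF a] e(1) by simp
    next
      case 3
      then show ?thesis
        using that[OF basic_nbhds_hat[OF 3(1), of "{}" e]] e(1)
        by (auto simp: nbhd_hat_def M_hat_def)
    qed
    then show "\<exists>C\<in>basic_nbhds A U s. C \<subseteq> {s \<in> M_union A U. s n a \<in> V}"
      using e(2) basic_nbhds_subset[OF C(1)] by blast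
  qed auto
qed auto

text \<open>The elements at which the inverse can be evaluated continuously form a \<open>C\<^sup>*\<close>-algebra, by
  contractivity of characters and uniform limits. On the generators the evaluations are the coordinates.\<close>

lemma continuous_map_inverse:
  assumes g: "\<And>s. s \<in> M_union A U \<Longrightarrow> g s \<in> max_ideal_space B"
    and xi_g: "\<And>s n. s \<in> M_union A U \<Longrightarrow> xi A U n (g s) = s n"
  shows "continuous_map (M_topology A U) (max_ideal_topology B) g"
proof -
  let ?Y = "M_topology A U"
  note top = topspace_M_topology[OF delta_image]
  have cont: "continuous_map ?Y euclidean (\<lambda>s. g s b)" if "b \<in> B" for b
  proof (rule coeff_algebra_induct[of "\<lambda>b. continuous_map ?Y euclidean (\<lambda>s. g s b)"])
    show "continuous_map ?Y euclidean (\<lambda>s. g s ((delta_star U ^^ n) a))" if a: "a \<in> A" for n a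
    proof (rule continuous_map_eq[OF continuous_map_coordinate[OF a, of n]])
      show "s n a = g s ((delta_star U ^^ n) a)" if "s \<in> topspace ?Y" for s
        using that a by (simp add: top xi_apply flip: xi_g)
    qed
    have closed: "closed {b \<in> B. continuous_map ?Y euclidean (\<lambda>s. g s b)}"
      unfolding closed_sequential_limits
    proof (intro allI impI, elim conjE)
      fix X b assume X: "\<forall>j. X j \<in> {b \<in> B. continuous_map ?Y euclidean (\<lambda>s. g s b)}" "X \<longlonglongrightarrow> b"
      then have b: "b \<in> B" using closed_sequentially[OF BD(7)] by blast
      have "continuous_map ?Y Met_TC.mtopology (\<lambda>s. g s b)"
      proof (rule Met_TC.continuous_map_uniform_limit)
        show "\<forall>\<^sub>F j in sequentially. continuous_map ?Y Met_TC.mtopology (\<lambda>s. g s (X j))"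
          using X(1) by simp
        fix \<epsilon> :: real assume "\<epsilon> > 0"
        then have "\<forall>\<^sub>F j in sequentially. norm (X j - b) < \<epsilon>"
          using tendstoD[OF X(2)] by (simp add: dist_norm)
        then show "\<forall>\<^sub>F j in sequentially. \<forall>s\<in>topspace ?Y. g s b \<in> UNIV \<and> dist (g s (X j)) (g s b) < \<epsilon>"
        proof (rule eventually_mono, intro ballI conjI)
          fix j s assume j: "norm (X j - b) < \<epsilon>" and s: "s \<in> topspace ?Y"
          have "X j \<in> B" using X(1) by auto
          then show "dist (g s (X j)) (g s b) < \<epsilon>"
            using character_contractive[OF cB g BD(10)[of "X j" b], of s] b s j
              character_diff[OF cB g, of s "X j" b] by (simp add: dist_norm top)
        qed auto
      qed auto
      then show "b \<in> {b \<in> B. continuous_map ?Y euclidean (\<lambda>s. g s b)}"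
        using b by simp
    qed
    have eq: "continuous_map ?Y euclidean (\<lambda>s. g s b)"
      if "continuous_map ?Y euclidean f" "\<And>s. s \<in> M_union A U \<Longrightarrow> f s = g s b" for f b
      using that by (intro continuous_map_eq[OF that(1)]) (auto simp: top)
    have mult: "continuous_map ?Y euclidean (\<lambda>s. g s b * g s c)" and conj: "continuous_map ?Y euclidean (\<lambda>s. cnj (g s b))"
      if "continuous_map ?Y euclidean (\<lambda>s. g s b)" "continuous_map ?Y euclidean (\<lambda>s. g s c)" for b c
      using that by (auto simp: continuous_map_atin intro: tendsto_mult tendsto_cnj)
    have const: "continuous_map ?Y euclidean (\<lambda>s. c * g s b)"
      if "continuous_map ?Y euclidean (\<lambda>s. g s b)" for b c
      using that by (auto simp: continuous_map_atin intro: tendsto_mult)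
    show "cstar_algebra {b \<in> B. continuous_map ?Y euclidean (\<lambda>s. g s b)}"
      unfolding cstar_algebra_def
    proof (intro conjI ballI allI closed)
      show "{b \<in> B. continuous_map ?Y euclidean (\<lambda>s. g s b)} \<subseteq> bounded_ops" using BD(1) by auto
      show "0 \<in> {b \<in> B. continuous_map ?Y euclidean (\<lambda>s. g s b)}"
        using characterD(2)[OF g BD(2), of _ 0] BD(2) by (auto intro: eq[of "\<lambda>_. 0"])
      fix a assume a: "a \<in> {b \<in> B. continuous_map ?Y euclidean (\<lambda>s. g s b)}"
      show "adj a \<in> {b \<in> B. continuous_map ?Y euclidean (\<lambda>s. g s b)}"
        using a conj[of a a] by (auto simp: BD character_adj[OF cB id_B g] intro: eq)
      show "cscale c a \<in> {b \<in> B. continuous_map ?Y euclidean (\<lambda>s. g s b)}" for c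
        using a const[of a c] by (auto simp: BD characterD[OF g] intro: eq)
      fix b assume b: "b \<in> {b \<in> B. continuous_map ?Y euclidean (\<lambda>s. g s b)}"
      show "a + b \<in> {b \<in> B. continuous_map ?Y euclidean (\<lambda>s. g s b)}"
        using a b continuous_map_add[of ?Y "\<lambda>s. g s a" "\<lambda>s. g s b"]
        by (auto simp: BD characterD[OF g] intro: eq)
      show "a o\<^sub>L b \<in> {b \<in> B. continuous_map ?Y euclidean (\<lambda>s. g s b)}"
        using a b mult[of a b] by (auto simp: BD characterD[OF g] intro: eq)
    qed
  qed (rule that)
  show ?thesis
    unfolding max_ideal_topology_def
    by (rule continuous_map_into_subtopology)
       (use cont g characterD(4) in \<open>auto simp: continuous_map_componentwise top\<close>)
qed

lemma homeomorphic_map_xi: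
  "homeomorphic_map (max_ideal_topology B) (M_topology A U) (\<lambda>x n. xi A U n x)"
proof -
  let ?f = "\<lambda>x n. xi A U n x"
  obtain g where g: "\<And>s. s \<in> M_union A U \<Longrightarrow> g s \<in> max_ideal_space B \<and> ?f (g s) = s"
    using xi_surjective by metis
  have "g (?f x) = x" if "x \<in> max_ideal_space B" for x
  proof (rule xi_injective)
    show "g (?f x) \<in> max_ideal_space B"
      using g[OF xi_M_union[OF that]] by simp
    show "xi A U n (g (?f x)) = xi A U n x" for n
      using fun_cong[OF conjunct2[OF g[OF xi_M_union[OF that]]], of n] .
  qed (rule that)
  moreover have "continuous_map (M_topology A U) (max_ideal_topology B) g"
  proof (rule continuous_map_inverse)
    show "xi A U n (g s) = s n" if "s \<in> M_union A U" for s n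
      using fun_cong[OF conjunct2[OF g[OF that]], of n] .
  qed (use g in simp)
  ultimately show ?thesis
    unfolding homeomorphic_map_maps homeomorphic_maps_def
    using continuous_map_xi g
    by (intro exI[of _ g]) (auto simp: topspace_max_ideal_topology topspace_M_topology[OF delta_image])
qed

lemma openin_M_hat: "openin (M_topology A U) (M_hat A U N)"
  unfolding openin_M_topology[OF delta_image]
proof (intro conjI ballI)
  show "M_hat A U N \<subseteq> M_union A U" by (auto simp: M_union_def)
  show "\<exists>C\<in>basic_nbhds A U s. C \<subseteq> M_hat A U N" if "s \<in> M_hat A U N" for s
    using basic_nbhds_hat[OF that, of "{}" 1]
    by (intro bexI[of _ "nbhd_hat A U N s {} 1"]) (auto simp: nbhd_hat_def)
qed

lemma closedin_M_inf: "closedin (M_topology A U) (M_inf A U)"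
proof -
  have "M_union A U - M_inf A U = (\<Union>N. M_hat A U N)"
    using M_hat_M_inf by (auto simp: M_union_def)
  moreover have "openin (M_topology A U) (\<Union>N. M_hat A U N)"
    using openin_M_hat by auto
  ultimately show ?thesis
    by (simp add: closedin_def topspace_M_topology[OF delta_image]) (simp add: M_union_def)
qed

text \<open>A point of \<open>M\<^sub>\<infinity>\<close> has a neighborhood that, outside \<open>M\<^sub>\<infinity>\<close>, meets only the pieces with last index above \<open>N\<close>.\<close>

lemma closedin_M_hat: "closedin (M_topology A U) (M_hat A U N)"
proof -
  have "openin (M_topology A U) (M_union A U - M_hat A U N)"
    unfolding openin_M_topology[OF delta_image]
  proof (intro conjI ballI)
    fix s assume s: "s \<in> M_union A U - M_hat A U N"
    then consider "s \<in> M_inf A U" | K where "s \<in> M_hat A U K" "K \<noteq> N"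
      unfolding M_union_def by auto
    then show "\<exists>C\<in>basic_nbhds A U s. C \<subseteq> M_union A U - M_hat A U N"
    proof cases
      case 1
      have "nbhd_inf A U s {} (Suc N) 1 \<subseteq> M_union A U - M_hat A U N"
      proof
        fix t assume "t \<in> nbhd_inf A U s {} (Suc N) 1"
        then consider "t \<in> M_inf A U" | K where "Suc N \<le> K" "t \<in> M_hat A U K"
          by (auto simp: nbhd_inf_def)
        then show "t \<in> M_union A U - M_hat A U N"
        proof cases
          case 1
          then show ?thesis using M_hat_M_inf[of t A U N] by (auto simp: M_union_def)
        next
          case 2
          then show ?thesis using M_hat_unique[of t A U N K] by (auto simp: M_union_def)
        qed
      qed
      then show ?thesis using basic_nbhds_inf[OF 1, of "{}" 1 "Suc N"] by auto
    next
      case 2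
      have "nbhd_hat A U K s {} 1 \<subseteq> M_union A U - M_hat A U N"
        using M_hat_unique[of _ A U N K] 2(2) by (auto simp: nbhd_hat_def M_union_def)
      then show ?thesis using basic_nbhds_hat[OF 2(1), of "{}" 1] by auto
    qed
  qed auto
  moreover have "M_hat A U N \<subseteq> M_union A U" by (auto simp: M_union_def)
  ultimately show ?thesis
    by (simp add: closedin_def topspace_M_topology[OF delta_image])
qed

end

theorem theorem3p4:
  fixes A :: "('h :: chilbert_space \<Rightarrow>\<^sub>L 'h) set" and U :: "'h \<Rightarrow>\<^sub>L 'h"
  assumes "comm_cstar_algebra A"
    and "id_blinfun \<in> A"
    and "U \<in> bounded_ops"
    and "star_endomorphism A (delta U)"
    and "adj U o\<^sub>L U \<in> A"
  shows "homeomorphic_map (max_ideal_topology (coeff_algebra A U)) (M_topology A U)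
           (\<lambda>x n. xi A U n x) \<and>
         topspace (M_topology A U) = (\<Union>N. M_hat A U N) \<union> M_inf A U \<and>
         disjoint_family (M_hat A U) \<and>
         (\<forall>N. M_hat A U N \<inter> M_inf A U = {}) \<and>
         (\<forall>N. openin (M_topology A U) (M_hat A U N) \<and> closedin (M_topology A U) (M_hat A U N)) \<and>
         closedin (M_topology A U) (M_inf A U)"
proof -
  interpret endomorphism_system A U
    by unfold_locales (rule assms)+
  have "disjoint_family (M_hat A U)"
    using M_hat_unique unfolding disjoint_family_on_def by blast
  moreover have "M_hat A U N \<inter> M_inf A U = {}" for N
    using M_hat_M_inf by blast
  ultimately show ?thesis
    using homeomorphic_map_xi openin_M_hat closedin_M_hat closedin_M_inf
      topspace_M_topology[OF delta_image] by (simp add: M_union_def)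
qed

end
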